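(* Let $0<\alpha<\frac12$, let $\Omega\subset(0,\alpha)$ be a finite set with a probability distribution $\mathbb P=(p_\beta)_{\beta\in\Omega}$, and let $\nu=\mathbb P^{\otimes\mathbb N}$ on $\Sigma=\Omega^{\mathbb N}$. Let $\varphi\in C^1([0,1])$, and write $\varphi_i(\omega,x):=\varphi(\mathcal T^i_\omega x)$ and $S_n(\omega,x):=\sum_{j=1}^n\varphi(\mathcal T^j_\omega x)$. Define the annealed variance $$\sigma^2:=\lim_{n\to\infty}\frac1n\Big\|S_n-\int_{\Sigma\times[0,1]}S_n\,d(\nu\otimes m)\Big\|^2_{L^2(\nu\otimes m)}=\sum_{k=0}^\infty(2-\delta_{0k})\lim_{i\to\infty}\int_\Sigma\big[m(\varphi_i\varphi_{i+k})-m(\varphi_i)\,m(\varphi_{i+k})\big]\,d\nu.$$ If $\sigma^2>0$, then for $\nu$-a.e. $\omega$ $$\frac1{\sqrt n}\sum_{j=1}^n\big[\varphi(\mathcal T^j_\omega\,\cdot)-m(\varphi\circ\mathcal T^j_\omega)\big]\to N(0,\sigma^2)$$ in distribution with respect to $m$ as $n\to\infty$.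
   Context: $m$ is Lebesgue measure on $[0,1]$ and $m(f)=\int_0^1 f\,dm$ (integration in $x$ with $\omega$ fixed). For $\beta\in(0,1)$ the intermittent map $T_\beta:[0,1]\to[0,1]$ is $T_\beta(x)=x+2^\beta x^{1+\beta}$ for $0\le x\le 1/2$ and $T_\beta(x)=2x-1$ for $1/2<x\le1$. For $\omega=(\omega_1,\omega_2,\dots)\in\Sigma$, $\mathcal T^j_\omega:=T_{\omega_j}\circ\cdots\circ T_{\omega_1}$. $\delta_{0k}$ is the Kronecker delta.
   Formalization: The displayed equality for σ² is false in general: the globally centred limit exceeds the series by lim Var_ν(m(S_n))/n. The identity is stated with this extra term, and σ² in the hypothesis and in the CLT is the series of fibrewise covariances. *)

theory Defs
  imports "HOL-Probability.Probability"
begin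

definition intermittent_map :: "real \<Rightarrow> real \<Rightarrow> real" where
  "intermittent_map \<beta> x =
     (if x \<le> 1/2 then x + 2 powr \<beta> * x powr (1 + \<beta>) else 2 * x - 1)"

text \<open>Parameter sequences are indexed from 0: the entry \<open>\<omega> i\<close> is the parameter written
  $\omega_{i+1}$ on paper, so \<open>random_orbit \<omega> j\<close> is
  $T_{\omega_j} \circ \cdots \circ T_{\omega_1}$.\<close>

primrec random_orbit :: "(nat \<Rightarrow> real) \<Rightarrow> nat \<Rightarrow> real \<Rightarrow> real" where
  "random_orbit \<omega> 0 x = x"
| "random_orbit \<omega> (Suc j) x = intermittent_map (\<omega> j) (random_orbit \<omega> j x)"

definition unit_lebesgue :: "real measure" where
  "unit_lebesgue = restrict_space lborel {0..1}"

definition noise :: "real set \<Rightarrow> (real \<Rightarrow> real) \<Rightarrow> (nat \<Rightarrow> real) measure" where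
  "noise \<Omega> p = (\<Pi>\<^sub>M i\<in>UNIV. point_measure \<Omega> (\<lambda>\<beta>. ennreal (p \<beta>)))"

definition obs :: "(real \<Rightarrow> real) \<Rightarrow> nat \<Rightarrow> (nat \<Rightarrow> real) \<Rightarrow> real \<Rightarrow> real" where
  "obs \<phi> i \<omega> x = \<phi> (random_orbit \<omega> i x)"

definition birkhoff_sum :: "(real \<Rightarrow> real) \<Rightarrow> nat \<Rightarrow> (nat \<Rightarrow> real) \<Rightarrow> real \<Rightarrow> real" where
  "birkhoff_sum \<phi> n \<omega> x = (\<Sum>j=1..n. obs \<phi> j \<omega> x)"

definition annealed_mean ::
    "real set \<Rightarrow> (real \<Rightarrow> real) \<Rightarrow> (real \<Rightarrow> real) \<Rightarrow> nat \<Rightarrow> real" where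
  "annealed_mean \<Omega> p \<phi> n =
     (LINT z|(noise \<Omega> p \<Otimes>\<^sub>M unit_lebesgue). birkhoff_sum \<phi> n (fst z) (snd z))"

definition annealed_L2_sq ::
    "real set \<Rightarrow> (real \<Rightarrow> real) \<Rightarrow> (real \<Rightarrow> real) \<Rightarrow> nat \<Rightarrow> real" where
  "annealed_L2_sq \<Omega> p \<phi> n =
     (LINT z|(noise \<Omega> p \<Otimes>\<^sub>M unit_lebesgue).
        (birkhoff_sum \<phi> n (fst z) (snd z) - annealed_mean \<Omega> p \<phi> n)\<^sup>2)"

text \<open>The variance under \<open>noise \<Omega> p\<close> of the fibrewise mean $m(S_n)$.\<close>

definition fibre_mean_L2_sq ::
    "real set \<Rightarrow> (real \<Rightarrow> real) \<Rightarrow> (real \<Rightarrow> real) \<Rightarrow> nat \<Rightarrow> real" where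
  "fibre_mean_L2_sq \<Omega> p \<phi> n =
     (LINT \<omega>|noise \<Omega> p.
        ((LINT x|unit_lebesgue. birkhoff_sum \<phi> n \<omega> x) - annealed_mean \<Omega> p \<phi> n)\<^sup>2)"

definition mean_fibre_cov ::
    "real set \<Rightarrow> (real \<Rightarrow> real) \<Rightarrow> (real \<Rightarrow> real) \<Rightarrow> nat \<Rightarrow> nat \<Rightarrow> real" where
  "mean_fibre_cov \<Omega> p \<phi> k i =
     (LINT \<omega>|noise \<Omega> p.
        (LINT x|unit_lebesgue. obs \<phi> i \<omega> x * obs \<phi> (i + k) \<omega> x)
        - (LINT x|unit_lebesgue. obs \<phi> i \<omega> x) * (LINT x|unit_lebesgue. obs \<phi> (i + k) \<omega> x))"

definition variance_term ::
    "real set \<Rightarrow> (real \<Rightarrow> real) \<Rightarrow> (real \<Rightarrow> real) \<Rightarrow> nat \<Rightarrow> real" where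
  "variance_term \<Omega> p \<phi> k = (2 - (if k = 0 then 1 else 0)) * lim (mean_fibre_cov \<Omega> p \<phi> k)"

text \<open>The limit \<open>annealed_variance\<close> centres $S_n$ by one constant, whereas the covariances in
  \<open>variance_series\<close> are centred separately in each fibre. By the law of total variance the two
  numbers differ by the limit of \<open>fibre_mean_L2_sq \<Omega> p \<phi> n / n\<close>, which is nonzero in general;
  the limit law of the fibrewise centred sums has variance \<open>variance_series\<close>.\<close>

definition annealed_variance ::
    "real set \<Rightarrow> (real \<Rightarrow> real) \<Rightarrow> (real \<Rightarrow> real) \<Rightarrow> real" where
  "annealed_variance \<Omega> p \<phi> = lim (\<lambda>n. annealed_L2_sq \<Omega> p \<phi> n / real n)"

definition variance_series ::
    "real set \<Rightarrow> (real \<Rightarrow> real) \<Rightarrow> (real \<Rightarrow> real) \<Rightarrow> real" where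
  "variance_series \<Omega> p \<phi> = (\<Sum>k. variance_term \<Omega> p \<phi> k)"

end

theory Submission
  imports Defs "HOL-Real_Asymp.Real_Asymp"
begin

text \<open>The transfer operators of the maps preserve the cone of decreasing functions \<open>f\<close> with
  \<open>x\<^bsup>1+\<alpha>\<^esup> f\<close> increasing and \<open>f \<le> 6 x\<^bsup>-\<alpha>\<^esup> m(f)\<close>. After \<open>n\<close> steps a decreasing density dominates a
  fixed fraction of the mass that has left the neighbourhood \<open>[0, n\<^bsup>-1/\<alpha>\<^esup>]\<close> of the neutral fixed
  point; subtracting constants repeatedly couples any two densities of the cone at a summable
  polynomial rate, uniformly in the parameter sequence. As Lipschitz multiples of cone functions
  are differences of cone functions, correlations are summable, and characteristic functions of
  Bernstein blocks of length \<open>o(\<surd>n)\<close> factorize approximately: over such a block the twisted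
  transfer operators enlarge the cone norm by a bounded factor only. This gives the central limit
  theorem for every parameter sequence along which the normalized variances converge. They
  converge almost surely because the fibrewise covariances forget the past of the sequence
  and therefore satisfy a strong law of large numbers.\<close>

section \<open>Integration over the unit interval\<close>

text \<open>The hypothesis \<alpha> < 1/2 acts mainly through one exponent. The mass of a cone
  density that has not escaped from 0 after n steps is at most of order n^(1 - 1/\<alpha>), and this
  exponent is below -1 exactly when \<alpha> < 1/2; covariances are then summable, and blocks
  shorter than sqrt n can be separated by gaps long enough to decouple all of them. Since the maps
  vary with time, there is no common invariant density or spectral gap to work with; every dynamical
  estimate is made uniform over all parameter sequences in (0, \<alpha>], and chance enters only
  through the convergence of the variances. Densities are unbounded at 0, so they are compared in L1
  and tested against bounded functions. Subtracting a constant may lead out of the cone, so the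
  coupling keeps two objects: a decreasing function that loses mass, and a cone function above it
  that controls the mass near 0. The fibrewise means fluctuate with the parameters; this contributes
  to the annealed variance but not to the quenched limit law, and is treated by the same mixing
  estimates as the covariances.\<close>

lemma prob_space_unit_lebesgue: "prob_space unit_lebesgue"
  unfolding unit_lebesgue_def by (auto intro!: prob_spaceI simp: emeasure_restrict_space space_restrict_space)

interpretation unit_lebesgue: prob_space unit_lebesgue
  by (rule prob_space_unit_lebesgue)

lemma space_unit_lebesgue [simp]: "space unit_lebesgue = {0..1}"
  by (simp add: unit_lebesgue_def space_restrict_space)

lemma sets_unit_lebesgue [measurable_cong]: "sets unit_lebesgue = sets (restrict_space borel {0..1})"
  by (simp add: unit_lebesgue_def sets_restrict_space)

text \<open>Densities are only controlled on (0, 1]: cone functions may blow up at the neutral fixed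
  point, and their value at 0 is arbitrary. Discarding this null set once lets all later pointwise
  hypotheses start with 0 < x.\<close>

lemma AE_unit_lebesgueI:
  assumes "\<And>x. 0 < x \<Longrightarrow> x \<le> 1 \<Longrightarrow> Q x"
  shows "AE x in unit_lebesgue. Q x"
proof -
  have "AE x in lborel. x \<noteq> (0::real)"
    by (rule AE_lborel_singleton)
  then have "AE x in lborel. x \<in> {0..1} \<longrightarrow> Q x"
    by eventually_elim (use assms in force)
  then show ?thesis
    unfolding unit_lebesgue_def by (subst AE_restrict_space_iff) auto
qed

lemma integral_unit_cong:
  fixes f g :: "real \<Rightarrow> real"
  assumes "integrable unit_lebesgue f" "integrable unit_lebesgue g"
    and "\<And>x. 0 < x \<Longrightarrow> x \<le> 1 \<Longrightarrow> f x = g x"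
  shows "(LINT x|unit_lebesgue. f x) = (LINT x|unit_lebesgue. g x)"
  using assms by (intro integral_cong_AE AE_unit_lebesgueI) auto

lemma integral_unit_mono:
  fixes f g :: "real \<Rightarrow> real"
  assumes "integrable unit_lebesgue f" "integrable unit_lebesgue g"
    and "\<And>x. 0 < x \<Longrightarrow> x \<le> 1 \<Longrightarrow> f x \<le> g x"
  shows "(LINT x|unit_lebesgue. f x) \<le> (LINT x|unit_lebesgue. g x)"
  using assms by (intro integral_mono_AE AE_unit_lebesgueI) auto

lemma integral_unit_nonneg:
  fixes f :: "real \<Rightarrow> real"
  assumes "\<And>x. 0 < x \<Longrightarrow> x \<le> 1 \<Longrightarrow> 0 \<le> f x"
  shows "0 \<le> (LINT x|unit_lebesgue. f x)"
  using assms by (intro integral_nonneg_AE AE_unit_lebesgueI) auto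

lemma integrable_unit_bounded_mult:
  fixes f g :: "real \<Rightarrow> real"
  assumes "integrable unit_lebesgue f" "g \<in> borel_measurable unit_lebesgue"
    and "\<And>x. x \<in> {0..1} \<Longrightarrow> \<bar>g x\<bar> \<le> B"
  shows "integrable unit_lebesgue (\<lambda>x. f x * g x)"
proof (rule Bochner_Integration.integrable_bound)
  show "integrable unit_lebesgue (\<lambda>x. B * f x)" using assms by simp
  show "(\<lambda>x. f x * g x) \<in> borel_measurable unit_lebesgue" using assms by measurable
  show "AE x in unit_lebesgue. norm (f x * g x) \<le> norm (B * f x)"
  proof (rule AE_unit_lebesgueI)
    fix x :: real assume "0 < x" "x \<le> 1"
    then have "\<bar>g x\<bar> \<le> \<bar>B\<bar>" using assms(3)[of x] by auto
    then have "\<bar>f x\<bar> * \<bar>g x\<bar> \<le> \<bar>f x\<bar> * \<bar>B\<bar>" by (intro mult_left_mono) auto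
    then show "norm (f x * g x) \<le> norm (B * f x)" by (simp add: abs_mult mult.commute)
  qed
qed

lemma integrable_unit_bounded:
  fixes g :: "real \<Rightarrow> real"
  assumes "g \<in> borel_measurable unit_lebesgue" "\<And>x. x \<in> {0..1} \<Longrightarrow> \<bar>g x\<bar> \<le> B"
  shows "integrable unit_lebesgue g"
  using integrable_unit_bounded_mult[of "\<lambda>_. 1" g B] assms by simp

text \<open>The change of variables formula for the inverse branches speaks of absolutely
  Henstock-Kurzweil integrable functions, that is of the completed Lebesgue measure. This carries it
  over to the Borel probability space \<open>unit_lebesgue\<close> and its subintervals.\<close>

lemma absolutely_integrable_unit_iff:
  fixes f :: "real \<Rightarrow> real"
  assumes [measurable]: "f \<in> borel_measurable unit_lebesgue" and S: "S \<in> sets borel" "S \<subseteq> {0..1}"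
  shows "f absolutely_integrable_on S \<longleftrightarrow> integrable unit_lebesgue (\<lambda>x. indicator S x * f x)" (is ?iff)
    and "f absolutely_integrable_on S \<Longrightarrow>
      integral S f = (LINT x|unit_lebesgue. indicator S x * f x)"
proof -
  have m: "(\<lambda>x. indicator {0..1} x * f x) \<in> borel_measurable borel"
    using assms(1) by (subst (asm) unit_lebesgue_def)
      (simp add: borel_measurable_restrict_space_iff)
  have eq: "(\<lambda>x. indicator S x * f x) = (\<lambda>x. indicator S x * (indicator {0..1} x * f x))"
    using S by (auto simp: fun_eq_iff indicator_def)
  have ms: "(\<lambda>x. indicator S x * f x) \<in> borel_measurable lborel"
    unfolding eq using m S by simp
  have eq': "(\<lambda>x. indicator {0..1} x *\<^sub>R (indicator S x * f x)) = (\<lambda>x. indicator S x * f x)"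
    using S by (auto simp: fun_eq_iff indicator_def)
  show ?iff
    unfolding set_integrable_def unit_lebesgue_def
    by (subst integrable_restrict_space) (use ms eq' in \<open>auto simp: integrable_completion\<close>)
  assume "f absolutely_integrable_on S"
  then have "integral S f = (LINT x|lebesgue. indicator S x *\<^sub>R f x)"
    by (simp add: set_lebesgue_integral_eq_integral(2)[symmetric] set_lebesgue_integral_def)
  also have "\<dots> = (LINT x|lborel. indicator S x * f x)"
    using ms by (simp add: integral_completion)
  also have "\<dots> = (LINT x|unit_lebesgue. indicator S x * f x)"
    unfolding unit_lebesgue_def by (subst integral_restrict_space) (use eq' in auto)
  finally show "integral S f = (LINT x|unit_lebesgue. indicator S x * f x)" .
qed

section \<open>The map and its inverse branches\<close>

definition left_deriv :: "real \<Rightarrow> real \<Rightarrow> real" where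
  "left_deriv \<beta> x = 1 + (1 + \<beta>) * (2 * x) powr \<beta>"

definition left_inverse :: "real \<Rightarrow> real \<Rightarrow> real" where
  "left_inverse \<beta> = inv_into {0..1/2} (intermittent_map \<beta>)"

lemma intermittent_map_left:
  assumes "0 \<le> x" "x \<le> 1/2"
  shows "intermittent_map \<beta> x = x * (1 + (2 * x) powr \<beta>)"
  using assms by (simp add: intermittent_map_def powr_add powr_mult algebra_simps)

lemma intermittent_map_right: "1/2 < x \<Longrightarrow> intermittent_map \<beta> x = 2 * x - 1"
  by (simp add: intermittent_map_def)

lemma left_deriv_bounds:
  assumes "0 < \<beta>" "\<beta> < 1" "0 \<le> x" "x \<le> 1/2"
  shows "1 \<le> left_deriv \<beta> x" "left_deriv \<beta> x \<le> 3"
proof -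
  have "(2 * x) powr \<beta> \<le> 1" using assms by (intro powr_le1) auto
  then have "(1 + \<beta>) * (2 * x) powr \<beta> \<le> 2 * 1" using assms by (intro mult_mono) auto
  then show "left_deriv \<beta> x \<le> 3" by (simp add: left_deriv_def)
  show "1 \<le> left_deriv \<beta> x" using assms by (simp add: left_deriv_def)
qed

lemma left_deriv_mono:
  assumes "0 < \<beta>" "0 \<le> x" "x \<le> y"
  shows "left_deriv \<beta> x \<le> left_deriv \<beta> y"
  unfolding left_deriv_def using assms by (auto intro!: mult_left_mono powr_mono2)

lemma has_derivative_left:
  assumes b: "0 < \<beta>" and x: "x \<in> {0..1/2}"
  shows "(intermittent_map \<beta> has_field_derivative left_deriv \<beta> x) (at x within {0..1/2})"
proof (cases "x = 0")
  case True
  \<comment> \<open>At the neutral fixed point the difference quotient is 1 + (2y)^\<beta> itself,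
    which tends to 1 because \<beta> > 0; the derivative rule for powers is applied at positive
    points only.\<close>
  have "((\<lambda>y::real. 1 + (2 * y) powr \<beta>) \<longlongrightarrow> 1 + 0 powr \<beta>) (at 0 within {0..1/2})"
    using b by (intro tendsto_intros tendsto_powr')
      (auto intro!: tendsto_eq_intros simp: eventually_at_filter)
  moreover have "\<forall>\<^sub>F y in at 0 within {0..1/2}.
      (intermittent_map \<beta> y - intermittent_map \<beta> 0) / (y - 0) = 1 + (2 * y) powr \<beta>"
    by (auto simp: eventually_at_filter intermittent_map_left)
  ultimately show ?thesis
    unfolding True has_field_derivative_iff using b
    by (subst tendsto_cong) (auto simp: left_deriv_def)
next
  case False
  then have x: "0 < x" "x \<le> 1/2" using x by auto
  have "((\<lambda>y. y + 2 powr \<beta> * y powr (1 + \<beta>)) has_field_derivative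
      1 + 2 powr \<beta> * ((1 + \<beta>) * x powr (1 + \<beta> - 1))) (at x within {0..1/2})"
    using x by (auto intro!: derivative_eq_intros)
  also have "1 + 2 powr \<beta> * ((1 + \<beta>) * x powr (1 + \<beta> - 1)) = left_deriv \<beta> x"
    using x by (simp add: left_deriv_def powr_mult)
  finally show ?thesis
    by (rule has_field_derivative_transform_within[of _ _ _ _ 1]) (use x in \<open>auto simp: intermittent_map_def\<close>)
qed

lemma strict_mono_left:
  assumes "0 < \<beta>" "0 \<le> x" "x < y" "y \<le> 1/2"
  shows "intermittent_map \<beta> x < intermittent_map \<beta> y"
proof -
  have "x * (1 + (2 * x) powr \<beta>) \<le> x * (1 + (2 * y) powr \<beta>)"
    using assms by (intro mult_left_mono add_left_mono powr_mono2) auto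
  also have "\<dots> < y * (1 + (2 * y) powr \<beta>)"
    using assms by (intro mult_strict_right_mono) (auto intro: add_pos_nonneg)
  finally show ?thesis using assms by (simp add: intermittent_map_left)
qed

lemma inj_on_left: "0 < \<beta> \<Longrightarrow> inj_on (intermittent_map \<beta>) {0..1/2}"
  by (rule inj_onI) (metis atLeastAtMost_iff less_irrefl linorder_neqE_linordered_idom strict_mono_left)

lemma image_left:
  assumes b: "0 < \<beta>"
  shows "intermittent_map \<beta> ` {0..1/2} = {0..1}"
proof
  have m: "intermittent_map \<beta> x \<le> intermittent_map \<beta> y" if "0 \<le> x" "x \<le> y" "y \<le> 1/2" for x y
    using strict_mono_left[OF b, of x y] that by (cases "x = y") auto
  show "intermittent_map \<beta> ` {0..1/2} \<subseteq> {0..1}"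
  proof
    fix z assume "z \<in> intermittent_map \<beta> ` {0..1/2}"
    then obtain x where x: "0 \<le> x" "x \<le> 1/2" "z = intermittent_map \<beta> x" by auto
    then show "z \<in> {0..1}"
      using m[of 0 x] m[of x "1/2"] by (simp add: intermittent_map_left)
  qed
  show "{0..1} \<subseteq> intermittent_map \<beta> ` {0..1/2}"
  proof
    fix z :: real assume z: "z \<in> {0..1}"
    have "continuous_on {0..1/2} (intermittent_map \<beta>)"
      using has_derivative_left[OF b] by (meson DERIV_continuous_on)
    then have "\<exists>x\<ge>0. x \<le> 1/2 \<and> intermittent_map \<beta> x = z"
      using z by (intro IVT') (auto simp: intermittent_map_left)
    then show "z \<in> intermittent_map \<beta> ` {0..1/2}" by force
  qed
qed

lemma left_inverse:
  assumes "0 < \<beta>" "0 \<le> x" "x \<le> 1"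
  shows "0 \<le> left_inverse \<beta> x" "left_inverse \<beta> x \<le> 1/2"
    "intermittent_map \<beta> (left_inverse \<beta> x) = x"
proof -
  have x: "x \<in> intermittent_map \<beta> ` {0..1/2}" using assms image_left by auto
  show "0 \<le> left_inverse \<beta> x" "left_inverse \<beta> x \<le> 1/2"
    using inv_into_into[OF x] by (auto simp: left_inverse_def)
  show "intermittent_map \<beta> (left_inverse \<beta> x) = x"
    using f_inv_into_f[OF x] by (simp add: left_inverse_def)
qed

lemma left_inverse_pos:
  assumes "0 < \<beta>" "0 < x" "x \<le> 1"
  shows "0 < left_inverse \<beta> x"
  using left_inverse[of \<beta> x] assms intermittent_map_left[of 0 \<beta>]
  by (metis less_eq_real_def mult_zero_left zero_le_divide_1_iff zero_le_numeral not_less)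

lemma left_inverse_map:
  assumes "0 < \<beta>" "0 \<le> x" "x \<le> 1/2"
  shows "left_inverse \<beta> (intermittent_map \<beta> x) = x"
  unfolding left_inverse_def using inj_on_left assms by (intro inv_into_f_f) auto

lemma left_inverse_mono:
  assumes "0 < \<beta>" "0 \<le> x" "x \<le> y" "y \<le> 1"
  shows "left_inverse \<beta> x \<le> left_inverse \<beta> y"
proof (rule ccontr)
  assume "\<not> ?thesis"
  then have "intermittent_map \<beta> (left_inverse \<beta> y) < intermittent_map \<beta> (left_inverse \<beta> x)"
    using left_inverse[of \<beta> x] left_inverse[of \<beta> y] assms by (intro strict_mono_left) auto
  then show False using left_inverse(3)[of \<beta> x] left_inverse(3)[of \<beta> y] assms by simp
qed

lemma left_inverse_one: "0 < \<beta> \<Longrightarrow> left_inverse \<beta> 1 = 1/2"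
  using left_inverse_map[of \<beta> "1/2"] by (simp add: intermittent_map_left)

lemma left_inverse_eq:
  assumes "0 < \<beta>" "0 \<le> x" "x \<le> 1"
  shows "x = left_inverse \<beta> x * (1 + (2 * left_inverse \<beta> x) powr \<beta>)"
  using left_inverse[OF assms] intermittent_map_left by metis

lemma measurable_left_inverse [measurable]:
  assumes b: "0 < \<beta>"
  shows "left_inverse \<beta> \<in> unit_lebesgue \<rightarrow>\<^sub>M unit_lebesgue"
proof -
  have "mono_on {0..1} (left_inverse \<beta>)"
    using left_inverse_mono[OF b] by (auto simp: mono_on_def)
  then have "left_inverse \<beta> \<in> restrict_space borel {0..1} \<rightarrow>\<^sub>M borel"
    by (rule borel_measurable_mono_on_fnc)
  moreover have "left_inverse \<beta> x \<in> {0..1}" if "x \<in> {0..1}" for x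
    using left_inverse[OF b, of x] that by auto
  ultimately have "left_inverse \<beta> \<in> restrict_space borel {0..1} \<rightarrow>\<^sub>M restrict_space borel {0..1}"
    by (intro measurable_restrict_space2) (auto simp: space_restrict_space)
  then show ?thesis
    by (simp add: measurable_cong_sets[OF sets_unit_lebesgue sets_unit_lebesgue])
qed

lemma measurable_intermittent_map [measurable]:
  "case_prod intermittent_map \<in> borel \<Otimes>\<^sub>M borel \<rightarrow>\<^sub>M borel"
  unfolding intermittent_map_def case_prod_beta by measurable

lemma intermittent_map_unit:
  assumes "0 < \<beta>" "x \<in> {0..1}"
  shows "intermittent_map \<beta> x \<in> {0..1}"
proof (cases "x \<le> 1/2")
  case True
  then show ?thesis using image_left[of \<beta>] assms by auto
qed (use assms in \<open>auto simp: intermittent_map_right\<close>)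

lemma intermittent_map_pos:
  assumes "0 < x" "x \<le> 1"
  shows "0 < intermittent_map \<beta> x"
  using assms by (cases "x \<le> 1/2") (auto simp: intermittent_map_left intermittent_map_right intro!: mult_pos_pos add_pos_nonneg)

section \<open>Transfer operators\<close>

text \<open>Density of the image of the mass f dm on [0, 1/2] under the left branch; together with
  the right branch this is the Perron-Frobenius operator with respect to m. The branches are kept
  apart because escape from 0 is measured by the left one alone.\<close>

definition left_transfer :: "real \<Rightarrow> (real \<Rightarrow> real) \<Rightarrow> real \<Rightarrow> real" where
  "left_transfer \<beta> f x = f (left_inverse \<beta> x) / left_deriv \<beta> (left_inverse \<beta> x)"

definition right_transfer :: "(real \<Rightarrow> real) \<Rightarrow> real \<Rightarrow> real" where
  "right_transfer f x = f ((x + 1) / 2) / 2"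

definition transfer :: "real \<Rightarrow> (real \<Rightarrow> real) \<Rightarrow> real \<Rightarrow> real" where
  "transfer \<beta> f x = left_transfer \<beta> f x + right_transfer f x"

lemma measurable_left_deriv [measurable]: "left_deriv \<beta> \<in> borel_measurable borel"
  unfolding left_deriv_def by measurable

lemma measurable_id_unit: "(\<lambda>x. x) \<in> unit_lebesgue \<rightarrow>\<^sub>M borel"
  unfolding unit_lebesgue_def by (rule measurable_restrict_space1) simp

lemma measurable_left_transfer [measurable]:
  assumes [measurable]: "f \<in> borel_measurable unit_lebesgue" and "0 < \<beta>"
  shows "left_transfer \<beta> f \<in> borel_measurable unit_lebesgue"
proof -
  note [measurable] = measurable_left_inverse[OF \<open>0 < \<beta>\<close>]
  have "(\<lambda>x. left_inverse \<beta> x) \<in> unit_lebesgue \<rightarrow>\<^sub>M borel"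
    using measurable_compose[OF measurable_left_inverse[OF \<open>0 < \<beta>\<close>] measurable_id_unit] by simp
  then have [measurable]: "(\<lambda>x. left_deriv \<beta> (left_inverse \<beta> x)) \<in> borel_measurable unit_lebesgue"
    by measurable
  show ?thesis unfolding left_transfer_def by measurable
qed

lemma measurable_right_transfer [measurable]:
  assumes [measurable]: "f \<in> borel_measurable unit_lebesgue"
  shows "right_transfer f \<in> borel_measurable unit_lebesgue"
proof -
  note [measurable] = measurable_id_unit
  have "(\<lambda>x::real. (x + 1) / 2) \<in> unit_lebesgue \<rightarrow>\<^sub>M restrict_space borel {0..1}"
    by (rule measurable_restrict_space2) auto
  then have [measurable]: "(\<lambda>x::real. (x + 1) / 2) \<in> unit_lebesgue \<rightarrow>\<^sub>M unit_lebesgue"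
    by (simp add: measurable_cong_sets[OF refl sets_unit_lebesgue])
  show ?thesis unfolding right_transfer_def by measurable
qed

lemma indicator_times_integrable:
  fixes f :: "real \<Rightarrow> real"
  assumes "integrable unit_lebesgue f" "S \<in> sets borel"
  shows "integrable unit_lebesgue (\<lambda>x. indicator S x * f x)"
proof -
  have "indicator S \<in> borel_measurable unit_lebesgue"
    using measurable_compose[OF measurable_id_unit, of "indicator S" borel] assms(2) by simp
  then show ?thesis
    using integrable_unit_bounded_mult[OF assms(1), of "indicator S" 1] by (simp add: mult.commute)
qed

lemma left_transfer_integral:
  assumes b: "0 < \<beta>" "\<beta> < 1" and f: "integrable unit_lebesgue f"
  shows "integrable unit_lebesgue (left_transfer \<beta> f)"
    and "(LINT x|unit_lebesgue. left_transfer \<beta> f x) = (LINT x|unit_lebesgue. indicator {0..1/2} x * f x)"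
proof -
  let ?F = "left_transfer \<beta> f"
  have F: "?F \<in> borel_measurable unit_lebesgue" using f b(1) by measurable
  have eq: "\<bar>left_deriv \<beta> x\<bar> * ?F (intermittent_map \<beta> x) = f x" if "x \<in> {0..1/2}" for x
    using that left_deriv_bounds(1)[OF b, of x] left_inverse_map[OF b(1), of x]
    by (simp add: left_transfer_def)
  have int: "f absolutely_integrable_on {0..1/2}"
    using f by (subst absolutely_integrable_unit_iff(1)) (auto intro: indicator_times_integrable)
  then have "(\<lambda>x. \<bar>left_deriv \<beta> x\<bar> * ?F (intermittent_map \<beta> x)) absolutely_integrable_on {0..1/2}"
    using eq by (subst set_integrable_cong[OF refl refl eq]) auto
  moreover have "integral {0..1/2} (\<lambda>x. \<bar>left_deriv \<beta> x\<bar> * ?F (intermittent_map \<beta> x)) = integral {0..1/2} f"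
    by (intro Henstock_Kurzweil_Integration.integral_cong eq)
  ultimately have *: "?F absolutely_integrable_on {0..1} \<and> integral {0..1} ?F = integral {0..1/2} f"
    using has_absolute_integral_change_of_variables_1'[of "{0..1/2}" "intermittent_map \<beta>"
        "left_deriv \<beta>" ?F "integral {0..1/2} f"]
      has_derivative_left[OF b(1)] inj_on_left[OF b(1)] image_left[OF b(1)] by simp
  have c: "integrable unit_lebesgue (\<lambda>x. indicator {0..1} x * ?F x) \<longleftrightarrow> integrable unit_lebesgue ?F"
    "(LINT x|unit_lebesgue. indicator {0..1} x * ?F x) = (LINT x|unit_lebesgue. ?F x)"
    by (auto intro!: Bochner_Integration.integrable_cong Bochner_Integration.integral_cong)
  show "integrable unit_lebesgue ?F"
    using absolutely_integrable_unit_iff(1)[OF F, of "{0..1}"] * c by auto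
  show "(LINT x|unit_lebesgue. ?F x) = (LINT x|unit_lebesgue. indicator {0..1/2} x * f x)"
    using absolutely_integrable_unit_iff(2)[OF F, of "{0..1}"] * c
      absolutely_integrable_unit_iff(2)[of f "{0..1/2}"] f int by auto
qed

lemma right_transfer_integral:
  assumes f: "integrable unit_lebesgue f"
  shows "integrable unit_lebesgue (right_transfer f)"
    and "(LINT x|unit_lebesgue. right_transfer f x) = (LINT x|unit_lebesgue. indicator {1/2..1} x * f x)"
proof -
  let ?F = "right_transfer f"
  have F: "?F \<in> borel_measurable unit_lebesgue" using f by measurable
  have eq: "\<bar>2\<bar> * ?F (2 * x - 1) = f x" for x
    by (simp add: right_transfer_def)
  have int: "f absolutely_integrable_on {1/2..1}"
    using f by (subst absolutely_integrable_unit_iff(1)) (auto intro: indicator_times_integrable)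
  have im: "(\<lambda>x::real. 2 * x - 1) ` {1/2..1} = {0..1}"
  proof -
    have "x \<in> (\<lambda>x::real. 2 * x - 1) ` {1/2..1}" if "x \<in> {0..1}" for x
      using that by (intro image_eqI[of _ _ "(x + 1) / 2"]) (auto simp: field_simps)
    then show ?thesis by auto
  qed
  have "((\<lambda>x::real. 2 * x - 1) has_field_derivative 2) (at x within {1/2..1})" for x
    by (auto intro!: derivative_eq_intros)
  then have *: "?F absolutely_integrable_on {0..1} \<and> integral {0..1} ?F = integral {1/2..1} f"
    using has_absolute_integral_change_of_variables_1'[of "{1/2..1}" "\<lambda>x. 2 * x - 1"
        "\<lambda>_. 2" ?F "integral {1/2..1} f"] int
    unfolding eq im by (auto simp: inj_on_def)
  have c: "integrable unit_lebesgue (\<lambda>x. indicator {0..1} x * ?F x) \<longleftrightarrow> integrable unit_lebesgue ?F"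
    "(LINT x|unit_lebesgue. indicator {0..1} x * ?F x) = (LINT x|unit_lebesgue. ?F x)"
    by (auto intro!: Bochner_Integration.integrable_cong Bochner_Integration.integral_cong)
  show "integrable unit_lebesgue ?F"
    using absolutely_integrable_unit_iff(1)[OF F, of "{0..1}"] * c by auto
  show "(LINT x|unit_lebesgue. ?F x) = (LINT x|unit_lebesgue. indicator {1/2..1} x * f x)"
    using absolutely_integrable_unit_iff(2)[OF F, of "{0..1}"] * c
      absolutely_integrable_unit_iff(2)[of f "{1/2..1}"] f int by auto
qed

lemma transfer_integral:
  assumes b: "0 < \<beta>" "\<beta> < 1" and f: "integrable unit_lebesgue f"
  shows "integrable unit_lebesgue (transfer \<beta> f)"
    and "(LINT x|unit_lebesgue. transfer \<beta> f x) = (LINT x|unit_lebesgue. f x)"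
proof -
  show "integrable unit_lebesgue (transfer \<beta> f)"
    using left_transfer_integral[OF b f] right_transfer_integral[OF f]
    unfolding transfer_def by auto
  have "(LINT x|unit_lebesgue. transfer \<beta> f x) =
      (LINT x|unit_lebesgue. indicator {0..1/2} x * f x + indicator {1/2..1} x * f x)"
    using left_transfer_integral[OF b f] right_transfer_integral[OF f] f
    unfolding transfer_def by (simp add: indicator_times_integrable)
  also have "\<dots> = (LINT x|unit_lebesgue. f x)"
  proof (rule integral_cong_AE)
    \<comment> \<open>The two closed halves overlap in the null set {1/2}.\<close>
    have "AE x in lborel. x \<noteq> (1/2::real)" by (rule AE_lborel_singleton)
    then have "AE x in lborel. x \<in> {0..1} \<longrightarrow> indicator {0..1/2} x * f x + indicator {1/2..1} x * f x = f x"
      by eventually_elim (auto simp: indicator_def)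
    then show "AE x in unit_lebesgue. indicator {0..1/2} x * f x + indicator {1/2..1} x * f x = f x"
      unfolding unit_lebesgue_def by (subst AE_restrict_space_iff) auto
  qed (use f in \<open>auto intro!: borel_measurable_integrable indicator_times_integrable\<close>)
  finally show "(LINT x|unit_lebesgue. transfer \<beta> f x) = (LINT x|unit_lebesgue. f x)" .
qed

text \<open>Concavity of the power, as the weighted arithmetic-geometric mean inequality for t and 1
  with weights a and 1 - a. With exponent \<alpha> it serves both the pointwise bound of the cone
  and the escape estimate.\<close>

lemma powr_Bernoulli_le:
  fixes a t :: real
  assumes "0 \<le> a" "a \<le> 1" "0 < t"
  shows "t powr a \<le> 1 + a * (t - 1)"
  using Youngs_inequality_0[of a "1 - a" t 1] assms by (simp add: algebra_simps)

section \<open>Order properties of one transfer operator and its interaction with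
  composition\<close>

lemma left_transfer_nonneg:
  assumes "0 < \<beta>" "\<beta> < 1" "\<And>x. 0 < x \<Longrightarrow> x \<le> 1 \<Longrightarrow> 0 \<le> f x" "0 < x" "x \<le> 1"
  shows "0 \<le> left_transfer \<beta> f x"
  unfolding left_transfer_def
  using left_inverse[of \<beta> x] left_inverse_pos[of \<beta> x] left_deriv_bounds(1)[of \<beta> "left_inverse \<beta> x"] assms
  by (intro divide_nonneg_nonneg) auto

lemma left_transfer_mono:
  assumes "0 < \<beta>" "\<beta> < 1" "\<And>x. 0 < x \<Longrightarrow> x \<le> 1 \<Longrightarrow> f x \<le> g x" "0 < x" "x \<le> 1"
  shows "left_transfer \<beta> f x \<le> left_transfer \<beta> g x"
  unfolding left_transfer_def
  using left_inverse[of \<beta> x] left_inverse_pos[of \<beta> x] left_deriv_bounds(1)[of \<beta> "left_inverse \<beta> x"] assms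
  by (intro divide_right_mono) auto

lemma right_transfer_mono:
  assumes "\<And>x. 0 < x \<Longrightarrow> x \<le> 1 \<Longrightarrow> f x \<le> g x" "0 < x" "x \<le> 1"
  shows "right_transfer f x \<le> right_transfer g x"
  unfolding right_transfer_def using assms by (intro divide_right_mono) auto

lemma transfer_mono:
  assumes "0 < \<beta>" "\<beta> < 1" "\<And>x. 0 < x \<Longrightarrow> x \<le> 1 \<Longrightarrow> f x \<le> g x" "0 < x" "x \<le> 1"
  shows "transfer \<beta> f x \<le> transfer \<beta> g x"
  unfolding transfer_def using assms by (intro add_mono left_transfer_mono right_transfer_mono) auto

lemma transfer_linear:
  "transfer \<beta> (\<lambda>x. a * f x + b * g x) = (\<lambda>x. a * transfer \<beta> f x + b * transfer \<beta> g x)"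
  by (simp add: fun_eq_iff transfer_def left_transfer_def right_transfer_def add_divide_distrib algebra_simps)

text \<open>The left inverse of x is mapped back to x, so a factor evaluated at x can be moved
  inside as a factor evaluated at the image. Integrated, such identities become the duality between
  transfer and composition.\<close>

lemma left_transfer_times:
  assumes "0 < \<beta>" "0 < x" "x \<le> 1"
  shows "left_transfer \<beta> f x * g x = left_transfer \<beta> (\<lambda>y. f y * g (intermittent_map \<beta> y)) x"
  using left_inverse(3)[of \<beta> x] assms by (simp add: left_transfer_def)

lemma transfer_times:
  assumes "0 < \<beta>" "0 < x" "x \<le> 1"
  shows "transfer \<beta> f x * g x = transfer \<beta> (\<lambda>y. f y * g (intermittent_map \<beta> y)) x"
proof -
  have "intermittent_map \<beta> ((x + 1) / 2) = x"
    using assms by (simp add: intermittent_map_right field_simps)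
  then show ?thesis
    using left_transfer_times[OF assms] by (simp add: transfer_def right_transfer_def distrib_right)
qed

section \<open>Transfer operators and orbits along a parameter sequence\<close>

primrec transfers :: "nat \<Rightarrow> (nat \<Rightarrow> real) \<Rightarrow> (real \<Rightarrow> real) \<Rightarrow> real \<Rightarrow> real" where
  "transfers 0 \<omega> f = f"
| "transfers (Suc n) \<omega> f = transfers n (\<lambda>i. \<omega> (Suc i)) (transfer (\<omega> 0) f)"

text \<open>Keeps only the mass whose orbit lies in the left half at all times 0, ..., n-1, that is,
  the mass that has not yet escaped.\<close>

primrec left_transfers :: "nat \<Rightarrow> (nat \<Rightarrow> real) \<Rightarrow> (real \<Rightarrow> real) \<Rightarrow> real \<Rightarrow> real" where
  "left_transfers 0 \<omega> f = f"
| "left_transfers (Suc n) \<omega> f = left_transfers n (\<lambda>i. \<omega> (Suc i)) (left_transfer (\<omega> 0) f)"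

lemma transfers_add: "transfers (n + k) \<omega> f = transfers k (\<lambda>i. \<omega> (i + n)) (transfers n \<omega> f)"
  by (induction n arbitrary: \<omega> f) auto

lemma transfers_linear:
  "transfers n \<omega> (\<lambda>x. a * f x + b * g x) = (\<lambda>x. a * transfers n \<omega> f x + b * transfers n \<omega> g x)"
  by (induction n arbitrary: \<omega> f g) (auto simp: transfer_linear)

lemma transfers_diff:
  "transfers n \<omega> (\<lambda>x. f x - g x) = (\<lambda>x. transfers n \<omega> f x - transfers n \<omega> g x)"
  using transfers_linear[of n \<omega> 1 f "-1" g] by simp

lemma transfers_cmult: "transfers n \<omega> (\<lambda>x. c * f x) = (\<lambda>x. c * transfers n \<omega> f x)"
  using transfers_linear[of n \<omega> c f 0 f] by simp

text \<open>\<open>transfers\<close> peels off the first map, so that inductions can generalize the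
  density, while \<open>random_orbit\<close> appends the last one; this reconciles the two
  recursions.\<close>

lemma random_orbit_Suc_front:
  "random_orbit \<omega> (Suc n) x = random_orbit (\<lambda>i. \<omega> (Suc i)) n (intermittent_map (\<omega> 0) x)"
  by (induction n) auto

lemma random_orbit_add:
  "random_orbit \<omega> (n + k) x = random_orbit (\<lambda>i. \<omega> (i + n)) k (random_orbit \<omega> n x)"
  by (induction k) (auto simp: add.commute)

text \<open>Larger than the cone defined below, and stable under subtraction of constants as long as
  the result stays nonnegative; the growth condition of the cone need not survive such a
  subtraction. The value at 0 is left free.\<close>

definition decreasing :: "(real \<Rightarrow> real) \<Rightarrow> bool" where
  "decreasing f \<longleftrightarrow> integrable unit_lebesgue f \<and>
     (\<forall>x y. 0 < x \<and> x \<le> y \<and> y \<le> 1 \<longrightarrow> 0 \<le> f y \<and> f y \<le> f x)"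

lemma decreasingD:
  assumes "decreasing f"
  shows "integrable unit_lebesgue f"
    and "0 < x \<Longrightarrow> x \<le> 1 \<Longrightarrow> 0 \<le> f x"
    and "0 < x \<Longrightarrow> x \<le> y \<Longrightarrow> y \<le> 1 \<Longrightarrow> f y \<le> f x"
  using assms by (auto simp: decreasing_def)

lemma decreasing_left_transfer:
  assumes b: "0 < \<beta>" "\<beta> < 1" and f: "decreasing f"
  shows "decreasing (left_transfer \<beta> f)"
proof -
  have "left_transfer \<beta> f y \<le> left_transfer \<beta> f x" if xy: "0 < x" "x \<le> y" "y \<le> 1" for x y
    unfolding left_transfer_def
    using left_inverse[of \<beta> x] left_inverse[of \<beta> y] left_inverse_pos[of \<beta> x] left_inverse_mono[of \<beta> x y]
      left_deriv_bounds(1)[of \<beta> "left_inverse \<beta> x"] xy b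
    by (intro frac_le left_deriv_mono decreasingD[OF f]) auto
  moreover have "0 \<le> left_transfer \<beta> f x" if "0 < x" "x \<le> 1" for x
    using left_transfer_nonneg[OF b] decreasingD[OF f] that by auto
  ultimately show ?thesis
    using left_transfer_integral[OF b decreasingD(1)[OF f]] by (auto simp: decreasing_def)
qed

lemma decreasing_right_transfer:
  assumes f: "decreasing f"
  shows "decreasing (right_transfer f)"
proof -
  have "0 \<le> right_transfer f y \<and> right_transfer f y \<le> right_transfer f x" if "0 < x" "x \<le> y" "y \<le> 1" for x y
    using decreasingD(2)[OF f, of "(y + 1) / 2"] decreasingD(3)[OF f, of "(x + 1) / 2" "(y + 1) / 2"] that
    by (simp add: right_transfer_def)
  then show ?thesis
    using right_transfer_integral[OF decreasingD(1)[OF f]] by (auto simp: decreasing_def)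
qed

lemma decreasing_add: "decreasing f \<Longrightarrow> decreasing g \<Longrightarrow> decreasing (\<lambda>x. f x + g x)"
  unfolding decreasing_def by (auto intro: add_mono)

lemma decreasing_transfer:
  assumes "0 < \<beta>" "\<beta> < 1" "decreasing f"
  shows "decreasing (transfer \<beta> f)"
  unfolding transfer_def
  using decreasing_add decreasing_left_transfer decreasing_right_transfer assms by blast

lemma decreasing_integral_le:
  assumes f: "decreasing f" and a: "0 < a" "a \<le> 1"
  shows "a * f a \<le> (LINT x|unit_lebesgue. f x)"
    and "(LINT x|unit_lebesgue. indicator {a..1} x * f x) \<le> (1 - a) * f a"
proof -
  have int: "integrable unit_lebesgue (\<lambda>x. indicator S x * c)" if "S \<in> sets borel" for S and c :: real
    using indicator_times_integrable[of "\<lambda>_. c"] that by simp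
  have val: "(LINT x|unit_lebesgue. indicator {u..v} x * c) = (v - u) * c"
    if "0 \<le> u" "u \<le> v" "v \<le> 1" for u v c :: real
  proof -
    have "(LINT x|unit_lebesgue. indicator {u..v} x * c) = measure unit_lebesgue {u..v} * c"
      using that by (simp add: unit_lebesgue.emeasure_eq_measure unit_lebesgue_def sets_restrict_space_iff measure_restrict_space)
    also have "measure unit_lebesgue {u..v} = v - u"
      using that unfolding unit_lebesgue_def by (subst measure_restrict_space) auto
    finally show ?thesis .
  qed
  have "a * f a = (LINT x|unit_lebesgue. indicator {0..a} x * f a)"
    using val[of 0 a "f a"] a by (metis diff_zero less_imp_le order_refl)
  also have "\<dots> \<le> (LINT x|unit_lebesgue. f x)"
    using decreasingD[OF f] a by (intro integral_unit_mono int) (auto simp: indicator_def)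
  finally show "a * f a \<le> (LINT x|unit_lebesgue. f x)" .
  have "(LINT x|unit_lebesgue. indicator {a..1} x * f x) \<le> (LINT x|unit_lebesgue. indicator {a..1} x * f a)"
    using decreasingD[OF f] a
    by (intro integral_unit_mono int indicator_times_integrable) (auto simp: indicator_def)
  also have "\<dots> = (1 - a) * f a"
    using val[of a 1 "f a"] a by simp
  finally show "(LINT x|unit_lebesgue. indicator {a..1} x * f x) \<le> (1 - a) * f a" .
qed

section \<open>Deterministic parameter sequences bounded by \<alpha>\<close>

locale intermittent =
  fixes \<alpha> :: real
  assumes alpha_pos: "0 < \<alpha>" and alpha_less: "\<alpha> < 1/2"
begin

text \<open>The dynamical estimates hold for arbitrary such sequences with constants independent of
  the sequence; this uniformity lets them be applied to every shift.\<close>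

definition admissible :: "(nat \<Rightarrow> real) \<Rightarrow> bool" where
  "admissible \<omega> \<longleftrightarrow> (\<forall>i. 0 < \<omega> i \<and> \<omega> i \<le> \<alpha>)"

lemma admissibleD:
  assumes "admissible \<omega>"
  shows "0 < \<omega> i" "\<omega> i \<le> \<alpha>" "\<omega> i < 1"
  using assms alpha_less unfolding admissible_def by (auto intro: le_less_trans[of "\<omega> i" \<alpha> 1])

lemma admissible_shift: "admissible \<omega> \<Longrightarrow> admissible (\<lambda>i. \<omega> (i + n))"
  and admissible_Suc: "admissible \<omega> \<Longrightarrow> admissible (\<lambda>i. \<omega> (Suc i))"
  by (auto simp: admissible_def)

lemma transfers_integral:
  assumes "admissible \<omega>" "integrable unit_lebesgue f"
  shows "integrable unit_lebesgue (transfers n \<omega> f)"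
    and "(LINT x|unit_lebesgue. transfers n \<omega> f x) = (LINT x|unit_lebesgue. f x)"
proof -
  have "integrable unit_lebesgue (transfers n \<omega> f) \<and>
      (LINT x|unit_lebesgue. transfers n \<omega> f x) = (LINT x|unit_lebesgue. f x)"
    using assms
  proof (induction n arbitrary: \<omega> f)
    case (Suc n)
    show ?case
      using Suc.IH[OF admissible_Suc[OF Suc.prems(1)], of "transfer (\<omega> 0) f"]
        transfer_integral[of "\<omega> 0" f] admissibleD[OF Suc.prems(1), of 0] Suc.prems(2)
      by simp
  qed auto
  then show "integrable unit_lebesgue (transfers n \<omega> f)"
    "(LINT x|unit_lebesgue. transfers n \<omega> f x) = (LINT x|unit_lebesgue. f x)" by auto
qed

lemma transfers_mono:
  assumes "admissible \<omega>" "\<And>x. 0 < x \<Longrightarrow> x \<le> 1 \<Longrightarrow> f x \<le> g x" "0 < x" "x \<le> 1"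
  shows "transfers n \<omega> f x \<le> transfers n \<omega> g x"
  using assms
proof (induction n arbitrary: \<omega> f g)
  case (Suc n)
  have "transfer (\<omega> 0) f y \<le> transfer (\<omega> 0) g y" if "0 < y" "y \<le> 1" for y
    using transfer_mono[of "\<omega> 0" f g y] admissibleD[OF Suc.prems(1), of 0] Suc.prems(2) that by auto
  then show ?case using Suc.IH[OF admissible_Suc[OF Suc.prems(1)]] Suc.prems(3,4) by simp
qed auto

lemma transfers_cong:
  assumes "admissible \<omega>" "\<And>x. 0 < x \<Longrightarrow> x \<le> 1 \<Longrightarrow> f x = g x" "0 < x" "x \<le> 1"
  shows "transfers n \<omega> f x = transfers n \<omega> g x"
  using transfers_mono[of \<omega> f g x n] transfers_mono[of \<omega> g f x n] assms by force

lemma decreasing_transfers: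
  assumes "admissible \<omega>" "decreasing f"
  shows "decreasing (transfers n \<omega> f)"
  using assms
proof (induction n arbitrary: \<omega> f)
  case (Suc n)
  then show ?case
    using admissible_Suc decreasing_transfer[of "\<omega> 0" f] admissibleD[OF Suc.prems(1), of 0] by simp
qed auto

text \<open>Positivity gives |P f| \<le> P |f| pointwise, and P preserves integrals.\<close>

lemma transfers_L1:
  assumes w: "admissible \<omega>" and f: "integrable unit_lebesgue f"
  shows "(LINT x|unit_lebesgue. \<bar>transfers n \<omega> f x\<bar>) \<le> (LINT x|unit_lebesgue. \<bar>f x\<bar>)"
proof -
  have "\<bar>transfers n \<omega> f x\<bar> \<le> transfers n \<omega> (\<lambda>x. \<bar>f x\<bar>) x" if x: "0 < x" "x \<le> 1" for x
  proof -
    have "transfers n \<omega> (\<lambda>x. - 1 * f x) x \<le> transfers n \<omega> (\<lambda>x. \<bar>f x\<bar>) x"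
      by (rule transfers_mono[OF w _ x]) auto
    moreover have "transfers n \<omega> f x \<le> transfers n \<omega> (\<lambda>x. \<bar>f x\<bar>) x"
      by (rule transfers_mono[OF w _ x]) auto
    ultimately show ?thesis unfolding transfers_cmult by auto
  qed
  then have "(LINT x|unit_lebesgue. \<bar>transfers n \<omega> f x\<bar>) \<le> (LINT x|unit_lebesgue. transfers n \<omega> (\<lambda>x. \<bar>f x\<bar>) x)"
    using transfers_integral(1)[OF w] f by (intro integral_unit_mono) auto
  also have "\<dots> = (LINT x|unit_lebesgue. \<bar>f x\<bar>)"
    using transfers_integral(2)[OF w] f by auto
  finally show ?thesis .
qed

lemma random_orbit_unit:
  assumes "admissible \<omega>" "x \<in> {0..1}"
  shows "random_orbit \<omega> n x \<in> {0..1}"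
  by (induction n) (use assms intermittent_map_unit admissibleD in \<open>auto simp del: atLeastAtMost_iff\<close>)

lemma measurable_random_orbit:
  "random_orbit \<omega> n \<in> borel_measurable borel"
proof (induction n)
  case (Suc n)
  note [measurable] = Suc
  have "(\<lambda>x. intermittent_map (\<omega> n) (random_orbit \<omega> n x)) \<in> borel_measurable borel"
    by measurable
  then show ?case by simp
qed auto

lemma measurable_compose_random_orbit:
  assumes w: "admissible \<omega>" and g: "g \<in> borel_measurable unit_lebesgue"
  shows "(\<lambda>x. g (random_orbit \<omega> n x)) \<in> borel_measurable unit_lebesgue"
proof -
  have "random_orbit \<omega> n \<in> unit_lebesgue \<rightarrow>\<^sub>M restrict_space borel {0..1}"
    by (rule measurable_restrict_space2)
      (use random_orbit_unit[OF w] measurable_compose[OF measurable_id_unit measurable_random_orbit] in auto)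
  then have "random_orbit \<omega> n \<in> unit_lebesgue \<rightarrow>\<^sub>M unit_lebesgue"
    by (simp add: measurable_cong_sets[OF refl sets_unit_lebesgue])
  then show ?thesis using g by (rule measurable_compose)
qed

lemma transfers_times:
  assumes "admissible \<omega>" "0 < x" "x \<le> 1"
  shows "transfers n \<omega> f x * g x = transfers n \<omega> (\<lambda>y. f y * g (random_orbit \<omega> n y)) x"
  using assms
proof (induction n arbitrary: \<omega> f)
  case (Suc n)
  have "transfers (Suc n) \<omega> f x * g x = transfers n (\<lambda>i. \<omega> (Suc i)) (transfer (\<omega> 0) f) x * g x"
    by simp
  also have "\<dots> = transfers n (\<lambda>i. \<omega> (Suc i))
      (\<lambda>y. transfer (\<omega> 0) f y * g (random_orbit (\<lambda>i. \<omega> (Suc i)) n y)) x"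
    using Suc.IH[OF admissible_Suc[OF Suc.prems(1)]] Suc.prems by blast
  also have "\<dots> = transfers n (\<lambda>i. \<omega> (Suc i))
      (transfer (\<omega> 0) (\<lambda>y. f y * g (random_orbit (\<lambda>i. \<omega> (Suc i)) n (intermittent_map (\<omega> 0) y)))) x"
    using transfer_times[of "\<omega> 0" _ f "\<lambda>y. g (random_orbit (\<lambda>i. \<omega> (Suc i)) n y)"] admissibleD(1)[OF Suc.prems(1)]
    by (intro transfers_cong[OF admissible_Suc[OF Suc.prems(1)] _ Suc.prems(2,3)]) blast
  finally show ?case by (simp add: random_orbit_Suc_front del: random_orbit.simps)
qed auto

lemma transfers_duality:
  assumes w: "admissible \<omega>" and f: "integrable unit_lebesgue f"
    and g: "g \<in> borel_measurable unit_lebesgue" "\<And>x. x \<in> {0..1} \<Longrightarrow> \<bar>g x\<bar> \<le> B"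
  shows "(LINT x|unit_lebesgue. transfers n \<omega> f x * g x)
    = (LINT x|unit_lebesgue. f x * g (random_orbit \<omega> n x))"
proof -
  have int: "integrable unit_lebesgue (\<lambda>x. f x * g (random_orbit \<omega> n x))"
    using integrable_unit_bounded_mult[OF f measurable_compose_random_orbit[OF w g(1)], of n B] g(2)
      random_orbit_unit[OF w] by auto
  have "(LINT x|unit_lebesgue. transfers n \<omega> f x * g x) =
      (LINT x|unit_lebesgue. transfers n \<omega> (\<lambda>y. f y * g (random_orbit \<omega> n y)) x)"
    using transfers_times[OF w] transfers_integral(1)[OF w] f g int
    by (intro integral_unit_cong integrable_unit_bounded_mult[of _ _ B]) auto
  also have "\<dots> = (LINT x|unit_lebesgue. f x * g (random_orbit \<omega> n x))"
    by (rule transfers_integral(2)[OF w int])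
  finally show ?thesis .
qed

section \<open>The invariant cone\<close>

text \<open>A cone of Liverani-Saussol-Vaienti type. The condition on x^(1+\<alpha>) f limits how
  fast f can fall, so that a lower bound near 0 propagates to 1; the bound by x^(-\<alpha>) controls
  the mass near 0. The constant 6 is the smallest for which the last inequality of
  \<open>cone_transfer\<close> closes with the estimates made there.\<close>

definition cone :: "(real \<Rightarrow> real) \<Rightarrow> bool" where
  "cone f \<longleftrightarrow> decreasing f \<and>
     (\<forall>x y. 0 < x \<and> x \<le> y \<and> y \<le> 1 \<longrightarrow> x powr (1 + \<alpha>) * f x \<le> y powr (1 + \<alpha>) * f y) \<and>
     (\<forall>x. 0 < x \<and> x \<le> 1 \<longrightarrow> f x \<le> 6 * x powr (- \<alpha>) * (LINT x|unit_lebesgue. f x))"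

lemma coneD:
  assumes "cone f"
  shows "decreasing f" "integrable unit_lebesgue f"
    and "0 < x \<Longrightarrow> x \<le> y \<Longrightarrow> y \<le> 1 \<Longrightarrow> x powr (1 + \<alpha>) * f x \<le> y powr (1 + \<alpha>) * f y"
    and "0 < x \<Longrightarrow> x \<le> 1 \<Longrightarrow> f x \<le> 6 * x powr (- \<alpha>) * (LINT x|unit_lebesgue. f x)"
    and "0 < x \<Longrightarrow> x \<le> 1 \<Longrightarrow> 0 \<le> f x" "0 \<le> (LINT x|unit_lebesgue. f x)"
  using assms decreasingD[of f] integral_unit_nonneg[of f] by (auto simp: cone_def)

lemma one_le_powr_neg: "0 < x \<Longrightarrow> x \<le> 1 \<Longrightarrow> 1 \<le> x powr (- \<alpha>)"
  using powr_mono'[of "- \<alpha>" 0 x] alpha_pos by simp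

lemma cone_const: "0 \<le> c \<Longrightarrow> cone (\<lambda>_. c)"
proof -
  assume c: "0 \<le> c"
  have "c \<le> 6 * x powr (- \<alpha>) * c" if "0 < x" "x \<le> 1" for x
    using mult_right_mono[of 1 "6 * x powr (- \<alpha>)" c] one_le_powr_neg[OF that] c by simp
  then show ?thesis
    using c alpha_pos unit_lebesgue.prob_space
    unfolding cone_def decreasing_def by (auto intro!: mult_right_mono powr_mono2)
qed

lemma cone_cmult:
  assumes f: "cone f" and c: "0 \<le> c"
  shows "cone (\<lambda>x. c * f x)"
proof -
  have "x powr (1 + \<alpha>) * (c * f x) \<le> y powr (1 + \<alpha>) * (c * f y)" if "0 < x" "x \<le> y" "y \<le> 1" for x y
    using mult_left_mono[OF coneD(3)[OF f that] c] by (simp add: algebra_simps)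
  moreover have "c * f x \<le> 6 * x powr (- \<alpha>) * (c * (LINT x|unit_lebesgue. f x))" if "0 < x" "x \<le> 1" for x
    using mult_left_mono[OF coneD(4)[OF f that] c] by (simp add: algebra_simps)
  ultimately show ?thesis
    using coneD(1)[OF f] c unfolding cone_def decreasing_def by (auto intro: mult_left_mono)
qed

lemma cone_add:
  assumes f: "cone f" "cone g"
  shows "cone (\<lambda>x. f x + g x)"
proof -
  have "x powr (1 + \<alpha>) * (f x + g x) \<le> y powr (1 + \<alpha>) * (f y + g y)" if "0 < x" "x \<le> y" "y \<le> 1" for x y
    using add_mono[OF coneD(3)[OF f(1) that] coneD(3)[OF f(2) that]] by (simp add: algebra_simps)
  moreover have "f x + g x \<le> 6 * x powr (- \<alpha>) * ((LINT x|unit_lebesgue. f x) + (LINT x|unit_lebesgue. g x))"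
    if "0 < x" "x \<le> 1" for x
    using add_mono[OF coneD(4)[OF f(1) that] coneD(4)[OF f(2) that]] by (simp add: algebra_simps)
  ultimately show ?thesis
    using coneD(1,2)[OF f(1)] coneD(1,2)[OF f(2)] decreasing_add unfolding cone_def by auto
qed

text \<open>The logarithmic derivative (1+\<alpha>)/(1+s) - (1+\<beta>)/(1+(1+\<beta>)s) is
  nonnegative because \<beta> \<le> \<alpha>. With s = (2y)^\<beta> for the left preimage y of x,
  the quotient is the factor between y^(1+\<alpha>) f(y) and x^(1+\<alpha>) times the left transfer
  of f at x.\<close>

lemma distortion_ratio_mono:
  assumes "0 < \<beta>" "\<beta> \<le> \<alpha>" "0 \<le> s" "s \<le> t"
  shows "(1 + s) powr (1 + \<alpha>) / (1 + (1 + \<beta>) * s) \<le> (1 + t) powr (1 + \<alpha>) / (1 + (1 + \<beta>) * t)"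
proof -
  have pos: "1 + (1 + \<beta>) * u > 0" if "0 \<le> u" for u using assms that by (intro add_pos_nonneg) auto
  have "(1 + \<alpha>) * ln (1 + s) - ln (1 + (1 + \<beta>) * s) \<le> (1 + \<alpha>) * ln (1 + t) - ln (1 + (1 + \<beta>) * t)"
  proof (rule DERIV_nonneg_imp_nondecreasing[OF assms(4)])
    fix u assume u: "s \<le> u" "u \<le> t"
    then have u0: "0 \<le> u" using assms by simp
    have "((\<lambda>u. (1 + \<alpha>) * ln (1 + u) - ln (1 + (1 + \<beta>) * u)) has_real_derivative
        (1 + \<alpha>) * (1 / (1 + u)) - (1 + \<beta>) / (1 + (1 + \<beta>) * u)) (at u)"
      using u0 pos[OF u0] by (auto intro!: derivative_eq_intros simp: divide_simps)
    moreover have "(1 + \<beta>) / (1 + (1 + \<beta>) * u) \<le> (1 + \<alpha>) * (1 / (1 + u))"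
    proof -
      have "(1 + \<beta>) * (1 + u) \<le> (1 + \<alpha>) * (1 + (1 + \<beta>) * u)"
        using assms u0 by (intro mult_mono) (auto simp: algebra_simps)
      then show ?thesis using u0 pos[OF u0] by (simp add: field_simps)
    qed
    ultimately show "\<exists>y. ((\<lambda>u. (1 + \<alpha>) * ln (1 + u) - ln (1 + (1 + \<beta>) * u)) has_real_derivative y) (at u) \<and> 0 \<le> y"
      by (intro exI conjI) auto
  qed
  then have "exp ((1 + \<alpha>) * ln (1 + s) - ln (1 + (1 + \<beta>) * s)) \<le> exp ((1 + \<alpha>) * ln (1 + t) - ln (1 + (1 + \<beta>) * t))"
    by simp
  then show ?thesis
    using assms pos[of s] pos[of t] by (simp add: exp_diff powr_def)
qed

text \<open>On the left branch x = y(1+s) with s = (2y)^\<beta>, so x^(1+\<alpha>) splits into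
  y^(1+\<alpha>) and (1+s)^(1+\<alpha>), and \<open>distortion_ratio_mono\<close> applies; on the
  right branch the analogous factor is a power of x / ((x+1)/2), again increasing. For the pointwise
  bound, division by the derivative 1+(1+\<beta>)s gains enough of order s to pay for the right
  branch, whose contribution is of order s relative to x^(-\<alpha>) m(f).\<close>

lemma cone_transfer:
  assumes b: "0 < \<beta>" "\<beta> \<le> \<alpha>" and f: "cone f"
  shows "cone (transfer \<beta> f)"
proof -
  have b1: "\<beta> < 1" using b alpha_less by simp
  let ?m = "LINT x|unit_lebesgue. f x"
  have left: "x powr (1 + \<alpha>) * left_transfer \<beta> f x =
      (left_inverse \<beta> x powr (1 + \<alpha>) * f (left_inverse \<beta> x)) *
      ((1 + (2 * left_inverse \<beta> x) powr \<beta>) powr (1 + \<alpha>) / (1 + (1 + \<beta>) * (2 * left_inverse \<beta> x) powr \<beta>))"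
    if x: "0 < x" "x \<le> 1" for x
  proof -
    have "x powr (1 + \<alpha>) = left_inverse \<beta> x powr (1 + \<alpha>) * (1 + (2 * left_inverse \<beta> x) powr \<beta>) powr (1 + \<alpha>)"
      using left_inverse_eq[of \<beta> x] x b by (simp flip: powr_mult)
    then show ?thesis by (simp add: left_transfer_def left_deriv_def)
  qed
  have "x powr (1 + \<alpha>) * transfer \<beta> f x \<le> y powr (1 + \<alpha>) * transfer \<beta> f y" if xy: "0 < x" "x \<le> y" "y \<le> 1" for x y
  proof -
    have "x powr (1 + \<alpha>) * left_transfer \<beta> f x \<le> y powr (1 + \<alpha>) * left_transfer \<beta> f y"
    proof -
      have m: "0 < left_inverse \<beta> x" "left_inverse \<beta> x \<le> left_inverse \<beta> y" "left_inverse \<beta> y \<le> 1/2"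
        using left_inverse_pos[of \<beta> x] left_inverse_mono[of \<beta> x y] left_inverse[of \<beta> y] xy b by auto
      have s: "(2 * left_inverse \<beta> x) powr \<beta> \<le> (2 * left_inverse \<beta> y) powr \<beta>"
        using m b by (intro powr_mono2) auto
      have x0: "0 < x" "x \<le> 1" "0 < y" "y \<le> 1" using xy by auto
      show ?thesis
        unfolding left[OF x0(1,2)] left[OF x0(3,4)]
      proof (rule mult_mono)
        show "left_inverse \<beta> x powr (1 + \<alpha>) * f (left_inverse \<beta> x) \<le> left_inverse \<beta> y powr (1 + \<alpha>) * f (left_inverse \<beta> y)"
          using m by (intro coneD(3)[OF f]) auto
        show "(1 + (2 * left_inverse \<beta> x) powr \<beta>) powr (1 + \<alpha>) / (1 + (1 + \<beta>) * (2 * left_inverse \<beta> x) powr \<beta>)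
          \<le> (1 + (2 * left_inverse \<beta> y) powr \<beta>) powr (1 + \<alpha>) / (1 + (1 + \<beta>) * (2 * left_inverse \<beta> y) powr \<beta>)"
          by (rule distortion_ratio_mono[OF b _ s]) simp
        show "0 \<le> left_inverse \<beta> y powr (1 + \<alpha>) * f (left_inverse \<beta> y)"
          using coneD(5)[OF f, of "left_inverse \<beta> y"] m by simp
        show "0 \<le> (1 + (2 * left_inverse \<beta> x) powr \<beta>) powr (1 + \<alpha>) / (1 + (1 + \<beta>) * (2 * left_inverse \<beta> x) powr \<beta>)"
          using b by (intro divide_nonneg_nonneg add_nonneg_nonneg mult_nonneg_nonneg) auto
      qed
    qed
    moreover have "x powr (1 + \<alpha>) * right_transfer f x \<le> y powr (1 + \<alpha>) * right_transfer f y"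
    proof -
      have eq: "z powr (1 + \<alpha>) * right_transfer f z =
          (((z + 1) / 2) powr (1 + \<alpha>) * f ((z + 1) / 2)) * (z / ((z + 1) / 2)) powr (1 + \<alpha>) / 2" if "0 < z" for z
      proof -
        have "((z + 1) / 2) powr (1 + \<alpha>) * (z / ((z + 1) / 2)) powr (1 + \<alpha>) = (((z + 1) / 2) * (z / ((z + 1) / 2))) powr (1 + \<alpha>)"
          by (rule powr_mult[symmetric])
        also have "((z + 1) / 2) * (z / ((z + 1) / 2)) = z"
          using that by simp
        finally show ?thesis by (simp add: right_transfer_def mult_ac)
      qed
      have "x / ((x + 1) / 2) \<le> y / ((y + 1) / 2)"
        using xy by (simp add: field_simps)
      then have "(x / ((x + 1) / 2)) powr (1 + \<alpha>) \<le> (y / ((y + 1) / 2)) powr (1 + \<alpha>)"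
        using xy alpha_pos by (intro powr_mono2) auto
      moreover have "((x + 1) / 2) powr (1 + \<alpha>) * f ((x + 1) / 2) \<le> ((y + 1) / 2) powr (1 + \<alpha>) * f ((y + 1) / 2)"
        using xy by (intro coneD(3)[OF f]) auto
      ultimately have "((x + 1) / 2) powr (1 + \<alpha>) * f ((x + 1) / 2) * (x / ((x + 1) / 2)) powr (1 + \<alpha>) / 2
          \<le> ((y + 1) / 2) powr (1 + \<alpha>) * f ((y + 1) / 2) * (y / ((y + 1) / 2)) powr (1 + \<alpha>) / 2"
        using xy coneD(5)[OF f, of "(y + 1) / 2"] by (intro divide_right_mono mult_mono[of "_ * _" "_ * _"]) auto
      then show ?thesis
        using xy by (subst (1 2) eq) auto
    qed
    ultimately show ?thesis by (simp add: transfer_def distrib_left)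
  qed
  moreover have "transfer \<beta> f x \<le> 6 * x powr (- \<alpha>) * ?m" if x: "0 < x" "x \<le> 1" for x
  proof -
    define u where "u = left_inverse \<beta> x"
    define s where "s = (2 * u) powr \<beta>"
    have u: "0 < u" "u \<le> 1/2" "x = u * (1 + s)"
      using left_inverse_pos[of \<beta> x] left_inverse[of \<beta> x] left_inverse_eq[of \<beta> x] x b by (auto simp: u_def s_def)
    have s: "0 < s" "s \<le> 1" using u b by (auto simp: s_def intro!: powr_le1)
    have "x powr (- \<alpha>) = u powr (- \<alpha>) * (1 + s) powr (- \<alpha>)"
      by (subst u(3)) (rule powr_mult)
    then have "u powr (- \<alpha>) = x powr (- \<alpha>) * (1 + s) powr \<alpha>"
      using s by (simp add: powr_minus)
    also have "\<dots> \<le> x powr (- \<alpha>) * (1 + \<alpha> * s)"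
      using powr_Bernoulli_le[of \<alpha> "1 + s"] alpha_pos alpha_less s by (intro mult_left_mono) auto
    finally have ub: "u powr (- \<alpha>) \<le> x powr (- \<alpha>) * (1 + \<alpha> * s)" .
    have "f u \<le> 6 * u powr (- \<alpha>) * ?m" using coneD(4)[OF f, of u] u by simp
    also have "\<dots> \<le> 6 * (x powr (- \<alpha>) * (1 + \<alpha> * s)) * ?m"
      using ub coneD(6)[OF f] alpha_pos s by (intro mult_mono) auto
    finally have "f u \<le> 6 * x powr (- \<alpha>) * ?m * (1 + \<alpha> * s)" by (simp add: algebra_simps)
    then have l: "left_transfer \<beta> f x \<le> 6 * x powr (- \<alpha>) * ?m * (1 + \<alpha> * s) / (1 + (1 + \<beta>) * s)"
      unfolding left_transfer_def left_deriv_def u_def[symmetric] s_def[symmetric]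
      using s b by (intro divide_right_mono) (auto intro!: add_nonneg_nonneg)
    have "right_transfer f x \<le> f (1/2) / 2"
      unfolding right_transfer_def using x by (intro divide_right_mono decreasingD(3)[OF coneD(1)[OF f]]) auto
    also have "\<dots> \<le> ?m" using decreasing_integral_le(1)[OF coneD(1)[OF f], of "1/2"] by simp
    \<comment> \<open>Splitting off x^(-\<alpha>) exhibits a factor x^\<alpha>, which is at most s
      because x \<le> 2u \<le> 1 + s and 2u \<le> 1 with \<beta> \<le> \<alpha>.\<close>
    also have "?m = x powr (- \<alpha>) * ?m * x powr \<alpha>" using x by (simp add: powr_minus)
    also have "x powr \<alpha> \<le> s"
    proof -
      have "x \<le> 2 * u" using u s by simp
      then have "x powr \<alpha> \<le> (2 * u) powr \<alpha>" using x alpha_pos by (intro powr_mono2) auto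
      also have "\<dots> \<le> (2 * u) powr \<beta>" using b u by (intro powr_mono') auto
      finally show ?thesis by (simp add: s_def)
    qed
    finally have r: "right_transfer f x \<le> x powr (- \<alpha>) * ?m * s"
      using coneD(6)[OF f] by (simp add: mult_left_mono)
    have pos: "0 < 1 + (1 + \<beta>) * s" using b s by (intro add_pos_nonneg) auto
    \<comment> \<open>This determines the 6: since \<alpha> < 1/2, the left branch saves at least 6s
      - 6s/2 = 3s in the numerator, and the right branch costs s times a derivative of at most
      3.\<close>
    have "6 * (1 + \<alpha> * s) / (1 + (1 + \<beta>) * s) + s \<le> 6"
    proof -
      have "(1 + \<beta>) * s \<le> 2 * 1" using b1 b s by (intro mult_mono) auto
      then have "s * (1 + (1 + \<beta>) * s) \<le> s * 3" using s by (intro mult_left_mono) auto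
      moreover have "\<alpha> * s \<le> 1/2 * s" using alpha_less s by (intro mult_right_mono) auto
      moreover have "0 \<le> \<beta> * s" using b s by simp
      ultimately have "6 * (1 + \<alpha> * s) + s * (1 + (1 + \<beta>) * s) \<le> 6 * (1 + (1 + \<beta>) * s)"
        by (simp add: algebra_simps)
      then show ?thesis using pos by (simp add: field_simps)
    qed
    then have "x powr (- \<alpha>) * ?m * (6 * (1 + \<alpha> * s) / (1 + (1 + \<beta>) * s) + s) \<le> x powr (- \<alpha>) * ?m * 6"
      using coneD(6)[OF f] by (intro mult_left_mono) auto
    then show ?thesis using l r by (simp add: transfer_def algebra_simps)
  qed
  ultimately show ?thesis
    using decreasing_transfer[OF b(1) b1 coneD(1)[OF f]] transfer_integral(2)[OF b(1) b1 coneD(2)[OF f]]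
    by (simp add: cone_def)
qed

lemma cone_transfers:
  assumes "admissible \<omega>" "cone f"
  shows "cone (transfers n \<omega> f)"
  using assms
proof (induction n arbitrary: \<omega> f)
  case (Suc n)
  then show ?case
    using admissible_Suc cone_transfer[of "\<omega> 0" f] admissibleD[OF Suc.prems(1), of 0] by simp
qed auto

end

section \<open>Memory loss\<close>

context intermittent
begin

text \<open>Integrating x^(-\<alpha>) over [0, b] gives b^(1-\<alpha>) / (1-\<alpha>), and
  1/(1-\<alpha>) \<le> 2 doubles the constant 6 of the cone.\<close>

lemma cone_near_zero:
  assumes f: "cone f" and b: "0 < b" "b \<le> 1"
  shows "(LINT x|unit_lebesgue. indicator {0..b} x * f x) \<le> 12 * b powr (1 - \<alpha>) * (LINT x|unit_lebesgue. f x)"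
proof -
  let ?m = "LINT x|unit_lebesgue. f x"
  have hi: "((\<lambda>x. x powr (- \<alpha>)) has_integral (b powr (- \<alpha> + 1) / (- \<alpha> + 1))) {0..b}"
    using alpha_less b by (intro has_integral_powr_from_0) auto
  have ai: "(\<lambda>x. x powr (- \<alpha>)) absolutely_integrable_on {0..b}"
    using hi by (intro nonnegative_absolutely_integrable_1) (auto simp: integrable_on_def)
  have pm: "(\<lambda>x. x powr (- \<alpha>)) \<in> borel_measurable unit_lebesgue"
    by (rule measurable_compose[OF measurable_id_unit]) measurable
  have int: "integrable unit_lebesgue (\<lambda>x. indicator {0..b} x * x powr (- \<alpha>))"
    using absolutely_integrable_unit_iff(1)[OF pm, of "{0..b}"] ai b by auto
  have "(LINT x|unit_lebesgue. indicator {0..b} x * x powr (- \<alpha>)) = b powr (- \<alpha> + 1) / (- \<alpha> + 1)"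
    using absolutely_integrable_unit_iff(2)[OF pm, of "{0..b}"] ai b integral_unique[OF hi] by simp
  also have "\<dots> \<le> b powr (1 - \<alpha>) / (1/2)"
    using alpha_less by (subst add.commute, intro frac_le) auto
  finally have le: "(LINT x|unit_lebesgue. indicator {0..b} x * x powr (- \<alpha>)) \<le> 2 * b powr (1 - \<alpha>)" by simp
  have "(LINT x|unit_lebesgue. indicator {0..b} x * f x) \<le>
      (LINT x|unit_lebesgue. (6 * ?m) * (indicator {0..b} x * x powr (- \<alpha>)))"
    using coneD(4)[OF f] int coneD(2)[OF f]
    by (intro integral_unit_mono indicator_times_integrable) (auto simp: indicator_def algebra_simps)
  also have "\<dots> = (6 * ?m) * (LINT x|unit_lebesgue. indicator {0..b} x * x powr (- \<alpha>))"
    by simp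
  also have "\<dots> \<le> (6 * ?m) * (2 * b powr (1 - \<alpha>))"
    using le coneD(6)[OF f] by (intro mult_left_mono) auto
  finally show ?thesis by (simp add: algebra_simps)
qed

text \<open>The constant is \<open>2 * 576\<^sup>2\<close>, where \<open>d = 1/576\<close> makes the bound \<open>12 d\<^bsup>1-\<alpha>\<^esup>\<close> of
  \<open>cone_near_zero\<close> at most \<open>1/2\<close>. The denominators 1327104 and 1990656 below are its double and triple.\<close>

lemma cone_lower_bound:
  assumes f: "cone f" and x: "0 < x" "x \<le> 1"
  shows "(LINT x|unit_lebesgue. f x) / 663552 \<le> f x"
proof -
  let ?m = "LINT x|unit_lebesgue. f x"
  define d :: real where "d = 1/576"
  have d: "0 < d" "d \<le> 1" by (auto simp: d_def)
  have "d powr (1 - \<alpha>) \<le> d powr (1/2)"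
    using d alpha_less by (intro powr_mono') auto
  also have "d powr (1/2) = 1/24"
    unfolding d_def by (simp add: powr_half_sqrt real_sqrt_divide real_sqrt_unique[of 24])
  finally have "12 * d powr (1 - \<alpha>) * ?m \<le> 12 * (1/24) * ?m"
    using coneD(6)[OF f] by (intro mult_right_mono mult_left_mono) auto
  then have near: "(LINT x|unit_lebesgue. indicator {0..d} x * f x) \<le> ?m / 2"
    using cone_near_zero[OF f d] by simp
  \<comment> \<open>At least half of the mass lies beyond d, so the decreasing f is at least m/2 at
    d; the growth condition carries this to the point 1 at the price of d^(1+\<alpha>).\<close>
  have "?m \<le> (LINT x|unit_lebesgue. indicator {0..d} x * f x + indicator {d..1} x * f x)"
    using coneD(2,5)[OF f] by (intro integral_unit_mono Bochner_Integration.integrable_add indicator_times_integrable) (auto simp: indicator_def)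
  also have "\<dots> = (LINT x|unit_lebesgue. indicator {0..d} x * f x) + (LINT x|unit_lebesgue. indicator {d..1} x * f x)"
    using coneD(2)[OF f] by (intro Bochner_Integration.integral_add indicator_times_integrable) auto
  also have "(LINT x|unit_lebesgue. indicator {d..1} x * f x) \<le> (1 - d) * f d"
    by (rule decreasing_integral_le(2)[OF coneD(1)[OF f] d])
  also have "\<dots> \<le> f d" using d coneD(5)[OF f d] by (simp add: mult_left_le_one_le)
  finally have fd: "?m / 2 \<le> f d" using near by simp
  have "d\<^sup>2 * f d \<le> d powr (1 + \<alpha>) * f d"
  proof (rule mult_right_mono[OF _ coneD(5)[OF f d]])
    have "d powr 2 \<le> d powr (1 + \<alpha>)" using d alpha_less by (intro powr_mono') auto
    then show "d\<^sup>2 \<le> d powr (1 + \<alpha>)" using d by simp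
  qed
  also have "\<dots> \<le> f 1" using coneD(3)[OF f, of d 1] d by simp
  also have "f 1 \<le> f x" using decreasingD(3)[OF coneD(1)[OF f] x(1,2)] by simp
  finally have "d\<^sup>2 * f d \<le> f x" .
  moreover have "d\<^sup>2 * (?m / 2) \<le> d\<^sup>2 * f d" using fd by (intro mult_left_mono) auto
  ultimately show ?thesis by (simp add: d_def power2_eq_square)
qed

text \<open>The solution of a(n+1)^(-\<alpha>) = a(n)^(-\<alpha>) + \<alpha>/2 with a(0) = 1: points
  that spend n steps in the left half lie below a(n), whatever the parameters.\<close>

definition escape_bound :: "nat \<Rightarrow> real" where
  "escape_bound n = (1 + \<alpha> / 2 * real n) powr (- 1 / \<alpha>)"

lemma escape_bound_bounds: "0 < escape_bound n" "escape_bound n \<le> 1"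
proof -
  have "1 \<le> 1 + \<alpha> / 2 * real n" using alpha_pos by simp
  then show "0 < escape_bound n" unfolding escape_bound_def by (simp add: powr_gt_zero)
  show "escape_bound n \<le> 1"
    using powr_mono2'[of "- 1 / \<alpha>" 1 "1 + \<alpha> / 2 * real n"] alpha_pos by (simp add: escape_bound_def)
qed

text \<open>In the coordinate x^(-\<alpha>) the left branch moves every point by at least a
  constant: with s = (2x)^\<beta> the factor (1+s)^(-\<alpha>) is at most 1 - \<alpha> s/2, and
  x^(-\<alpha>) s \<ge> 1 because s \<ge> (2x)^\<alpha> \<ge> x^\<alpha>. As \<beta> matters only in
  the last inequality, the bound is uniform in the parameter.\<close>

lemma map_powr_neg_le:
  assumes b: "0 < \<beta>" "\<beta> \<le> \<alpha>" and x: "0 < x" "x \<le> 1/2"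
  shows "intermittent_map \<beta> x powr (- \<alpha>) + \<alpha> / 2 \<le> x powr (- \<alpha>)"
proof -
  define s where "s = (2 * x) powr \<beta>"
  have s: "0 < s" "s \<le> 1" using x b by (auto simp: s_def intro!: powr_le1)
  have "(1 + s) powr (- \<alpha>) = (1 / (1 + s)) powr \<alpha>"
    by (simp add: powr_minus powr_divide field_simps)
  also have "\<dots> \<le> 1 + \<alpha> * (1 / (1 + s) - 1)"
    using powr_Bernoulli_le[of \<alpha> "1 / (1 + s)"] alpha_pos alpha_less s by simp
  also have "1 / (1 + s) - 1 \<le> - s / 2"
    using s mult_left_mono[of s 1 s] by (simp add: field_simps)
  finally have 1: "(1 + s) powr (- \<alpha>) \<le> 1 - \<alpha> * s / 2"
    using alpha_pos by (simp add: algebra_simps)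
  have "intermittent_map \<beta> x powr (- \<alpha>) = x powr (- \<alpha>) * (1 + s) powr (- \<alpha>)"
    using x by (simp add: intermittent_map_left s_def powr_mult)
  also have "\<dots> \<le> x powr (- \<alpha>) * (1 - \<alpha> * s / 2)"
    using 1 by (intro mult_left_mono) auto
  finally have 2: "intermittent_map \<beta> x powr (- \<alpha>) \<le> x powr (- \<alpha>) - \<alpha> / 2 * (x powr (- \<alpha>) * s)"
    by (simp add: algebra_simps)
  have "x powr \<alpha> \<le> (2 * x) powr \<alpha>" using x alpha_pos by (intro powr_mono2) auto
  also have "\<dots> \<le> s" unfolding s_def using b x by (intro powr_mono') auto
  finally have "x powr (- \<alpha>) * x powr \<alpha> \<le> x powr (- \<alpha>) * s" by (intro mult_left_mono) auto
  then have "1 \<le> x powr (- \<alpha>) * s" using x by (simp add: powr_minus)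
  then have "\<alpha> / 2 * 1 \<le> \<alpha> / 2 * (x powr (- \<alpha>) * s)" using alpha_pos by (intro mult_left_mono) auto
  then show ?thesis using 2 by simp
qed

lemma escape_bound_Suc:
  assumes b: "0 < \<beta>" "\<beta> \<le> \<alpha>" and x: "0 < x" "x \<le> 1/2"
    and le: "intermittent_map \<beta> x \<le> escape_bound n"
  shows "x \<le> escape_bound (Suc n)"
proof -
  let ?A = "1 + \<alpha> / 2 * real n"
  have A: "1 \<le> ?A" using alpha_pos by simp
  have "?A = escape_bound n powr (- \<alpha>)"
    unfolding escape_bound_def using A alpha_pos by (simp add: powr_powr)
  also have "\<dots> \<le> intermittent_map \<beta> x powr (- \<alpha>)"
    using le alpha_pos intermittent_map_pos[of x \<beta>] x by (intro powr_mono2') auto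
  finally have "?A + \<alpha> / 2 \<le> x powr (- \<alpha>)"
    using map_powr_neg_le[OF b x] by simp
  then have "(x powr (- \<alpha>)) powr (- 1 / \<alpha>) \<le> (?A + \<alpha> / 2) powr (- 1 / \<alpha>)"
    using A alpha_pos by (intro powr_mono2') (auto intro!: add_pos_nonneg)
  then show ?thesis
    using x alpha_pos by (simp add: powr_powr escape_bound_def field_simps)
qed

text \<open>The indicator of [0, \<open>escape_bound n\<close>] is pulled back through one left
  branch at a time; \<open>escape_bound_Suc\<close> says where its preimage in the left half
  lies.\<close>

lemma left_transfers_integral_le:
  assumes "admissible \<omega>" "integrable unit_lebesgue f" "\<And>x. 0 < x \<Longrightarrow> x \<le> 1 \<Longrightarrow> 0 \<le> f x"
  shows "(LINT x|unit_lebesgue. left_transfers n \<omega> f x) \<le> (LINT x|unit_lebesgue. indicator {0..escape_bound n} x * f x)"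
  using assms
proof (induction n arbitrary: \<omega> f)
  case 0
  have "escape_bound 0 = 1" by (simp add: escape_bound_def)
  then show ?case
    using 0 by (intro integral_unit_mono indicator_times_integrable) auto
next
  case (Suc n)
  let ?b = "\<omega> 0" and ?Q = "left_transfer (\<omega> 0) f" and ?e = "escape_bound n"
  have b: "0 < ?b" "?b < 1" "?b \<le> \<alpha>" using admissibleD[OF Suc.prems(1)] by auto
  let ?g = "\<lambda>y. f y * indicator {0..?e} (intermittent_map ?b y)"
  have [measurable]: "intermittent_map ?b \<in> borel_measurable borel" by measurable
  have "(\<lambda>y. indicator {0..?e} (intermittent_map ?b y) :: real) \<in> borel_measurable unit_lebesgue"
    by (rule measurable_compose[OF measurable_id_unit]) measurable
  then have g: "integrable unit_lebesgue ?g"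
    by (intro integrable_unit_bounded_mult[OF Suc.prems(2), of _ 1]) auto
  have "(LINT x|unit_lebesgue. left_transfers (Suc n) \<omega> f x) \<le>
      (LINT x|unit_lebesgue. indicator {0..?e} x * ?Q x)"
    using Suc.IH[OF admissible_Suc[OF Suc.prems(1)] left_transfer_integral(1)[OF b(1,2) Suc.prems(2)]]
      left_transfer_nonneg[OF b(1,2)] Suc.prems(3) by simp
  also have "\<dots> = (LINT x|unit_lebesgue. left_transfer ?b ?g x)"
    using left_transfer_integral(1)[OF b(1,2) Suc.prems(2)] left_transfer_integral(1)[OF b(1,2) g]
      left_transfer_times[OF b(1), of _ f "indicator {0..?e}"]
    by (intro integral_unit_cong indicator_times_integrable) (auto simp: mult.commute)
  also have "\<dots> = (LINT x|unit_lebesgue. indicator {0..1/2} x * ?g x)"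
    by (rule left_transfer_integral(2)[OF b(1,2) g])
  also have "\<dots> \<le> (LINT x|unit_lebesgue. indicator {0..escape_bound (Suc n)} x * f x)"
  proof (rule integral_unit_mono)
    fix x :: real assume x: "0 < x" "x \<le> 1"
    show "indicator {0..1/2} x * ?g x \<le> indicator {0..escape_bound (Suc n)} x * f x"
      using escape_bound_Suc[OF b(1,3) x(1), of n] Suc.prems(3)[OF x] x by (auto simp: indicator_def)
  qed (use g Suc.prems(2) in \<open>auto intro!: indicator_times_integrable\<close>)
  finally show ?case .
qed

text \<open>Each step sends the mass in the right half back to the whole interval with a density that is
  at least half the value at 1, while the mass in the right half is at most 3/2 of the value at 1
  that the left branch produces one step later. Comparing these two estimates avoids any
  distortion bound.\<close>

lemma transfers_ge_sum:
  assumes "admissible \<omega>" "decreasing f" "0 < x" "x \<le> 1"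
  shows "(\<Sum>i<n. left_transfers i \<omega> f 1) / 1327104 \<le> transfers n \<omega> f x"
  using assms
proof (induction n arbitrary: \<omega> f)
  case 0
  then show ?case using decreasingD(2) by simp
next
  case (Suc n)
  let ?w = "\<lambda>i. \<omega> (Suc i)" and ?b = "\<omega> 0"
  have b: "0 < ?b" "?b < 1" and w: "admissible ?w"
    using admissibleD[OF Suc.prems(1)] admissible_Suc[OF Suc.prems(1)] by auto
  have "(\<Sum>i<n. left_transfers i ?w (left_transfer ?b f) 1) / 1327104 \<le> transfers n ?w (left_transfer ?b f) x"
    by (rule Suc.IH[OF w decreasing_left_transfer[OF b Suc.prems(2)] Suc.prems(3,4)])
  \<comment> \<open>The image of the right half is at least f(1)/2 everywhere, a constant and hence
    a cone function; \<open>cone_lower_bound\<close> then bounds all its later images from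
    below.\<close>
  moreover have "f 1 / 1327104 \<le> transfers n ?w (right_transfer f) x"
  proof -
    have "cone (\<lambda>_. f 1 / 2)" using decreasingD(2)[OF Suc.prems(2), of 1] by (intro cone_const) simp
    then have "(LINT x|unit_lebesgue. transfers n ?w (\<lambda>_. f 1 / 2) x) / 663552 \<le> transfers n ?w (\<lambda>_. f 1 / 2) x"
      by (intro cone_lower_bound[OF cone_transfers[OF w] Suc.prems(3,4)])
    moreover have "(LINT x|unit_lebesgue. transfers n ?w (\<lambda>_. f 1 / 2) x) = f 1 / 2"
      using transfers_integral(2)[OF w, of "\<lambda>_. f 1 / 2" n] unit_lebesgue.prob_space by simp
    ultimately have "f 1 / 2 / 663552 \<le> transfers n ?w (\<lambda>_. f 1 / 2) x"
      by simp
    also have "\<dots> \<le> transfers n ?w (right_transfer f) x"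
      using Suc.prems decreasingD(3)[OF Suc.prems(2)]
      by (intro transfers_mono[OF w]) (auto simp: right_transfer_def)
    finally show ?thesis by simp
  qed
  moreover have "transfers (Suc n) \<omega> f x = transfers n ?w (left_transfer ?b f) x + transfers n ?w (right_transfer f) x"
    using transfers_linear[of n ?w 1 "left_transfer ?b f" 1 "right_transfer f"] by (simp add: transfer_def[abs_def])
  ultimately show ?case
    by (simp add: sum.lessThan_Suc_shift add_divide_distrib del: sum.lessThan_Suc)
qed

lemma integral_le_sum_left_transfers:
  assumes "admissible \<omega>" "decreasing f"
  shows "(LINT x|unit_lebesgue. f x) \<le> (LINT x|unit_lebesgue. left_transfers n \<omega> f x)
    + 3/2 * (\<Sum>i<n. left_transfers (Suc i) \<omega> f 1)"
  using assms
proof (induction n arbitrary: \<omega> f)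
  case (Suc n)
  let ?w = "\<lambda>i. \<omega> (Suc i)" and ?b = "\<omega> 0"
  have b: "0 < ?b" "?b < 1" and w: "admissible ?w"
    using admissibleD[OF Suc.prems(1)] admissible_Suc[OF Suc.prems(1)] by auto
  note f = decreasingD(1)[OF Suc.prems(2)]
  have "(LINT x|unit_lebesgue. f x) = (LINT x|unit_lebesgue. left_transfer ?b f x) + (LINT x|unit_lebesgue. right_transfer f x)"
    using transfer_integral(2)[OF b f] left_transfer_integral(1)[OF b f] right_transfer_integral(1)[OF f]
    by (simp add: transfer_def[abs_def])
  moreover have "(LINT x|unit_lebesgue. right_transfer f x) \<le> 3/2 * left_transfer ?b f 1"
  proof -
    \<comment> \<open>As f is decreasing, the right half carries at most f(1/2)/2, while the left
      branch transports f(1/2) to the point 1 divided by a derivative of at most 3; hence the factor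
      3/2.\<close>
    have "(LINT x|unit_lebesgue. right_transfer f x) \<le> f (1/2) / 2"
      using right_transfer_integral(2)[OF f] decreasing_integral_le(2)[OF Suc.prems(2), of "1/2"] by simp
    also have "f (1/2) / 3 \<le> left_transfer ?b f 1"
      unfolding left_transfer_def left_inverse_one[OF b(1)]
      using left_deriv_bounds[OF b, of "1/2"] decreasingD(2)[OF Suc.prems(2), of "1/2"]
      by (intro divide_left_mono) auto
    then have "f (1/2) / 2 \<le> 3/2 * left_transfer ?b f 1" by simp
    finally show ?thesis .
  qed
  ultimately show ?case
    using Suc.IH[OF w decreasing_left_transfer[OF b Suc.prems(2)]]
    by (subst sum.lessThan_Suc_shift) (simp add: algebra_simps)
qed auto

text \<open>The sum in the upper bound starts one index later than the sum in the lower bound, so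
  one more step is spent; 3/2 times 1327104 gives the denominator. Only the mass remaining under
  \<open>left_transfers\<close> is subtracted, and a cone function above f suffices to control
  it.\<close>

lemma transfers_minorization:
  assumes w: "admissible \<omega>" and f: "decreasing f" and x: "0 < x" "x \<le> 1"
  shows "((LINT x|unit_lebesgue. f x) - (LINT x|unit_lebesgue. left_transfers n \<omega> f x)) / 1990656
    \<le> transfers (Suc n) \<omega> f x"
proof -
  have "(\<Sum>i<n. left_transfers (Suc i) \<omega> f 1) \<le> (\<Sum>i<Suc n. left_transfers i \<omega> f 1)"
    using decreasingD(2)[OF f, of 1] by (subst sum.lessThan_Suc_shift) simp
  then have "(LINT x|unit_lebesgue. f x) - (LINT x|unit_lebesgue. left_transfers n \<omega> f x)
    \<le> 3/2 * (\<Sum>i<Suc n. left_transfers i \<omega> f 1)"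
    using integral_le_sum_left_transfers[OF w f, of n] by linarith
  then show ?thesis using transfers_ge_sum[OF w f x, of "Suc n"] by simp
qed

section \<open>Coupling by repeated subtraction of constants\<close>

declare transfers.simps(2) [simp del]

text \<open>Bounds the fraction of the mass of a cone function that has not escaped after n steps;
  it is of order n^(1 - 1/\<alpha>).\<close>

definition slow_mass :: "nat \<Rightarrow> real" where
  "slow_mass n = 12 * escape_bound n powr (1 - \<alpha>)"

text \<open>After every block of \<open>Suc n\<close> steps both functions dominate the same constant; subtracting it
  keeps them decreasing and dominated by the cone functions \<open>f1\<close>, \<open>f2\<close>.\<close>

lemma coupling:
  assumes "admissible \<omega>" "cone f1" "cone f2" "(LINT x|unit_lebesgue. f1 x) = A" "(LINT x|unit_lebesgue. f2 x) = A"
    and "decreasing g1" "decreasing g2" "(LINT x|unit_lebesgue. g1 x) = M" "(LINT x|unit_lebesgue. g2 x) = M"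
    and "\<And>x. 0 < x \<Longrightarrow> x \<le> 1 \<Longrightarrow> g1 x \<le> f1 x" "\<And>x. 0 < x \<Longrightarrow> x \<le> 1 \<Longrightarrow> g2 x \<le> f2 x"
  shows "(LINT x|unit_lebesgue. \<bar>transfers (k * Suc n) \<omega> (\<lambda>x. g1 x - g2 x) x\<bar>)
    \<le> 2 * ((1 - 1/1990656) ^ k * max 0 (M - slow_mass n * A) + slow_mass n * A)"
  using assms
proof (induction k arbitrary: \<omega> f1 f2 g1 g2 M)
  case (0 \<omega> f1 f2 g1 g2 M)
  note g = decreasingD[OF 0(6)] decreasingD[OF 0(7)]
  have "(LINT x|unit_lebesgue. \<bar>g1 x - g2 x\<bar>) \<le> (LINT x|unit_lebesgue. g1 x + g2 x)"
    using g by (intro integral_unit_mono) (auto simp: abs_le_iff add_increasing2)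
  moreover have "M \<le> max 0 (M - slow_mass n * A) + slow_mass n * A" by simp
  ultimately show ?case using g 0(8,9) by simp
next
  case (Suc k \<omega> f1 f2 g1 g2 M)
  let ?d = "slow_mass n * A" and ?N = "Suc n"
  note w = Suc.prems(1)
  note g = decreasingD[OF Suc.prems(6)] decreasingD[OF Suc.prems(7)]
  note m = Suc.prems(4,5,8,9)
  show ?case
  proof (cases "M \<le> ?d")
    case True
    \<comment> \<open>No excess over \<open>?d\<close> is left to be coupled: the maximum in the
      bound vanishes and L1 contraction suffices.\<close>
    have "(LINT x|unit_lebesgue. \<bar>transfers (Suc k * ?N) \<omega> (\<lambda>x. g1 x - g2 x) x\<bar>)
        \<le> (LINT x|unit_lebesgue. \<bar>g1 x - g2 x\<bar>)"
      using g by (intro transfers_L1[OF w]) auto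
    also have "\<dots> \<le> (LINT x|unit_lebesgue. g1 x + g2 x)"
      using g by (intro integral_unit_mono) (auto simp: abs_le_iff add_increasing2)
    finally show ?thesis using True g m by simp
  next
    case False
    \<comment> \<open>This is what \<open>transfers_minorization\<close> guarantees when at most
      \<open>?d\<close> of the mass \<open>M\<close> has not escaped; the bound \<open>?d\<close>
      comes from the dominating cone function, as g1 and g2 need not lie in the cone
      themselves.\<close>
    define q where "q = (M - ?d) / 1990656"
    have q: "0 \<le> q" using False by (simp add: q_def)
    let ?w = "\<lambda>i. \<omega> (i + ?N)"
    have lower: "q \<le> transfers ?N \<omega> h x"
      if h: "decreasing h" "cone f" "(LINT x|unit_lebesgue. h x) = M" "(LINT x|unit_lebesgue. f x) = A"
        "\<And>x. 0 < x \<Longrightarrow> x \<le> 1 \<Longrightarrow> h x \<le> f x" and x: "0 < x" "x \<le> 1" for h f x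
    proof -
      have "(LINT x|unit_lebesgue. left_transfers n \<omega> h x) \<le> (LINT x|unit_lebesgue. indicator {0..escape_bound n} x * h x)"
        using decreasingD[OF h(1)] by (intro left_transfers_integral_le[OF w]) auto
      also have "\<dots> \<le> (LINT x|unit_lebesgue. indicator {0..escape_bound n} x * f x)"
        using decreasingD[OF h(1)] coneD(2)[OF h(2)] h(5)
        by (intro integral_unit_mono indicator_times_integrable) (auto simp: indicator_def)
      also have "\<dots> \<le> ?d"
        using cone_near_zero[OF h(2) escape_bound_bounds] h(4) by (simp add: slow_mass_def)
      finally show ?thesis
        using transfers_minorization[OF w h(1) x, of n] h(3) by (simp add: q_def)
    qed
    have dec: "decreasing (\<lambda>x. transfers ?N \<omega> h x - q)"
      if "decreasing h" "\<And>x. 0 < x \<Longrightarrow> x \<le> 1 \<Longrightarrow> q \<le> transfers ?N \<omega> h x" for h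
      using decreasingD[OF decreasing_transfers[OF w that(1), of ?N]] that(2)
      unfolding decreasing_def by auto
    have mass: "(LINT x|unit_lebesgue. transfers ?N \<omega> h x - q) = M - q"
      if "decreasing h" "(LINT x|unit_lebesgue. h x) = M" for h
      using transfers_integral[OF w decreasingD(1)[OF that(1)]] that(2) unit_lebesgue.prob_space by simp
    have le: "transfers ?N \<omega> h x - q \<le> transfers ?N \<omega> f x"
      if "\<And>x. 0 < x \<Longrightarrow> x \<le> 1 \<Longrightarrow> h x \<le> f x" "0 < x" "x \<le> 1" for h f x
    proof -
      have "transfers ?N \<omega> h x \<le> transfers ?N \<omega> f x"
        using that by (intro transfers_mono[OF w]) auto
      then show ?thesis using q by simp
    qed
    have "(LINT x|unit_lebesgue. \<bar>transfers (k * ?N) ?w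
          (\<lambda>x. (transfers ?N \<omega> g1 x - q) - (transfers ?N \<omega> g2 x - q)) x\<bar>)
        \<le> 2 * ((1 - 1/1990656) ^ k * max 0 ((M - q) - ?d) + ?d)"
    proof (rule Suc.IH)
      show "admissible ?w" by (rule admissible_shift[OF w])
      show "cone (transfers ?N \<omega> f1)" "cone (transfers ?N \<omega> f2)"
        using cone_transfers[OF w] Suc.prems(2,3) by auto
      show "(LINT x|unit_lebesgue. transfers ?N \<omega> f1 x) = A" "(LINT x|unit_lebesgue. transfers ?N \<omega> f2 x) = A"
        using transfers_integral(2)[OF w coneD(2)[OF Suc.prems(2)]] transfers_integral(2)[OF w coneD(2)[OF Suc.prems(3)]] m
        by auto
      show "decreasing (\<lambda>x. transfers ?N \<omega> g1 x - q)"
        by (rule dec[OF Suc.prems(6) lower[OF Suc.prems(6,2,8,4,10)]])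
      show "decreasing (\<lambda>x. transfers ?N \<omega> g2 x - q)"
        by (rule dec[OF Suc.prems(7) lower[OF Suc.prems(7,3,9,5,11)]])
      show "(LINT x|unit_lebesgue. transfers ?N \<omega> g1 x - q) = M - q"
        by (rule mass[OF Suc.prems(6,8)])
      show "(LINT x|unit_lebesgue. transfers ?N \<omega> g2 x - q) = M - q"
        by (rule mass[OF Suc.prems(7,9)])
      show "transfers ?N \<omega> g1 x - q \<le> transfers ?N \<omega> f1 x" if "0 < x" "x \<le> 1" for x
        by (rule le[OF Suc.prems(10) that])
      show "transfers ?N \<omega> g2 x - q \<le> transfers ?N \<omega> f2 x" if "0 < x" "x \<le> 1" for x
        by (rule le[OF Suc.prems(11) that])
    qed
    moreover have "transfers (k * ?N) ?w (\<lambda>x. (transfers ?N \<omega> g1 x - q) - (transfers ?N \<omega> g2 x - q))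
        = transfers (Suc k * ?N) \<omega> (\<lambda>x. g1 x - g2 x)"
      using transfers_add[of ?N "k * ?N" \<omega> "\<lambda>x. g1 x - g2 x"] by (simp only: transfers_diff mult_Suc) simp
    \<comment> \<open>Each round removes the fraction 1/1990656 of the excess over
      \<open>?d\<close>.\<close>
    moreover have "max 0 ((M - q) - ?d) = (1 - 1/1990656) * max 0 (M - ?d)"
      using False by (simp add: q_def max_def field_simps)
    ultimately show ?thesis by (simp only: power_Suc2 mult.assoc)
  qed
qed

section \<open>From coupling to a polynomial rate\<close>

lemma coupling_cone:
  assumes w: "admissible \<omega>" and f: "cone f1" "cone f2"
    and m: "(LINT x|unit_lebesgue. f1 x) = A" "(LINT x|unit_lebesgue. f2 x) = A"
    and N: "k * Suc n \<le> N"
  shows "(LINT x|unit_lebesgue. \<bar>transfers N \<omega> (\<lambda>x. f1 x - f2 x) x\<bar>)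
    \<le> 2 * ((1 - 1/1990656) ^ k + slow_mass n) * A"
proof -
  have A: "0 \<le> A" using coneD(6)[OF f(1)] m by simp
  have s: "0 \<le> slow_mass n" by (simp add: slow_mass_def)
  obtain l where l: "N = k * Suc n + l" using N le_Suc_ex by blast
  have i: "integrable unit_lebesgue (\<lambda>x. f1 x - f2 x)" using coneD(2) f by auto
  have "(LINT x|unit_lebesgue. \<bar>transfers N \<omega> (\<lambda>x. f1 x - f2 x) x\<bar>)
      \<le> (LINT x|unit_lebesgue. \<bar>transfers (k * Suc n) \<omega> (\<lambda>x. f1 x - f2 x) x\<bar>)"
    unfolding l transfers_add by (intro transfers_L1 admissible_shift transfers_integral(1) w i)
  also have "\<dots> \<le> 2 * ((1 - 1/1990656) ^ k * max 0 (A - slow_mass n * A) + slow_mass n * A)"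
    by (rule coupling[OF w f m coneD(1)[OF f(1)] coneD(1)[OF f(2)] m]) auto
  also have "\<dots> \<le> 2 * ((1 - 1/1990656) ^ k * A + slow_mass n * A)"
    using A s by (intro mult_left_mono add_right_mono) auto
  finally show ?thesis by (simp add: algebra_simps)
qed

text \<open>Any exponent strictly between 1 and \<open>1/\<alpha> - 1\<close>, the exponent of \<open>slow_mass\<close>, would do.\<close>

definition decay_exponent :: real where
  "decay_exponent = 1 / (2 * \<alpha>)"

lemma decay_exponent_gt_1: "1 < decay_exponent"
  using alpha_pos alpha_less by (simp add: decay_exponent_def field_simps)

text \<open>About N^\<eta> rounds of about N^(1-\<eta>) steps: the factor geometric in the number of
  rounds is then smaller than any power of N, and the slow mass is of order
  N^(-(1-\<eta>)(1-\<alpha>)/\<alpha>). The choice of \<eta> makes the last exponent at least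
  1/(2\<alpha>) in absolute value, which comes down to (1-2\<alpha>)(1+\<alpha>) \<ge> 0.\<close>

lemma block_length_choice:
  obtains C :: real where "0 < C" and "\<And>N::nat. N \<ge> 1 \<Longrightarrow>
    \<exists>k n. k * Suc n \<le> N \<and> (1 - 1/1990656) ^ k + slow_mass n \<le> C * real N powr (- decay_exponent)"
proof -
  define \<eta> where "\<eta> = (1 - 2 * \<alpha>) / 4"
  define c :: real where "c = 1/1990656"
  define \<theta> where "\<theta> = (1 - \<alpha>) / \<alpha>"
  have eta: "0 < \<eta>" "\<eta> < 1" using alpha_pos alpha_less by (auto simp: \<eta>_def)
  have c: "0 < c" "c < 1" by (auto simp: c_def)
  have th: "0 < \<theta>" using alpha_pos alpha_less by (auto simp: \<theta>_def)
  have exps: "decay_exponent \<le> (1 - \<eta>) * \<theta>"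
  proof -
    have "0 \<le> (1 - 2 * \<alpha>) * (1 + \<alpha>)" using alpha_pos alpha_less by simp
    then have "2 \<le> (3 + 2 * \<alpha>) * (1 - \<alpha>)" by (simp add: algebra_simps)
    then have "2 / (4 * \<alpha>) \<le> (3 + 2 * \<alpha>) * (1 - \<alpha>) / (4 * \<alpha>)"
      using alpha_pos by (intro divide_right_mono) auto
    also have "\<dots> = (1 - \<eta>) * \<theta>" using alpha_pos by (simp add: \<eta>_def \<theta>_def field_simps)
    finally show ?thesis by (simp add: decay_exponent_def)
  qed
  have "(\<lambda>N. exp (- c * real N powr \<eta>) * real N powr decay_exponent) \<longlonglongrightarrow> 0"
    using c(1) eta(1) by real_asymp
  then obtain B where B: "\<And>N. norm (exp (- c * real N powr \<eta>) * real N powr decay_exponent) \<le> B"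
    by (metis (no_types, lifting) convergentI convergent_imp_Bseq BseqE)
  define D where "D = exp c * B + 12 * (\<alpha> / 4) powr (- \<theta>)"
  have B0: "0 \<le> B" using B[of 0] by simp
  have D: "0 < D" unfolding D_def using B0 alpha_pos by (intro add_nonneg_pos) auto
  show thesis
  proof (rule that[OF D])
    fix N :: nat assume N: "N \<ge> 1"
    have N1: "1 \<le> real N powr a" if "0 < a" for a using N that by (simp add: ge_one_powr_ge_zero)
    define k where "k = nat \<lfloor>real N powr \<eta>\<rfloor>"
    define l where "l = nat \<lfloor>real N powr (1 - \<eta>)\<rfloor>"
    have k: "real k \<le> real N powr \<eta>" "real N powr \<eta> - 1 \<le> real k"
    proof -
      have "real k = real_of_int \<lfloor>real N powr \<eta>\<rfloor>" unfolding k_def by simp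
      then show "real k \<le> real N powr \<eta>" "real N powr \<eta> - 1 \<le> real k" by linarith+
    qed
    have l: "real l \<le> real N powr (1 - \<eta>)" "real N powr (1 - \<eta>) / 2 \<le> real l" "1 \<le> l"
    proof -
      have x: "1 \<le> real N powr (1 - \<eta>)" using N1[of "1 - \<eta>"] eta by simp
      then have f: "1 \<le> \<lfloor>real N powr (1 - \<eta>)\<rfloor>" by (simp add: le_floor_iff)
      then have "real l = real_of_int \<lfloor>real N powr (1 - \<eta>)\<rfloor>" unfolding l_def by simp
      then show "real l \<le> real N powr (1 - \<eta>)" "real N powr (1 - \<eta>) / 2 \<le> real l" using f by linarith+
      show "1 \<le> l" using f unfolding l_def by linarith
    qed
    obtain n where n: "l = Suc n" using l(3) by (cases l) auto
    have "real k * real l \<le> real N powr \<eta> * real N powr (1 - \<eta>)" using k l by (intro mult_mono) auto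
    also have "\<dots> = real N" using N by (simp flip: powr_add)
    finally have "k * Suc n \<le> N" unfolding n by (metis of_nat_le_iff of_nat_mult)
    moreover have "(1 - 1/1990656) ^ k \<le> exp c * B * real N powr (- decay_exponent)"
    proof -
      have "(1 - c) ^ k \<le> exp (- c) ^ k" using c exp_ge_add_one_self[of "- c"] by (intro power_mono) auto
      also have "\<dots> = exp (- c * real k)" by (simp add: exp_of_nat_mult[symmetric] mult.commute)
      also have "\<dots> \<le> exp (- c * (real N powr \<eta> - 1))" using k c by simp
      also have "\<dots> = exp c * exp (- c * real N powr \<eta>)" by (simp add: exp_add[symmetric] algebra_simps)
      also have "exp (- c * real N powr \<eta>) \<le> B * real N powr (- decay_exponent)"
        using B[of N] N by (simp add: powr_minus field_simps)
      finally show ?thesis by (simp add: c_def mult.assoc)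
    qed
    moreover have "slow_mass n \<le> 12 * (\<alpha> / 4) powr (- \<theta>) * real N powr (- decay_exponent)"
    proof -
      have "\<alpha> / 4 * real N powr (1 - \<eta>) \<le> \<alpha> / 2 * real l" using l alpha_pos by simp
      also have "\<dots> \<le> 1 + \<alpha> / 2 * real n" using alpha_less unfolding n by (simp add: field_simps)
      finally have "(1 + \<alpha> / 2 * real n) powr (- \<theta>) \<le> (\<alpha> / 4 * real N powr (1 - \<eta>)) powr (- \<theta>)"
        using th alpha_pos N by (intro powr_mono2') auto
      also have "\<dots> = (\<alpha> / 4) powr (- \<theta>) * real N powr (- ((1 - \<eta>) * \<theta>))"
        by (subst powr_mult) (simp add: powr_powr)
      also have "\<dots> \<le> (\<alpha> / 4) powr (- \<theta>) * real N powr (- decay_exponent)"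
        using exps N by (intro mult_left_mono powr_mono) auto
      finally have "(1 + \<alpha> / 2 * real n) powr (- \<theta>) \<le> (\<alpha> / 4) powr (- \<theta>) * real N powr (- decay_exponent)" .
      moreover have "slow_mass n = 12 * (1 + \<alpha> / 2 * real n) powr (- \<theta>)"
        unfolding slow_mass_def escape_bound_def \<theta>_def by (simp add: powr_powr)
      ultimately show ?thesis by simp
    qed
    ultimately show "\<exists>k n. k * Suc n \<le> N \<and> (1 - 1/1990656) ^ k + slow_mass n \<le> D * real N powr (- decay_exponent)"
      by (intro exI[of _ k] exI[of _ n]) (simp add: D_def algebra_simps)
  qed
qed

theorem memory_loss:
  obtains C :: real where "0 < C" and
    "\<And>\<omega> f1 f2 n. admissible \<omega> \<Longrightarrow> cone f1 \<Longrightarrow> cone f2 \<Longrightarrow>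
      (LINT x|unit_lebesgue. f1 x) = (LINT x|unit_lebesgue. f2 x) \<Longrightarrow>
      (LINT x|unit_lebesgue. \<bar>transfers n \<omega> (\<lambda>x. f1 x - f2 x) x\<bar>)
        \<le> C * real (Suc n) powr (- decay_exponent) * (LINT x|unit_lebesgue. f1 x)"
proof -
  obtain C where C: "0 < C" and blocks: "\<And>N::nat. N \<ge> 1 \<Longrightarrow>
    \<exists>k n. k * Suc n \<le> N \<and> (1 - 1/1990656) ^ k + slow_mass n \<le> C * real N powr (- decay_exponent)"
    using block_length_choice by blast
  \<comment> \<open>The summand 2 covers n = 0, where the L1 distance is bounded by the sum of the
    two masses.\<close>
  define D where "D = 2 + 2 * C * 2 powr decay_exponent"
  have D: "0 < D" using C by (simp add: D_def add_pos_nonneg)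
  show thesis
  proof (rule that[OF D])
    fix \<omega> f1 f2 n
    assume w: "admissible \<omega>" and f: "cone f1" "cone f2"
      and m: "(LINT x|unit_lebesgue. f1 x) = (LINT x|unit_lebesgue. f2 x)"
    let ?A = "LINT x|unit_lebesgue. f1 x" and ?L = "LINT x|unit_lebesgue. \<bar>transfers n \<omega> (\<lambda>x. f1 x - f2 x) x\<bar>"
    have A: "0 \<le> ?A" by (rule coneD(6)[OF f(1)])
    show "?L \<le> D * real (Suc n) powr (- decay_exponent) * ?A"
    proof (cases "n = 0")
      case True
      have "?L \<le> (LINT x|unit_lebesgue. f1 x + f2 x)"
        unfolding True using coneD(2,5)[OF f(1)] coneD(2,5)[OF f(2)]
        by (intro integral_unit_mono) (auto simp: abs_le_iff add_increasing2)
      also have "\<dots> = 2 * ?A" using coneD(2) f m by simp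
      also have "\<dots> \<le> D * ?A" using A C by (intro mult_right_mono) (auto simp: D_def)
      finally show ?thesis using True by simp
    next
      case False
      then obtain k l where kl: "k * Suc l \<le> n" "(1 - 1/1990656) ^ k + slow_mass l \<le> C * real n powr (- decay_exponent)"
        using blocks[of n] by auto
      have "?L \<le> 2 * ((1 - 1/1990656) ^ k + slow_mass l) * ?A"
        using m by (intro coupling_cone[OF w f] kl) auto
      also have "\<dots> \<le> 2 * (C * real n powr (- decay_exponent)) * ?A"
        using kl A by (intro mult_right_mono mult_left_mono) auto
      \<comment> \<open>Here n \<ge> (n+1)/2 is used. The rate is stated with \<open>Suc n\<close>
        because \<open>0 powr (- decay_exponent)\<close> is 0, which would be a false bound at n =
        0.\<close>
      also have "real n powr (- decay_exponent) \<le> 2 powr decay_exponent * real (Suc n) powr (- decay_exponent)"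
      proof -
        have "real n powr (- decay_exponent) \<le> (real (Suc n) / 2) powr (- decay_exponent)"
          using False decay_exponent_gt_1 by (intro powr_mono2') auto
        also have "\<dots> = 2 powr decay_exponent * real (Suc n) powr (- decay_exponent)"
          by (simp add: powr_divide powr_minus field_simps)
        finally show ?thesis .
      qed
      finally have "?L \<le> 2 * (C * (2 powr decay_exponent * real (Suc n) powr (- decay_exponent))) * ?A"
        using A C by (simp add: mult_left_mono mult_right_mono)
      also have "\<dots> \<le> D * real (Suc n) powr (- decay_exponent) * ?A"
        using A unfolding D_def by (simp add: algebra_simps)
      finally show ?thesis .
    qed
  qed
qed

end

section \<open>Lipschitz observables and decay of correlations\<close>

text \<open>One constant bounds both the values and the slope, so that the cone estimate for
  products is linear in it.\<close>

definition bounded_lipschitz :: "real \<Rightarrow> (real \<Rightarrow> real) \<Rightarrow> bool" where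
  "bounded_lipschitz M u \<longleftrightarrow> (\<forall>x\<in>{0..1}. \<bar>u x\<bar> \<le> M) \<and>
     (\<forall>x\<in>{0..1}. \<forall>y\<in>{0..1}. \<bar>u x - u y\<bar> \<le> M * \<bar>x - y\<bar>)"

lemma bounded_lipschitzD:
  assumes "bounded_lipschitz M u"
  shows "x \<in> {0..1} \<Longrightarrow> \<bar>u x\<bar> \<le> M"
    and "x \<in> {0..1} \<Longrightarrow> y \<in> {0..1} \<Longrightarrow> \<bar>u x - u y\<bar> \<le> M * \<bar>x - y\<bar>"
    and "0 \<le> M"
  using assms unfolding bounded_lipschitz_def by (auto dest: bspec[of _ _ 0])

lemma measurable_bounded_lipschitz [measurable_dest]:
  assumes u: "bounded_lipschitz M u"
  shows "u \<in> borel_measurable unit_lebesgue"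
proof -
  have "M-lipschitz_on {0..1} u"
    using bounded_lipschitzD[OF u] by (auto intro!: lipschitz_onI simp: dist_real_def)
  then have "continuous_on {0..1} u" by (rule lipschitz_on_continuous_on)
  then have "u \<in> borel_measurable (restrict_space borel {0..1})"
    by (rule borel_measurable_continuous_on_restrict)
  then show ?thesis by (simp add: measurable_cong_sets[OF sets_unit_lebesgue refl])
qed

lemma bounded_lipschitz_compose:
  assumes u: "bounded_lipschitz M u" and F: "\<And>s t. \<bar>F s - F t\<bar> \<le> L * \<bar>s - t\<bar>" "F 0 = 0" and L: "0 \<le> L"
  shows "bounded_lipschitz (L * M) (\<lambda>x. F (u x))"
  unfolding bounded_lipschitz_def
proof (intro conjI ballI)
  fix x :: real assume x: "x \<in> {0..1}"
  have "\<bar>F (u x) - F 0\<bar> \<le> L * \<bar>u x - 0\<bar>" by (rule F)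
  also have "\<dots> \<le> L * M" using bounded_lipschitzD(1)[OF u x] L by (intro mult_left_mono) auto
  finally show "\<bar>F (u x)\<bar> \<le> L * M" using F by simp
  fix y :: real assume y: "y \<in> {0..1}"
  have "\<bar>F (u x) - F (u y)\<bar> \<le> L * \<bar>u x - u y\<bar>" by (rule F)
  also have "\<dots> \<le> L * (M * \<bar>x - y\<bar>)" using bounded_lipschitzD(2)[OF u x y] L by (intro mult_left_mono) auto
  finally show "\<bar>F (u x) - F (u y)\<bar> \<le> L * M * \<bar>x - y\<bar>" by (simp add: mult.assoc)
qed

lemma abs_sin_diff_le: "\<bar>sin s - sin t\<bar> \<le> \<bar>s - t\<bar>" for s t :: real
proof -
  have "\<bar>sin s - sin t\<bar> = 2 * \<bar>sin ((s - t) / 2)\<bar> * \<bar>cos ((s + t) / 2)\<bar>"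
    by (simp add: sin_diff_sin abs_mult)
  also have "\<dots> \<le> 2 * \<bar>(s - t) / 2\<bar> * 1"
    using abs_sin_x_le_abs_x[of "(s - t) / 2"] by (intro mult_mono) auto
  finally show ?thesis by simp
qed

lemma abs_cos_diff_le: "\<bar>cos s - cos t\<bar> \<le> \<bar>s - t\<bar>" for s t :: real
  using abs_sin_diff_le[of "s + pi/2" "t + pi/2"] by (simp add: sin_add)

section \<open>The rate as a fixed sequence and the norm generated by the cone\<close>

context intermittent
begin

text \<open>Fixes one witness of \<open>memory_loss\<close>, so that all later estimates share the
  single rate \<open>decay\<close>.\<close>

definition decay_const :: real where
  "decay_const = (SOME C. 0 < C \<and> (\<forall>\<omega> f1 f2 n. admissible \<omega> \<longrightarrow> cone f1 \<longrightarrow> cone f2 \<longrightarrow>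
      (LINT x|unit_lebesgue. f1 x) = (LINT x|unit_lebesgue. f2 x) \<longrightarrow>
      (LINT x|unit_lebesgue. \<bar>transfers n \<omega> (\<lambda>x. f1 x - f2 x) x\<bar>)
        \<le> C * real (Suc n) powr (- decay_exponent) * (LINT x|unit_lebesgue. f1 x)))"

definition decay :: "nat \<Rightarrow> real" where
  "decay n = decay_const * real (Suc n) powr (- decay_exponent)"

lemma decay_const: "0 < decay_const"
  and memory_loss_decay: "admissible \<omega> \<Longrightarrow> cone f1 \<Longrightarrow> cone f2 \<Longrightarrow>
      (LINT x|unit_lebesgue. f1 x) = (LINT x|unit_lebesgue. f2 x) \<Longrightarrow>
      (LINT x|unit_lebesgue. \<bar>transfers n \<omega> (\<lambda>x. f1 x - f2 x) x\<bar>) \<le> decay n * (LINT x|unit_lebesgue. f1 x)"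
proof -
  have "\<exists>C. 0 < C \<and> (\<forall>\<omega> f1 f2 n. admissible \<omega> \<longrightarrow> cone f1 \<longrightarrow> cone f2 \<longrightarrow>
      (LINT x|unit_lebesgue. f1 x) = (LINT x|unit_lebesgue. f2 x) \<longrightarrow>
      (LINT x|unit_lebesgue. \<bar>transfers n \<omega> (\<lambda>x. f1 x - f2 x) x\<bar>)
        \<le> C * real (Suc n) powr (- decay_exponent) * (LINT x|unit_lebesgue. f1 x))"
    using memory_loss by metis
  from someI_ex[OF this] have *: "0 < decay_const \<and> (\<forall>\<omega> f1 f2 n. admissible \<omega> \<longrightarrow> cone f1 \<longrightarrow> cone f2 \<longrightarrow>
      (LINT x|unit_lebesgue. f1 x) = (LINT x|unit_lebesgue. f2 x) \<longrightarrow>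
      (LINT x|unit_lebesgue. \<bar>transfers n \<omega> (\<lambda>x. f1 x - f2 x) x\<bar>)
        \<le> decay_const * real (Suc n) powr (- decay_exponent) * (LINT x|unit_lebesgue. f1 x))"
    unfolding decay_const_def .
  show "0 < decay_const" using * by blast
  show "admissible \<omega> \<Longrightarrow> cone f1 \<Longrightarrow> cone f2 \<Longrightarrow>
      (LINT x|unit_lebesgue. f1 x) = (LINT x|unit_lebesgue. f2 x) \<Longrightarrow>
      (LINT x|unit_lebesgue. \<bar>transfers n \<omega> (\<lambda>x. f1 x - f2 x) x\<bar>) \<le> decay n * (LINT x|unit_lebesgue. f1 x)"
    using * unfolding decay_def by blast
qed

lemma decay_pos: "0 < decay n"
  using decay_const by (simp add: decay_def)

lemma decay_antimono: "m \<le> n \<Longrightarrow> decay n \<le> decay m"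
  unfolding decay_def using decay_const decay_exponent_gt_1
  by (intro mult_left_mono powr_mono2') auto

text \<open>The exponent exceeds 1 because \<alpha> < 1/2; all sums over covariances rest on
  this.\<close>

lemma summable_decay: "summable decay"
proof -
  have "summable (\<lambda>n. real n powr (- decay_exponent))"
    using decay_exponent_gt_1 by (simp add: summable_real_powr_iff)
  then have "summable (\<lambda>n. real (Suc n) powr (- decay_exponent))"
    by (subst summable_Suc_iff)
  then show ?thesis unfolding decay_def[abs_def] by (rule summable_mult)
qed

text \<open>The infimum of such K is a seminorm on differences of cone functions that dominates the
  L1 norm. Transfer operators do not increase it, and memory loss extends to all elements of
  integral zero.\<close>

definition cone_diff :: "real \<Rightarrow> (real \<Rightarrow> real) \<Rightarrow> bool" where
  "cone_diff K g \<longleftrightarrow> (\<exists>h1 h2. cone h1 \<and> cone h2 \<and> g = (\<lambda>x. h1 x - h2 x) \<and>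
     (LINT x|unit_lebesgue. h1 x) + (LINT x|unit_lebesgue. h2 x) \<le> K)"

lemma cone_diffI:
  assumes "cone h1" "cone h2" "\<And>x. g x = h1 x - h2 x"
    "(LINT x|unit_lebesgue. h1 x) + (LINT x|unit_lebesgue. h2 x) \<le> K"
  shows "cone_diff K g"
  unfolding cone_diff_def using assms by blast

lemma cone_diffE:
  assumes "cone_diff K g"
  obtains h1 h2 where "cone h1" "cone h2" "g = (\<lambda>x. h1 x - h2 x)"
    "(LINT x|unit_lebesgue. h1 x) + (LINT x|unit_lebesgue. h2 x) \<le> K"
  using assms unfolding cone_diff_def by blast

lemma cone_imp_cone_diff:
  assumes "cone h"
  shows "cone_diff (LINT x|unit_lebesgue. h x) h"
  using assms by (intro cone_diffI[of h "\<lambda>_. 0"] cone_const) auto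

lemma cone_diff_mono: "cone_diff K g \<Longrightarrow> K \<le> L \<Longrightarrow> cone_diff L g"
  by (elim cone_diffE) (rule cone_diffI, auto)

lemma cone_diff_add:
  assumes "cone_diff K f" "cone_diff L g"
  shows "cone_diff (K + L) (\<lambda>x. f x + g x)"
proof -
  obtain a b where f: "cone a" "cone b" "f = (\<lambda>x. a x - b x)"
    "(LINT x|unit_lebesgue. a x) + (LINT x|unit_lebesgue. b x) \<le> K" using assms(1) by (rule cone_diffE)
  obtain c d where g: "cone c" "cone d" "g = (\<lambda>x. c x - d x)"
    "(LINT x|unit_lebesgue. c x) + (LINT x|unit_lebesgue. d x) \<le> L" using assms(2) by (rule cone_diffE)
  show ?thesis
    by (rule cone_diffI[of "\<lambda>x. a x + c x" "\<lambda>x. b x + d x"]) (use f g in \<open>auto simp: cone_add coneD\<close>)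
qed

lemma cone_diff_minus:
  assumes "cone_diff K f"
  shows "cone_diff K (\<lambda>x. - f x)"
proof -
  obtain a b where f: "cone a" "cone b" "f = (\<lambda>x. a x - b x)"
    "(LINT x|unit_lebesgue. a x) + (LINT x|unit_lebesgue. b x) \<le> K" using assms(1) by (rule cone_diffE)
  show ?thesis
    by (rule cone_diffI[of b a]) (use f in \<open>auto simp: add.commute\<close>)
qed

lemma cone_diff_cmult:
  assumes "cone_diff K f"
  shows "cone_diff (\<bar>c\<bar> * K) (\<lambda>x. c * f x)"
proof -
  obtain a b where f: "cone a" "cone b" "f = (\<lambda>x. a x - b x)"
    "(LINT x|unit_lebesgue. a x) + (LINT x|unit_lebesgue. b x) \<le> K" using assms(1) by (rule cone_diffE)
  have "cone_diff (\<bar>c\<bar> * K) (\<lambda>x. \<bar>c\<bar> * f x)"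
    by (rule cone_diffI[of "\<lambda>x. \<bar>c\<bar> * a x" "\<lambda>x. \<bar>c\<bar> * b x"])
      (use f in \<open>auto simp: cone_cmult right_diff_distrib simp flip: distrib_left intro!: mult_left_mono\<close>)
  then show ?thesis using cone_diff_minus[of "\<bar>c\<bar> * K" "\<lambda>x. \<bar>c\<bar> * f x"] by (cases "0 \<le> c") auto
qed

lemma cone_diff_integrable: "cone_diff K g \<Longrightarrow> integrable unit_lebesgue g"
  by (elim cone_diffE) (auto simp: coneD)

lemma cone_diff_L1:
  assumes "cone_diff K g"
  shows "(LINT x|unit_lebesgue. \<bar>g x\<bar>) \<le> K" "\<bar>LINT x|unit_lebesgue. g x\<bar> \<le> K" "0 \<le> K"
proof -
  obtain a b where g: "cone a" "cone b" "g = (\<lambda>x. a x - b x)"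
    "(LINT x|unit_lebesgue. a x) + (LINT x|unit_lebesgue. b x) \<le> K" using assms(1) by (rule cone_diffE)
  have "(LINT x|unit_lebesgue. \<bar>g x\<bar>) \<le> (LINT x|unit_lebesgue. a x + b x)"
    using g(1-3) coneD(2,5) by (intro integral_unit_mono) (auto simp: abs_le_iff add_increasing2)
  then show 1: "(LINT x|unit_lebesgue. \<bar>g x\<bar>) \<le> K" using g coneD(2) by simp
  then show "\<bar>LINT x|unit_lebesgue. g x\<bar> \<le> K"
    using integral_abs_bound[of unit_lebesgue g] by linarith
  then show "0 \<le> K" by linarith
qed

lemma cone_diff_transfers:
  assumes w: "admissible \<omega>" and "cone_diff K g"
  shows "cone_diff K (transfers n \<omega> g)"
proof -
  obtain a b where g: "cone a" "cone b" "g = (\<lambda>x. a x - b x)"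
    "(LINT x|unit_lebesgue. a x) + (LINT x|unit_lebesgue. b x) \<le> K" using assms(2) by (rule cone_diffE)
  show ?thesis
    by (rule cone_diffI[of "transfers n \<omega> a" "transfers n \<omega> b"])
      (use g w in \<open>auto simp: cone_transfers transfers_diff transfers_integral(2) coneD(2)\<close>)
qed

text \<open>Integral zero means that the two cone parts have equal mass, which is the hypothesis of
  the coupling.\<close>

lemma cone_diff_decay:
  assumes w: "admissible \<omega>" and g: "cone_diff K g" and m: "(LINT x|unit_lebesgue. g x) = 0"
  shows "(LINT x|unit_lebesgue. \<bar>transfers n \<omega> g x\<bar>) \<le> K * decay n"
proof -
  obtain a b where g: "cone a" "cone b" "g = (\<lambda>x. a x - b x)"
    "(LINT x|unit_lebesgue. a x) + (LINT x|unit_lebesgue. b x) \<le> K" using assms(2) by (rule cone_diffE)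
  have eq: "(LINT x|unit_lebesgue. a x) = (LINT x|unit_lebesgue. b x)"
    using m g coneD(2) by simp
  have "(LINT x|unit_lebesgue. \<bar>transfers n \<omega> g x\<bar>) \<le> decay n * (LINT x|unit_lebesgue. a x)"
    unfolding g(3) by (rule memory_loss_decay[OF w g(1,2) eq])
  also have "\<dots> \<le> decay n * K"
    using decay_pos[of n] g(4) coneD(6)[OF g(2)] by (intro mult_left_mono) auto
  finally show ?thesis by (simp add: mult.commute)
qed

text \<open>Multiplication by \<open>u\<close> leaves the cone only by a bounded amount: the constant added to
  \<open>(u + 2M - Mx) f\<close> restores the monotonicity of \<open>x\<^bsup>1+\<alpha>\<^esup> h\<close>.\<close>

lemma cone_affine:
  assumes f: "cone f" and w: "w \<in> borel_measurable unit_lebesgue"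
    and bnd: "\<And>x. x \<in> {0..1} \<Longrightarrow> 0 \<le> w x \<and> w x \<le> 3 * M"
    and dec: "\<And>x y. 0 \<le> x \<Longrightarrow> x \<le> y \<Longrightarrow> y \<le> 1 \<Longrightarrow> w y \<le> w x \<and> w x - w y \<le> 2 * M * (y - x)"
  shows "cone (\<lambda>x. w x * f x + 12 * M * (LINT x|unit_lebesgue. f x))"
    and "(LINT x|unit_lebesgue. w x * f x + 12 * M * (LINT x|unit_lebesgue. f x)) \<le> 15 * M * (LINT x|unit_lebesgue. f x)"
proof -
  let ?m = "LINT x|unit_lebesgue. f x"
  let ?B = "12 * M * ?m"
  have M: "0 \<le> M" using bnd[of 0] by simp
  have m: "0 \<le> ?m" by (rule coneD(6)[OF f])
  have B: "0 \<le> ?B" using M m by simp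
  have i: "integrable unit_lebesgue (\<lambda>x. f x * w x)"
    using bnd by (intro integrable_unit_bounded_mult[OF coneD(2)[OF f] w, of "3 * M"]) auto
  then have i': "integrable unit_lebesgue (\<lambda>x. w x * f x)" by (simp add: mult.commute)
  have int: "(LINT x|unit_lebesgue. w x * f x + ?B) = (LINT x|unit_lebesgue. w x * f x) + ?B"
    using i' unit_lebesgue.prob_space by simp
  have wf0: "0 \<le> (LINT x|unit_lebesgue. w x * f x)"
    using bnd coneD(5)[OF f] by (intro integral_unit_nonneg) auto
  have "(LINT x|unit_lebesgue. w x * f x) \<le> (LINT x|unit_lebesgue. 3 * M * f x)"
    using bnd coneD(2,5)[OF f] i' by (intro integral_unit_mono mult_right_mono) auto
  then show "(LINT x|unit_lebesgue. w x * f x + ?B) \<le> 15 * M * ?m"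
    unfolding int by simp
  have "decreasing (\<lambda>x. w x * f x + ?B)"
    unfolding decreasing_def
  proof (intro conjI allI impI)
    show "integrable unit_lebesgue (\<lambda>x. w x * f x + ?B)" using i' by simp
    fix x y :: real assume xy: "0 < x \<and> x \<le> y \<and> y \<le> 1"
    then show "0 \<le> w y * f y + ?B" using bnd[of y] coneD(5)[OF f, of y] B by simp
    show "w y * f y + ?B \<le> w x * f x + ?B"
      using xy bnd[of x] bnd[of y] dec[of x y] coneD(5)[OF f, of y] decreasingD(3)[OF coneD(1)[OF f], of x y]
      by (intro add_right_mono mult_mono) auto
  qed
  moreover have "x powr (1 + \<alpha>) * (w x * f x + ?B) \<le> y powr (1 + \<alpha>) * (w y * f y + ?B)"
    if xy: "0 < x" "x \<le> y" "y \<le> 1" for x y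
  proof -
    let ?F = "\<lambda>x. x powr (1 + \<alpha>) * f x"
    have "?F x \<le> x powr (1 + \<alpha>) * (6 * x powr (- \<alpha>) * ?m)"
      using coneD(4)[OF f, of x] xy by (intro mult_left_mono) auto
    also have "\<dots> = 6 * ?m * x" using xy by (simp add: powr_add powr_minus field_simps)
    finally have F: "?F x \<le> 6 * ?m * x" .
    \<comment> \<open>The drop of w costs at most 2M(y-x) times the cone bound 6 m x for
      x^(1+\<alpha>) f, that is 12 M m x(y-x), and x(y-x) is at most the increment of the power
      1+\<alpha> from x to y; hence the 12 in \<open>?B\<close>.\<close>
    have "w x * ?F x - w y * ?F x = (w x - w y) * ?F x" by (simp add: algebra_simps)
    also have "\<dots> \<le> 2 * M * (y - x) * (6 * ?m * x)"
      using dec[of x y] xy F M coneD(5)[OF f, of x] by (intro mult_mono[of "w x - w y" "2 * M * (y - x)"]) auto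
    also have "\<dots> = ?B * (x * (y - x))" by (simp add: algebra_simps)
    also have "\<dots> \<le> ?B * (y powr (1 + \<alpha>) - x powr (1 + \<alpha>))"
    proof (intro mult_left_mono B)
      have "x * (y - x) \<le> x powr \<alpha> * (y - x)"
      proof (intro mult_right_mono)
        have "x powr 1 \<le> x powr \<alpha>" using xy alpha_less by (intro powr_mono') auto
        then show "x \<le> x powr \<alpha>" using xy by simp
      qed (use xy in auto)
      also have "\<dots> \<le> y powr (1 + \<alpha>) - x powr (1 + \<alpha>)"
        using mult_left_mono[OF powr_mono2[of \<alpha> x y], of y] xy alpha_pos
        by (simp add: powr_add algebra_simps)
      finally show "x * (y - x) \<le> y powr (1 + \<alpha>) - x powr (1 + \<alpha>)" .
    qed
    finally have 1: "w x * ?F x - w y * ?F x \<le> ?B * (y powr (1 + \<alpha>) - x powr (1 + \<alpha>))" .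
    have "w y * ?F x \<le> w y * ?F y"
      using coneD(3)[OF f xy] bnd[of y] xy by (intro mult_left_mono) auto
    then show ?thesis using 1 by (simp add: algebra_simps)
  qed
  moreover have "w x * f x + ?B \<le> 6 * x powr (- \<alpha>) * (LINT x|unit_lebesgue. w x * f x + ?B)"
    if x: "0 < x" "x \<le> 1" for x
  proof -
    let ?p = "x powr (- \<alpha>)"
    have p: "1 \<le> ?p" by (rule one_le_powr_neg[OF x])
    \<comment> \<open>The product is at most 18 M m x^(-\<alpha>), which is 3/2 of \<open>?B\<close>
      x^(-\<alpha>), so the sum is at most 5/2 of it; the integral of the new function is at least
      \<open>?B\<close>, because the added constant counts fully.\<close>
    have "w x * f x \<le> 3 * M * (6 * ?p * ?m)"
      using bnd[of x] coneD(4,5)[OF f x] x M by (intro mult_mono) auto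
    also have "\<dots> = 3/2 * (?B * ?p)" by simp
    finally have "w x * f x + ?B \<le> 3/2 * (?B * ?p) + ?B * ?p"
      using mult_left_mono[OF p B] by simp
    also have "\<dots> \<le> 6 * (?B * ?p)"
      using mult_nonneg_nonneg[OF B powr_ge_zero[of x "- \<alpha>"]] by linarith
    also have "6 * (?B * ?p) = 6 * ?p * ?B" by simp
    also have "\<dots> \<le> 6 * ?p * (LINT x|unit_lebesgue. w x * f x + ?B)"
      unfolding int using wf0 p by (intro mult_left_mono) auto
    finally show ?thesis .
  qed
  ultimately show "cone (\<lambda>x. w x * f x + ?B)" unfolding cone_def by blast
qed

text \<open>u is the difference of u + 2M - Mx and 2M - Mx, both decreasing with values in [0, 3M]
  and dropping at most at rate 2M. The constants added by \<open>cone_affine\<close> cancel, and the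
  two masses of at most 15 M m(f) give 30.\<close>

lemma cone_times_lipschitz:
  assumes f: "cone f" and u: "bounded_lipschitz M u"
  shows "cone_diff (30 * M * (LINT x|unit_lebesgue. f x)) (\<lambda>x. u x * f x)"
proof -
  note [measurable] = measurable_id_unit
  note M = bounded_lipschitzD(3)[OF u]
  have um: "u \<in> borel_measurable unit_lebesgue" using u by (rule measurable_bounded_lipschitz)
  let ?c = "12 * M * (LINT x|unit_lebesgue. f x)"
  let ?w1 = "\<lambda>x. u x + 2 * M - M * x" and ?w2 = "\<lambda>x. 2 * M - M * x"
  have Mx: "0 \<le> M * x" "M * x \<le> M" if "x \<in> {0..1}" for x
    using M that mult_left_mono[of x 1 M] by auto
  have w1: "?w1 \<in> borel_measurable unit_lebesgue" and w2: "?w2 \<in> borel_measurable unit_lebesgue"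
    using um by measurable
  have b1: "0 \<le> ?w1 x \<and> ?w1 x \<le> 3 * M" if "x \<in> {0..1}" for x
    using bounded_lipschitzD(1)[OF u that] Mx[OF that] by auto
  have b2: "0 \<le> ?w2 x \<and> ?w2 x \<le> 3 * M" if "x \<in> {0..1}" for x
    using Mx[OF that] M by auto
  have d1: "?w1 y \<le> ?w1 x \<and> ?w1 x - ?w1 y \<le> 2 * M * (y - x)" if "0 \<le> x" "x \<le> y" "y \<le> 1" for x y
    using bounded_lipschitzD(2)[OF u, of x y] that by (auto simp: abs_le_iff algebra_simps)
  have d2: "?w2 y \<le> ?w2 x \<and> ?w2 x - ?w2 y \<le> 2 * M * (y - x)" if "0 \<le> x" "x \<le> y" "y \<le> 1" for x y
    using M that mult_left_mono[of x y M] by (auto simp: algebra_simps)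
  show ?thesis
    by (rule cone_diffI[OF cone_affine(1)[OF f w1 b1 d1] cone_affine(1)[OF f w2 b2 d2]])
      (use cone_affine(2)[OF f w1 b1 d1] cone_affine(2)[OF f w2 b2 d2] in \<open>auto simp: algebra_simps\<close>)
qed

lemma cone_diff_times_lipschitz:
  assumes "cone_diff K g" and u: "bounded_lipschitz M u"
  shows "cone_diff (30 * M * K) (\<lambda>x. u x * g x)"
proof -
  obtain a b where g: "cone a" "cone b" "g = (\<lambda>x. a x - b x)"
    "(LINT x|unit_lebesgue. a x) + (LINT x|unit_lebesgue. b x) \<le> K" using assms(1) by (rule cone_diffE)
  have "cone_diff (30 * M * (LINT x|unit_lebesgue. a x) + 30 * M * (LINT x|unit_lebesgue. b x)) (\<lambda>x. u x * a x + - (u x * b x))"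
    by (intro cone_diff_add cone_diff_minus cone_times_lipschitz g u)
  moreover have "30 * M * (LINT x|unit_lebesgue. a x) + 30 * M * (LINT x|unit_lebesgue. b x) \<le> 30 * M * K"
    using bounded_lipschitzD(3)[OF u] mult_left_mono[OF g(4), of "30 * M"] by (simp add: distrib_left)
  ultimately have "cone_diff (30 * M * K) (\<lambda>x. u x * a x + - (u x * b x))"
    by (rule cone_diff_mono)
  then show ?thesis by (simp add: g(3) algebra_simps)
qed

end

section \<open>Observables along orbits and decay of the fibre covariances\<close>

locale intermittent_observable = intermittent +
  fixes \<phi> :: "real \<Rightarrow> real" and M :: real
  assumes phi: "bounded_lipschitz M \<phi>" and M_pos: "0 < M"
begin

lemma phi_bound: "x \<in> {0..1} \<Longrightarrow> \<bar>\<phi> x\<bar> \<le> M"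
  using bounded_lipschitzD(1)[OF phi] .

lemma measurable_phi: "\<phi> \<in> borel_measurable unit_lebesgue"
  using phi by (rule measurable_bounded_lipschitz)

lemma measurable_obs: "admissible \<omega> \<Longrightarrow> obs \<phi> j \<omega> \<in> borel_measurable unit_lebesgue"
  unfolding obs_def[abs_def] by (rule measurable_compose_random_orbit[OF _ measurable_phi])

lemma obs_bound: "admissible \<omega> \<Longrightarrow> x \<in> {0..1} \<Longrightarrow> \<bar>obs \<phi> j \<omega> x\<bar> \<le> M"
  unfolding obs_def using phi_bound random_orbit_unit by blast

lemma integrable_obs: "admissible \<omega> \<Longrightarrow> integrable unit_lebesgue (obs \<phi> j \<omega>)"
  using integrable_unit_bounded[OF measurable_obs obs_bound] by blast

definition fibre_mean :: "(nat \<Rightarrow> real) \<Rightarrow> nat \<Rightarrow> real" where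
  "fibre_mean \<omega> j = (LINT x|unit_lebesgue. obs \<phi> j \<omega> x)"

definition centred :: "(nat \<Rightarrow> real) \<Rightarrow> nat \<Rightarrow> real \<Rightarrow> real" where
  "centred \<omega> j x = obs \<phi> j \<omega> x - fibre_mean \<omega> j"

definition fibre_cov :: "(nat \<Rightarrow> real) \<Rightarrow> nat \<Rightarrow> nat \<Rightarrow> real" where
  "fibre_cov \<omega> i j = (LINT x|unit_lebesgue. centred \<omega> i x * centred \<omega> j x)"

lemma fibre_mean_bound:
  assumes w: "admissible \<omega>"
  shows "\<bar>fibre_mean \<omega> j\<bar> \<le> M"
proof -
  have "\<bar>fibre_mean \<omega> j\<bar> \<le> (LINT x|unit_lebesgue. \<bar>obs \<phi> j \<omega> x\<bar>)"
    unfolding fibre_mean_def by (rule integral_abs_bound)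
  also have "\<dots> \<le> (LINT x|unit_lebesgue. M)"
    using obs_bound[OF w] integrable_obs[OF w] by (intro integral_unit_mono) auto
  finally show ?thesis using unit_lebesgue.prob_space by simp
qed

lemma measurable_centred: "admissible \<omega> \<Longrightarrow> centred \<omega> j \<in> borel_measurable unit_lebesgue"
  unfolding centred_def[abs_def] using measurable_obs by measurable

lemma centred_bound:
  assumes "admissible \<omega>" "x \<in> {0..1}"
  shows "\<bar>centred \<omega> j x\<bar> \<le> 2 * M"
  using obs_bound[OF assms, of j] fibre_mean_bound[OF assms(1), of j] unfolding centred_def by linarith

lemma integrable_centred: "admissible \<omega> \<Longrightarrow> integrable unit_lebesgue (centred \<omega> j)"
  using integrable_unit_bounded[OF measurable_centred centred_bound] by blast

lemma integral_centred: "admissible \<omega> \<Longrightarrow> (LINT x|unit_lebesgue. centred \<omega> j x) = 0"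
  unfolding centred_def using integrable_obs unit_lebesgue.prob_space by (simp add: fibre_mean_def)

lemma integrable_centred_times:
  "admissible \<omega> \<Longrightarrow> integrable unit_lebesgue (\<lambda>x. centred \<omega> i x * centred \<omega> j x)"
  using integrable_unit_bounded_mult[OF integrable_centred measurable_centred centred_bound] by blast

lemma fibre_cov_eq:
  assumes "admissible \<omega>"
  shows "fibre_cov \<omega> i j = (LINT x|unit_lebesgue. obs \<phi> i \<omega> x * obs \<phi> j \<omega> x) - fibre_mean \<omega> i * fibre_mean \<omega> j"
proof -
  have i: "integrable unit_lebesgue (\<lambda>x. obs \<phi> i \<omega> x * obs \<phi> j \<omega> x)"
    using integrable_unit_bounded_mult[OF integrable_obs measurable_obs obs_bound] assms by blast
  have "fibre_cov \<omega> i j = (LINT x|unit_lebesgue. obs \<phi> i \<omega> x * obs \<phi> j \<omega> x - fibre_mean \<omega> j * obs \<phi> i \<omega> x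
      - fibre_mean \<omega> i * obs \<phi> j \<omega> x + fibre_mean \<omega> i * fibre_mean \<omega> j)"
    unfolding fibre_cov_def centred_def by (simp add: algebra_simps)
  also have "\<dots> = (LINT x|unit_lebesgue. obs \<phi> i \<omega> x * obs \<phi> j \<omega> x) - fibre_mean \<omega> i * fibre_mean \<omega> j"
    using i integrable_obs[OF assms] unit_lebesgue.prob_space by (simp add: fibre_mean_def[symmetric])
  finally show ?thesis .
qed

lemma bounded_lipschitz_phi_minus:
  assumes "\<bar>c\<bar> \<le> M"
  shows "bounded_lipschitz (2 * M) (\<lambda>x. \<phi> x - c)"
  unfolding bounded_lipschitz_def
proof (intro conjI ballI)
  fix x y :: real assume x: "x \<in> {0..1}"
  show "\<bar>\<phi> x - c\<bar> \<le> 2 * M" using phi_bound[OF x] assms by linarith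
  assume y: "y \<in> {0..1}"
  have "\<bar>\<phi> x - \<phi> y\<bar> \<le> M * \<bar>x - y\<bar>" by (rule bounded_lipschitzD(2)[OF phi x y])
  also have "\<dots> \<le> 2 * M * \<bar>x - y\<bar>" using M_pos by (intro mult_right_mono) auto
  finally show "\<bar>\<phi> x - c - (\<phi> y - c)\<bar> \<le> 2 * M * \<bar>x - y\<bar>" by simp
qed

lemma integral_transfers_one:
  assumes w: "admissible \<omega>" and G: "G \<in> borel_measurable unit_lebesgue" "\<And>x. x \<in> {0..1} \<Longrightarrow> \<bar>G x\<bar> \<le> B"
  shows "(LINT x|unit_lebesgue. transfers n \<omega> (\<lambda>_. 1) x * G x) = (LINT x|unit_lebesgue. G (random_orbit \<omega> n x))"
  using transfers_duality[OF w _ G, of "\<lambda>_. 1" n] by simp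

text \<open>After i steps Lebesgue measure has a density h of mass 1 in the cone. The centred
  observable times h has integral zero and cone norm at most 60 M, so it decays in L1 during the
  next k steps and is finally tested against a function bounded by 2M.\<close>

lemma fibre_cov_bound:
  assumes w: "admissible \<omega>"
  shows "\<bar>fibre_cov \<omega> i (i + k)\<bar> \<le> 120 * M\<^sup>2 * decay k"
proof -
  let ?w = "\<lambda>l. \<omega> (l + i)"
  have w': "admissible ?w" by (rule admissible_shift[OF w])
  let ?u = "\<lambda>x. \<phi> x - fibre_mean \<omega> i" and ?v = "\<lambda>x. \<phi> x - fibre_mean \<omega> (i + k)"
  let ?h = "transfers i \<omega> (\<lambda>_. 1)"
  have u: "bounded_lipschitz (2 * M) ?u" "bounded_lipschitz (2 * M) ?v"
    using fibre_mean_bound[OF w] by (auto intro: bounded_lipschitz_phi_minus)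
  note um = measurable_bounded_lipschitz[OF u(1)] measurable_bounded_lipschitz[OF u(2)]
  have h: "cone ?h" by (intro cone_transfers[OF w] cone_const) simp
  have mh: "(LINT x|unit_lebesgue. ?h x) = 1"
    using transfers_integral(2)[OF w, of "\<lambda>_. 1" i] unit_lebesgue.prob_space by simp
  let ?g = "\<lambda>x. ?u x * ?h x"
  have g: "cone_diff (60 * M) ?g"
    using cone_times_lipschitz[OF h u(1)] mh by simp
  have "(LINT x|unit_lebesgue. ?g x) = (LINT x|unit_lebesgue. ?u (random_orbit \<omega> i x))"
    using integral_transfers_one[OF w um(1) bounded_lipschitzD(1)[OF u(1)], of i] by (simp add: mult.commute)
  also have "\<dots> = 0" using integral_centred[OF w, of i] by (simp add: centred_def obs_def)
  finally have g0: "(LINT x|unit_lebesgue. ?g x) = 0" .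
  let ?G = "\<lambda>x. ?u x * ?v (random_orbit ?w k x)"
  have Gm: "?G \<in> borel_measurable unit_lebesgue"
    using um(1) measurable_compose_random_orbit[OF w' um(2)] by (rule borel_measurable_times)
  have Gb: "\<bar>?G x\<bar> \<le> (2 * M) * (2 * M)" if "x \<in> {0..1}" for x
    unfolding abs_mult using bounded_lipschitzD(1)[OF u(1) that] M_pos
      bounded_lipschitzD(1)[OF u(2) random_orbit_unit[OF w' that]]
    by (intro mult_mono) auto
  have "fibre_cov \<omega> i (i + k) = (LINT x|unit_lebesgue. ?G (random_orbit \<omega> i x))"
    unfolding fibre_cov_def centred_def obs_def by (simp add: random_orbit_add)
  also have "\<dots> = (LINT x|unit_lebesgue. ?h x * ?G x)"
    by (rule integral_transfers_one[OF w Gm Gb, symmetric])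
  also have "\<dots> = (LINT x|unit_lebesgue. ?g x * ?v (random_orbit ?w k x))"
    by (simp add: mult_ac)
  also have "\<dots> = (LINT x|unit_lebesgue. transfers k ?w ?g x * ?v x)"
    by (rule transfers_duality[OF w' cone_diff_integrable[OF g] um(2) bounded_lipschitzD(1)[OF u(2)], symmetric])
  finally have eq: "fibre_cov \<omega> i (i + k) = (LINT x|unit_lebesgue. transfers k ?w ?g x * ?v x)" .
  have ti: "integrable unit_lebesgue (transfers k ?w ?g)"
    by (rule transfers_integral(1)[OF w' cone_diff_integrable[OF g]])
  have "\<bar>fibre_cov \<omega> i (i + k)\<bar> \<le> (LINT x|unit_lebesgue. \<bar>transfers k ?w ?g x * ?v x\<bar>)"
    unfolding eq by (rule integral_abs_bound)
  also have "\<dots> \<le> (LINT x|unit_lebesgue. \<bar>transfers k ?w ?g x\<bar> * (2 * M))"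
    using ti bounded_lipschitzD(1)[OF u(2)] integrable_unit_bounded_mult[OF ti um(2) bounded_lipschitzD(1)[OF u(2)]]
    by (intro integral_unit_mono integrable_abs) (auto simp: abs_mult intro!: mult_left_mono)
  also have "\<dots> = (LINT x|unit_lebesgue. \<bar>transfers k ?w ?g x\<bar>) * (2 * M)" by simp
  also have "\<dots> \<le> (60 * M * decay k) * (2 * M)"
    using cone_diff_decay[OF w' g g0, of k] M_pos by (intro mult_right_mono) auto
  finally show ?thesis by (simp add: power2_eq_square algebra_simps)
qed

lemma fibre_cov_commute: "fibre_cov \<omega> i j = fibre_cov \<omega> j i"
  by (simp add: fibre_cov_def mult.commute)

lemma fibre_cov_bound':
  assumes w: "admissible \<omega>"
  shows "\<bar>fibre_cov \<omega> i j\<bar> \<le> 120 * M\<^sup>2 * decay (max i j - min i j)"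
proof (cases "i \<le> j")
  case True
  then show ?thesis using fibre_cov_bound[OF w, of i "j - i"] by simp
next
  case False
  then show ?thesis using fibre_cov_bound[OF w, of j "i - j"] fibre_cov_commute[of \<omega> i j] by simp
qed

end

section \<open>Twisted transfer operators and decoupling\<close>

context intermittent
begin

text \<open>The 1 is subtracted from the cosine so that both functions are of order \<epsilon> in
  value as well as in slope: as functions of u they vanish at u = 0.\<close>

lemma bounded_lipschitz_trig:
  assumes "bounded_lipschitz L u"
  shows "bounded_lipschitz (\<bar>\<epsilon>\<bar> * L) (\<lambda>x. sin (\<epsilon> * u x))"
    and "bounded_lipschitz (\<bar>\<epsilon>\<bar> * L) (\<lambda>x. cos (\<epsilon> * u x) - 1)"
proof -
  have "\<bar>sin (\<epsilon> * s) - sin (\<epsilon> * t)\<bar> \<le> \<bar>\<epsilon>\<bar> * \<bar>s - t\<bar>" "\<bar>cos (\<epsilon> * s) - cos (\<epsilon> * t)\<bar> \<le> \<bar>\<epsilon>\<bar> * \<bar>s - t\<bar>" for s t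
    using abs_sin_diff_le[of "\<epsilon> * s" "\<epsilon> * t"] abs_cos_diff_le[of "\<epsilon> * s" "\<epsilon> * t"]
    by (auto simp: abs_mult simp flip: right_diff_distrib)
  then show "bounded_lipschitz (\<bar>\<epsilon>\<bar> * L) (\<lambda>x. sin (\<epsilon> * u x))"
    "bounded_lipschitz (\<bar>\<epsilon>\<bar> * L) (\<lambda>x. cos (\<epsilon> * u x) - 1)"
    using bounded_lipschitz_compose[OF assms, of "\<lambda>s. sin (\<epsilon> * s)" "\<bar>\<epsilon>\<bar>"]
      bounded_lipschitz_compose[OF assms, of "\<lambda>s. cos (\<epsilon> * s) - 1" "\<bar>\<epsilon>\<bar>"] by auto
qed

text \<open>The observable may change with time because the centring constants do.\<close>

definition orbit_sum :: "(nat \<Rightarrow> real) \<Rightarrow> (nat \<Rightarrow> real \<Rightarrow> real) \<Rightarrow> nat \<Rightarrow> real \<Rightarrow> real" where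
  "orbit_sum \<omega> \<psi> n x = (\<Sum>j=1..n. \<psi> j (random_orbit \<omega> j x))"

lemma measurable_orbit_sum:
  assumes "admissible \<omega>" "\<And>j. \<psi> j \<in> borel_measurable unit_lebesgue"
  shows "orbit_sum \<omega> \<psi> n \<in> borel_measurable unit_lebesgue"
  unfolding orbit_sum_def[abs_def]
  by (intro borel_measurable_sum measurable_compose_random_orbit assms)

text \<open>\<open>g1\<close> and \<open>g2\<close> are the real and imaginary part of the image of \<open>h\<close> under the twisted transfer
  operators; every step enlarges the cone norm by the factor \<open>1 + O(\<epsilon>)\<close> only.\<close>

lemma twisted_transfer:
  assumes w: "admissible \<omega>" and h: "cone h" and \<psi>: "\<And>j. bounded_lipschitz L (\<psi> j)"
  shows "\<exists>g1 g2. cone_diff ((1 + 60 * L * \<bar>\<epsilon>\<bar>) ^ n * (LINT x|unit_lebesgue. h x)) g1 \<and>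
    cone_diff ((1 + 60 * L * \<bar>\<epsilon>\<bar>) ^ n * (LINT x|unit_lebesgue. h x)) g2 \<and>
    (\<forall>G B. G \<in> borel_measurable unit_lebesgue \<longrightarrow> (\<forall>x\<in>{0..1}. \<bar>G x\<bar> \<le> B) \<longrightarrow>
      (LINT x|unit_lebesgue. h x * (cos (\<epsilon> * orbit_sum \<omega> \<psi> n x) * G (random_orbit \<omega> n x))) = (LINT x|unit_lebesgue. g1 x * G x) \<and>
      (LINT x|unit_lebesgue. h x * (sin (\<epsilon> * orbit_sum \<omega> \<psi> n x) * G (random_orbit \<omega> n x))) = (LINT x|unit_lebesgue. g2 x * G x))"
proof (induction n)
  case 0
  have "cone_diff (LINT x|unit_lebesgue. h x) (\<lambda>_. 0)"
    using coneD(6)[OF h] by (intro cone_diffI[of "\<lambda>_. 0" "\<lambda>_. 0"] cone_const) auto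
  then show ?case
    using cone_imp_cone_diff[OF h] by (intro exI[of _ h] exI[of _ "\<lambda>_. 0"]) (auto simp: orbit_sum_def)
next
  case (Suc n)
  let ?A = "orbit_sum \<omega> \<psi>"
  let ?K = "(1 + 60 * L * \<bar>\<epsilon>\<bar>) ^ n * (LINT x|unit_lebesgue. h x)"
  let ?S = "\<lambda>x. sin (\<epsilon> * \<psi> (Suc n) x)" and ?C = "\<lambda>x. cos (\<epsilon> * \<psi> (Suc n) x)"
  let ?w = "\<lambda>i. \<omega> (i + n)"
  have w': "admissible ?w" by (rule admissible_shift[OF w])
  obtain g1 g2 where g: "cone_diff ?K g1" "cone_diff ?K g2"
    and eq: "\<And>G B. G \<in> borel_measurable unit_lebesgue \<Longrightarrow> (\<And>x. x \<in> {0..1} \<Longrightarrow> \<bar>G x\<bar> \<le> B) \<Longrightarrow>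
      (LINT x|unit_lebesgue. h x * (cos (\<epsilon> * ?A n x) * G (random_orbit \<omega> n x))) = (LINT x|unit_lebesgue. g1 x * G x)"
      "\<And>G B. G \<in> borel_measurable unit_lebesgue \<Longrightarrow> (\<And>x. x \<in> {0..1} \<Longrightarrow> \<bar>G x\<bar> \<le> B) \<Longrightarrow>
      (LINT x|unit_lebesgue. h x * (sin (\<epsilon> * ?A n x) * G (random_orbit \<omega> n x))) = (LINT x|unit_lebesgue. g2 x * G x)"
    using Suc.IH by blast
  let ?P = "transfers 1 ?w"
  have P: "cone_diff ?K (?P g1)" "cone_diff ?K (?P g2)"
    using cone_diff_transfers[OF w'] g by auto
  note iP = cone_diff_integrable[OF P(1)] cone_diff_integrable[OF P(2)]
  \<comment> \<open>Real and imaginary part of (cos + i sin)(\<epsilon> \<psi>) times (P g1 + i P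
    g2). Splitting 1 off the cosine leaves P g1 and P g2 themselves at no cost, and each of the two
    remaining products costs a factor 30 L |\<epsilon>|.\<close>
  let ?g1 = "\<lambda>x. ?P g1 x + (?C x - 1) * ?P g1 x + - (?S x * ?P g2 x)"
  let ?g2 = "\<lambda>x. ?P g2 x + (?C x - 1) * ?P g2 x + ?S x * ?P g1 x"
  have size: "?K + 30 * (\<bar>\<epsilon>\<bar> * L) * ?K + 30 * (\<bar>\<epsilon>\<bar> * L) * ?K = (1 + 60 * L * \<bar>\<epsilon>\<bar>) ^ Suc n * (LINT x|unit_lebesgue. h x)"
    by (simp add: algebra_simps)
  have c1: "cone_diff ((1 + 60 * L * \<bar>\<epsilon>\<bar>) ^ Suc n * (LINT x|unit_lebesgue. h x)) ?g1"
    unfolding size[symmetric]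
    by (intro cone_diff_add cone_diff_minus cone_diff_times_lipschitz P bounded_lipschitz_trig \<psi>)
  have c2: "cone_diff ((1 + 60 * L * \<bar>\<epsilon>\<bar>) ^ Suc n * (LINT x|unit_lebesgue. h x)) ?g2"
    unfolding size[symmetric]
    by (intro cone_diff_add cone_diff_times_lipschitz P bounded_lipschitz_trig \<psi>)
  have \<psi>m: "\<psi> j \<in> borel_measurable unit_lebesgue" for j
    using \<psi> by (rule measurable_bounded_lipschitz)
  have Am: "?A n \<in> borel_measurable unit_lebesgue"
    using w \<psi>m by (rule measurable_orbit_sum)
  have main: "(LINT x|unit_lebesgue. h x * (cos (\<epsilon> * ?A (Suc n) x) * G (random_orbit \<omega> (Suc n) x))) = (LINT x|unit_lebesgue. ?g1 x * G x) \<and>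
      (LINT x|unit_lebesgue. h x * (sin (\<epsilon> * ?A (Suc n) x) * G (random_orbit \<omega> (Suc n) x))) = (LINT x|unit_lebesgue. ?g2 x * G x)"
    if Gm: "G \<in> borel_measurable unit_lebesgue" and Gb: "\<And>x. x \<in> {0..1} \<Longrightarrow> \<bar>G x\<bar> \<le> B" for G B
  proof -
    let ?FC = "\<lambda>x. ?C x * G x" and ?FS = "\<lambda>x. ?S x * G x"
    have Fm: "?FC \<in> borel_measurable unit_lebesgue" "?FS \<in> borel_measurable unit_lebesgue"
      using \<psi>m[of "Suc n"] Gm by measurable
    have le1: "\<bar>c * z\<bar> \<le> B" if "\<bar>c\<bar> \<le> 1" "\<bar>z\<bar> \<le> B" for c z :: real
      using mult_mono[OF that] that by (simp add: abs_mult)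
    have Fb: "\<bar>?FC x\<bar> \<le> B" "\<bar>?FS x\<bar> \<le> B" if "x \<in> {0..1}" for x
      using le1 Gb[OF that] by auto
    let ?T = "random_orbit ?w 1"
    let ?GC = "\<lambda>y. ?FC (?T y)" and ?GS = "\<lambda>y. ?FS (?T y)"
    have GGm: "?GC \<in> borel_measurable unit_lebesgue" "?GS \<in> borel_measurable unit_lebesgue"
      by (rule measurable_compose_random_orbit[OF w' Fm(1)], rule measurable_compose_random_orbit[OF w' Fm(2)])
    have GGb: "\<bar>?GC x\<bar> \<le> B" "\<bar>?GS x\<bar> \<le> B" if "x \<in> {0..1}" for x
      using Fb random_orbit_unit[OF w' that, of 1] by blast+
    have dual: "(LINT x|unit_lebesgue. g x * F (?T x)) = (LINT x|unit_lebesgue. ?P g x * F x)"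
      if "cone_diff ?K g" "F \<in> borel_measurable unit_lebesgue" "\<And>x. x \<in> {0..1} \<Longrightarrow> \<bar>F x\<bar> \<le> B" for g F
      using transfers_duality[OF w' cone_diff_integrable[OF that(1)] that(2,3), of 1] by simp
    have orb: "random_orbit \<omega> (Suc n) x = ?T (random_orbit \<omega> n x)" for x
      by simp
    have Asuc: "?A (Suc n) x = ?A n x + \<psi> (Suc n) (random_orbit \<omega> (Suc n) x)" for x
      by (simp add: orbit_sum_def)
    have ih: "integrable unit_lebesgue (\<lambda>x. h x * (f (\<epsilon> * ?A n x) * F (random_orbit \<omega> n x)))"
      if "f \<in> borel_measurable borel" "\<And>x. \<bar>f x\<bar> \<le> 1" "F \<in> borel_measurable unit_lebesgue" "\<And>x. x \<in> {0..1} \<Longrightarrow> \<bar>F x\<bar> \<le> B" for f F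
    proof (rule integrable_unit_bounded_mult[OF coneD(2)[OF h]])
      show "(\<lambda>x. f (\<epsilon> * ?A n x) * F (random_orbit \<omega> n x)) \<in> borel_measurable unit_lebesgue"
        using that(1) Am measurable_compose_random_orbit[OF w that(3), of n] by measurable
      show "\<bar>f (\<epsilon> * ?A n x) * F (random_orbit \<omega> n x)\<bar> \<le> B" if "x \<in> {0..1}" for x
        using le1 \<open>\<And>x. \<bar>f x\<bar> \<le> 1\<close> \<open>\<And>x. x \<in> {0..1} \<Longrightarrow> \<bar>F x\<bar> \<le> B\<close> random_orbit_unit[OF w that] by blast
    qed
    have ig: "integrable unit_lebesgue (\<lambda>x. ?P g x * F x)"
      if "cone_diff ?K (?P g)" "F \<in> borel_measurable unit_lebesgue" "\<And>x. x \<in> {0..1} \<Longrightarrow> \<bar>F x\<bar> \<le> B" for g F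
      using cone_diff_integrable[OF that(1)] that(2,3) by (rule integrable_unit_bounded_mult)
    have trig: "cos \<in> borel_measurable (borel :: real measure)" "sin \<in> borel_measurable (borel :: real measure)"
      by measurable
    have "(LINT x|unit_lebesgue. h x * (cos (\<epsilon> * ?A (Suc n) x) * G (random_orbit \<omega> (Suc n) x))) =
        (LINT x|unit_lebesgue. h x * (cos (\<epsilon> * ?A n x) * ?GC (random_orbit \<omega> n x)) - h x * (sin (\<epsilon> * ?A n x) * ?GS (random_orbit \<omega> n x)))"
      unfolding Asuc orb by (simp add: distrib_left cos_add algebra_simps)
    also have "\<dots> = (LINT x|unit_lebesgue. h x * (cos (\<epsilon> * ?A n x) * ?GC (random_orbit \<omega> n x)))
        - (LINT x|unit_lebesgue. h x * (sin (\<epsilon> * ?A n x) * ?GS (random_orbit \<omega> n x)))"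
      by (intro Bochner_Integration.integral_diff ih[OF trig(1) _ GGm(1) GGb(1)] ih[OF trig(2) _ GGm(2) GGb(2)]) auto
    also have "\<dots> = (LINT x|unit_lebesgue. ?P g1 x * ?FC x) - (LINT x|unit_lebesgue. ?P g2 x * ?FS x)"
      using eq(1)[OF GGm(1) GGb(1)] eq(2)[OF GGm(2) GGb(2)] dual[OF g(1) Fm(1) Fb(1)] dual[OF g(2) Fm(2) Fb(2)] by simp
    also have "\<dots> = (LINT x|unit_lebesgue. ?P g1 x * ?FC x - ?P g2 x * ?FS x)"
      by (intro Bochner_Integration.integral_diff[symmetric] ig[OF P(1) Fm(1) Fb(1)] ig[OF P(2) Fm(2) Fb(2)])
    also have "\<dots> = (LINT x|unit_lebesgue. ?g1 x * G x)" by (simp add: algebra_simps)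
    finally have 1: "(LINT x|unit_lebesgue. h x * (cos (\<epsilon> * ?A (Suc n) x) * G (random_orbit \<omega> (Suc n) x))) = (LINT x|unit_lebesgue. ?g1 x * G x)" .
    have "(LINT x|unit_lebesgue. h x * (sin (\<epsilon> * ?A (Suc n) x) * G (random_orbit \<omega> (Suc n) x))) =
        (LINT x|unit_lebesgue. h x * (sin (\<epsilon> * ?A n x) * ?GC (random_orbit \<omega> n x)) + h x * (cos (\<epsilon> * ?A n x) * ?GS (random_orbit \<omega> n x)))"
      unfolding Asuc orb by (simp add: distrib_left sin_add algebra_simps)
    also have "\<dots> = (LINT x|unit_lebesgue. h x * (sin (\<epsilon> * ?A n x) * ?GC (random_orbit \<omega> n x)))
        + (LINT x|unit_lebesgue. h x * (cos (\<epsilon> * ?A n x) * ?GS (random_orbit \<omega> n x)))"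
      by (intro Bochner_Integration.integral_add ih[OF trig(2) _ GGm(1) GGb(1)] ih[OF trig(1) _ GGm(2) GGb(2)]) auto
    also have "\<dots> = (LINT x|unit_lebesgue. ?P g2 x * ?FC x) + (LINT x|unit_lebesgue. ?P g1 x * ?FS x)"
      using eq(2)[OF GGm(1) GGb(1)] eq(1)[OF GGm(2) GGb(2)] dual[OF g(2) Fm(1) Fb(1)] dual[OF g(1) Fm(2) Fb(2)] by simp
    also have "\<dots> = (LINT x|unit_lebesgue. ?P g2 x * ?FC x + ?P g1 x * ?FS x)"
      by (intro Bochner_Integration.integral_add[symmetric] ig[OF P(2) Fm(1) Fb(1)] ig[OF P(1) Fm(2) Fb(2)])
    also have "\<dots> = (LINT x|unit_lebesgue. ?g2 x * G x)" by (simp add: algebra_simps)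
    finally show ?thesis using 1 by blast
  qed
  show ?case
  proof (rule exI[of _ ?g1], rule exI[of _ ?g2], intro conjI allI impI c1 c2)
    fix G :: "real \<Rightarrow> real" and B
    assume G: "G \<in> borel_measurable unit_lebesgue" "\<forall>x\<in>{0..1}. \<bar>G x\<bar> \<le> B"
    show "(LINT x|unit_lebesgue. h x * (cos (\<epsilon> * ?A (Suc n) x) * G (random_orbit \<omega> (Suc n) x))) = (LINT x|unit_lebesgue. ?g1 x * G x)"
      by (rule conjunct1[OF main[of G B]]) (use G in auto)
    show "(LINT x|unit_lebesgue. h x * (sin (\<epsilon> * ?A (Suc n) x) * G (random_orbit \<omega> (Suc n) x))) = (LINT x|unit_lebesgue. ?g2 x * G x)"
      by (rule conjunct2[OF main[of G B]]) (use G in auto)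
  qed
qed

text \<open>The twisted image f of h after n steps differs from its integral times the untwisted
  image by a function of integral zero and cone norm at most 2K, which the g steps of the gap damp.
  K is at most an exponential in |\<epsilon>| n, hence bounded as long as the block length is of
  order 1/|\<epsilon>|.\<close>

lemma decoupling:
  assumes w: "admissible \<omega>" and h: "cone h" "(LINT x|unit_lebesgue. h x) = 1"
    and \<psi>: "\<And>j. bounded_lipschitz L (\<psi> j)" and trig: "F = cos \<or> F = sin"
    and Gm: "G \<in> borel_measurable unit_lebesgue" and Gb: "\<And>x. x \<in> {0..1} \<Longrightarrow> \<bar>G x\<bar> \<le> 1"
  shows "\<bar>(LINT x|unit_lebesgue. h x * (F (\<epsilon> * orbit_sum \<omega> \<psi> n x) * G (random_orbit \<omega> (n + g) x)))
    - (LINT x|unit_lebesgue. h x * F (\<epsilon> * orbit_sum \<omega> \<psi> n x)) * (LINT x|unit_lebesgue. h x * G (random_orbit \<omega> (n + g) x))\<bar>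
    \<le> 2 * exp (60 * L * \<bar>\<epsilon>\<bar> * real n) * decay g"
proof -
  let ?K = "(1 + 60 * L * \<bar>\<epsilon>\<bar>) ^ n"
  let ?w = "\<lambda>i. \<omega> (i + n)"
  have w': "admissible ?w" by (rule admissible_shift[OF w])
  obtain f where f: "cone_diff ?K f"
    and eq: "\<And>G B. G \<in> borel_measurable unit_lebesgue \<Longrightarrow> (\<And>x. x \<in> {0..1} \<Longrightarrow> \<bar>G x\<bar> \<le> B) \<Longrightarrow>
      (LINT x|unit_lebesgue. h x * (F (\<epsilon> * orbit_sum \<omega> \<psi> n x) * G (random_orbit \<omega> n x))) = (LINT x|unit_lebesgue. f x * G x)"
  proof -
    obtain g1 g2 where g: "cone_diff ?K g1" "cone_diff ?K g2"
      and eq: "\<forall>G B. G \<in> borel_measurable unit_lebesgue \<longrightarrow> (\<forall>x\<in>{0..1}. \<bar>G x\<bar> \<le> B) \<longrightarrow>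
        (LINT x|unit_lebesgue. h x * (cos (\<epsilon> * orbit_sum \<omega> \<psi> n x) * G (random_orbit \<omega> n x))) = (LINT x|unit_lebesgue. g1 x * G x) \<and>
        (LINT x|unit_lebesgue. h x * (sin (\<epsilon> * orbit_sum \<omega> \<psi> n x) * G (random_orbit \<omega> n x))) = (LINT x|unit_lebesgue. g2 x * G x)"
      using twisted_transfer[where \<psi> = \<psi> and \<epsilon> = \<epsilon> and n = n, OF w h(1) \<psi>] unfolding h(2) mult_1_right by (elim exE conjE) (rule that)
    show thesis
      using trig
    proof
      assume "F = cos"
      then show thesis using that[OF g(1)] eq by blast
    next
      assume "F = sin"
      then show thesis using that[OF g(2)] eq by blast
    qed
  qed
  let ?c = "LINT x|unit_lebesgue. f x"
  have c: "(LINT x|unit_lebesgue. h x * F (\<epsilon> * orbit_sum \<omega> \<psi> n x)) = ?c"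
    using eq[of "\<lambda>_. 1" 1] by simp
  let ?GG = "\<lambda>y. G (random_orbit ?w g y)"
  have GGm: "?GG \<in> borel_measurable unit_lebesgue" by (rule measurable_compose_random_orbit[OF w' Gm])
  have GGb: "\<bar>?GG x\<bar> \<le> 1" if "x \<in> {0..1}" for x using Gb random_orbit_unit[OF w' that] by blast
  let ?h = "transfers n \<omega> h"
  have h': "cone ?h" "(LINT x|unit_lebesgue. ?h x) = 1"
    using cone_transfers[OF w h(1)] transfers_integral(2)[OF w coneD(2)[OF h(1)]] h(2) by auto
  let ?d = "\<lambda>x. f x + - (?c * ?h x)"
  have ci: "\<bar>?c\<bar> \<le> ?K" by (rule cone_diff_L1(2)[OF f])
  have hd: "cone_diff (\<bar>?c\<bar> * 1) (\<lambda>x. ?c * ?h x)"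
    using cone_diff_cmult[OF cone_imp_cone_diff[OF h'(1)], of ?c] h'(2) by simp
  have d: "cone_diff (2 * ?K) ?d"
    using cone_diff_add[OF f cone_diff_minus[OF hd]] by (rule cone_diff_mono) (use ci in simp)
  have if': "integrable unit_lebesgue f" by (rule cone_diff_integrable[OF f])
  have d0: "(LINT x|unit_lebesgue. ?d x) = 0"
    using if' coneD(2)[OF h'(1)] h'(2) by simp
  have e1: "(LINT x|unit_lebesgue. h x * (F (\<epsilon> * orbit_sum \<omega> \<psi> n x) * G (random_orbit \<omega> (n + g) x))) = (LINT x|unit_lebesgue. f x * ?GG x)"
    using eq[OF GGm GGb] by (simp add: random_orbit_add)
  have e2: "(LINT x|unit_lebesgue. h x * G (random_orbit \<omega> (n + g) x)) = (LINT x|unit_lebesgue. ?h x * ?GG x)"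
    using transfers_duality[OF w coneD(2)[OF h(1)] GGm GGb, of n] by (simp add: random_orbit_add)
  have i1: "integrable unit_lebesgue (\<lambda>x. f x * ?GG x)" "integrable unit_lebesgue (\<lambda>x. ?h x * ?GG x)"
    using integrable_unit_bounded_mult[OF _ GGm GGb] if' coneD(2)[OF h'(1)] by auto
  have "(LINT x|unit_lebesgue. f x * ?GG x) - ?c * (LINT x|unit_lebesgue. ?h x * ?GG x) =
      (LINT x|unit_lebesgue. f x * ?GG x - ?c * (?h x * ?GG x))"
    using i1 by simp
  also have "\<dots> = (LINT x|unit_lebesgue. ?d x * ?GG x)" by (simp add: algebra_simps)
  also have "\<dots> = (LINT x|unit_lebesgue. transfers g ?w ?d x * G x)"
    by (rule transfers_duality[OF w' cone_diff_integrable[OF d] Gm Gb, symmetric])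
  finally have e3: "(LINT x|unit_lebesgue. f x * ?GG x) - ?c * (LINT x|unit_lebesgue. ?h x * ?GG x) = (LINT x|unit_lebesgue. transfers g ?w ?d x * G x)" .
  have it: "integrable unit_lebesgue (transfers g ?w ?d)"
    by (rule transfers_integral(1)[OF w' cone_diff_integrable[OF d]])
  have "\<bar>LINT x|unit_lebesgue. transfers g ?w ?d x * G x\<bar> \<le> (LINT x|unit_lebesgue. \<bar>transfers g ?w ?d x * G x\<bar>)"
    by (rule integral_abs_bound)
  also have "\<dots> \<le> (LINT x|unit_lebesgue. \<bar>transfers g ?w ?d x\<bar>)"
  proof (intro integral_unit_mono integrable_abs integrable_unit_bounded_mult[OF it Gm Gb] it)
    fix x :: real assume "0 < x" "x \<le> 1"
    then show "\<bar>transfers g ?w ?d x * G x\<bar> \<le> \<bar>transfers g ?w ?d x\<bar>"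
      using mult_left_mono[OF Gb[of x], of "\<bar>transfers g ?w ?d x\<bar>"] by (simp add: abs_mult)
  qed
  also have "\<dots> \<le> 2 * ?K * decay g" by (rule cone_diff_decay[OF w' d d0])
  also have "?K \<le> exp (60 * L * \<bar>\<epsilon>\<bar> * real n)"
  proof -
    have "?K \<le> exp (60 * L * \<bar>\<epsilon>\<bar>) ^ n"
      using bounded_lipschitzD(3)[OF \<psi>] exp_ge_add_one_self by (intro power_mono) auto
    then show ?thesis by (simp add: exp_of_nat_mult[symmetric] mult.commute)
  qed
  finally have "\<bar>LINT x|unit_lebesgue. transfers g ?w ?d x * G x\<bar> \<le> 2 * exp (60 * L * \<bar>\<epsilon>\<bar> * real n) * decay g"
    using decay_pos[of g] by (simp add: mult_right_mono)
  then show ?thesis unfolding e1 e2 c e3 .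
qed

end

section \<open>Characteristic functions on the unit interval and factorization over blocks\<close>

definition unit_cf :: "(real \<Rightarrow> real) \<Rightarrow> complex" where
  "unit_cf X = (CLINT x|unit_lebesgue. cis (X x))"

lemma integrable_cis:
  assumes [measurable]: "X \<in> borel_measurable unit_lebesgue"
  shows "integrable unit_lebesgue (\<lambda>x. cis (X x))"
  by (rule unit_lebesgue.integrable_const_bound[of _ 1]) (auto simp: cis_conv_exp)

lemma Re_unit_cf:
  assumes "X \<in> borel_measurable unit_lebesgue"
  shows "Re (unit_cf X) = (LINT x|unit_lebesgue. cos (X x))"
  using integral_Re[OF integrable_cis[OF assms]] by (simp add: unit_cf_def)

lemma Im_unit_cf:
  assumes "X \<in> borel_measurable unit_lebesgue"
  shows "Im (unit_cf X) = (LINT x|unit_lebesgue. sin (X x))"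
  using integral_Im[OF integrable_cis[OF assms]] by (simp add: unit_cf_def)

lemma norm_unit_cf_le:
  assumes "X \<in> borel_measurable unit_lebesgue"
  shows "norm (unit_cf X) \<le> 1"
proof -
  have "norm (unit_cf X) \<le> (LINT x|unit_lebesgue. norm (cis (X x)))"
    unfolding unit_cf_def by (rule integral_norm_bound)
  then show ?thesis using unit_lebesgue.prob_space by simp
qed

lemma norm_unit_cf_diff_le:
  assumes [measurable]: "X \<in> borel_measurable unit_lebesgue" "Y \<in> borel_measurable unit_lebesgue"
    and i: "integrable unit_lebesgue (\<lambda>x. \<bar>X x - Y x\<bar>)"
  shows "norm (unit_cf X - unit_cf Y) \<le> (LINT x|unit_lebesgue. \<bar>X x - Y x\<bar>)"
proof -
  have "unit_cf X - unit_cf Y = (CLINT x|unit_lebesgue. cis (X x) - cis (Y x))"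
    unfolding unit_cf_def using assms by (simp add: integrable_cis)
  also have "norm \<dots> \<le> (LINT x|unit_lebesgue. norm (cis (X x) - cis (Y x)))"
    by (rule integral_norm_bound)
  also have "\<dots> \<le> (LINT x|unit_lebesgue. \<bar>X x - Y x\<bar>)"
  proof (intro integral_unit_mono i integrable_norm)
    show "integrable unit_lebesgue (\<lambda>x. cis (X x) - cis (Y x))" using assms by (simp add: integrable_cis)
    fix x :: real
    have "cis (X x) - cis (Y x) = cis (Y x) * (cis (X x - Y x) - 1)"
      by (simp add: algebra_simps cis_mult)
    then have "norm (cis (X x) - cis (Y x)) = norm (cis (X x - Y x) - 1)"
      by (simp add: norm_mult)
    also have "\<dots> \<le> \<bar>X x - Y x\<bar>"
      using iexp_approx1[of "X x - Y x" 0] by (simp add: cis_conv_exp)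
    finally show "norm (cis (X x) - cis (Y x)) \<le> \<bar>X x - Y x\<bar>" .
  qed
  finally show ?thesis .
qed

context intermittent_observable
begin

definition block_sum :: "(nat \<Rightarrow> real) \<Rightarrow> nat \<Rightarrow> nat \<Rightarrow> real \<Rightarrow> real" where
  "block_sum \<omega> a k x = (\<Sum>j=1..k. centred \<omega> (a + j) x)"

lemma measurable_block_sum: "admissible \<omega> \<Longrightarrow> block_sum \<omega> a k \<in> borel_measurable unit_lebesgue"
  unfolding block_sum_def[abs_def] by (intro borel_measurable_sum measurable_centred)

text \<open>The past before time a is absorbed into a cone density, and cosine and sine of the two
  arguments are decoupled separately. Real and imaginary part of the error contain two such products
  each, whence 8 = 4 * 2; the centred observables have constant 2M, whence 120 = 60 * 2.\<close>

lemma unit_cf_split: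
  assumes w: "admissible \<omega>" and Ym: "Y \<in> borel_measurable unit_lebesgue"
  shows "norm (unit_cf (\<lambda>x. \<epsilon> * block_sum \<omega> a k x + Y (random_orbit \<omega> (a + k + g) x))
      - unit_cf (\<lambda>x. \<epsilon> * block_sum \<omega> a k x) * unit_cf (\<lambda>x. Y (random_orbit \<omega> (a + k + g) x)))
    \<le> 8 * exp (120 * M * \<bar>\<epsilon>\<bar> * real k) * decay g"
proof -
  let ?w = "\<lambda>i. \<omega> (i + a)" and ?\<psi> = "\<lambda>j x. \<phi> x - fibre_mean \<omega> (a + j)"
  let ?h = "transfers a \<omega> (\<lambda>_. 1)"
  let ?B = "\<lambda>x. \<epsilon> * block_sum \<omega> a k x" and ?Y = "\<lambda>x. Y (random_orbit \<omega> (a + k + g) x)"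
  let ?d = "2 * exp (120 * M * \<bar>\<epsilon>\<bar> * real k) * decay g"
  have w': "admissible ?w" by (rule admissible_shift[OF w])
  have h: "cone ?h" by (intro cone_transfers[OF w] cone_const) simp
  have mh: "(LINT x|unit_lebesgue. ?h x) = 1"
    using transfers_integral(2)[OF w, of "\<lambda>_. 1" a] unit_lebesgue.prob_space by simp
  have \<psi>: "bounded_lipschitz (2 * M) (?\<psi> j)" for j
    using fibre_mean_bound[OF w] by (rule bounded_lipschitz_phi_minus)
  have Am: "orbit_sum ?w ?\<psi> k \<in> borel_measurable unit_lebesgue"
    by (intro measurable_orbit_sum[OF w'] measurable_bounded_lipschitz[OF \<psi>])
  have Beq: "block_sum \<omega> a k x = orbit_sum ?w ?\<psi> k (random_orbit \<omega> a x)" for x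
    unfolding block_sum_def orbit_sum_def centred_def obs_def by (simp add: random_orbit_add)
  have Yeq: "?Y x = Y (random_orbit ?w (k + g) (random_orbit \<omega> a x))" for x
    using random_orbit_add[of \<omega> a "k + g" x] by (simp add: add.assoc)
  have Bm: "?B \<in> borel_measurable unit_lebesgue" using measurable_block_sum[OF w] by measurable
  have Y'm: "?Y \<in> borel_measurable unit_lebesgue" by (rule measurable_compose_random_orbit[OF w Ym])
  have push: "(LINT x|unit_lebesgue. H (random_orbit \<omega> a x)) = (LINT x|unit_lebesgue. ?h x * H x)"
    if "H \<in> borel_measurable unit_lebesgue" "\<And>x. x \<in> {0..1} \<Longrightarrow> \<bar>H x\<bar> \<le> 1" for H
    by (rule integral_transfers_one[OF w that, symmetric])
  have part: "\<bar>(LINT x|unit_lebesgue. F1 (?B x) * F2 (?Y x)) - (LINT x|unit_lebesgue. F1 (?B x)) * (LINT x|unit_lebesgue. F2 (?Y x))\<bar> \<le> ?d"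
    if F1: "F1 = cos \<or> F1 = sin" and F2: "F2 = cos \<or> F2 = sin" for F1 F2 :: "real \<Rightarrow> real"
  proof -
    have m [measurable]: "F1 \<in> borel_measurable borel" "F2 \<in> borel_measurable borel"
      using F1 F2 by (auto intro: borel_measurable_cos borel_measurable_sin borel_measurable_continuous_onI continuous_intros)
    have b: "\<bar>F1 x\<bar> \<le> 1" "\<bar>F2 x\<bar> \<le> 1" for x using F1 F2 by auto
    let ?H1 = "\<lambda>x. F1 (\<epsilon> * orbit_sum ?w ?\<psi> k x)" and ?H2 = "\<lambda>x. F2 (Y (random_orbit ?w (k + g) x))"
    have H1: "?H1 \<in> borel_measurable unit_lebesgue" using Am by measurable
    have Gm: "(\<lambda>x. F2 (Y x)) \<in> borel_measurable unit_lebesgue" using Ym by measurable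
    have H2: "?H2 \<in> borel_measurable unit_lebesgue" by (rule measurable_compose_random_orbit[OF w' Gm])
    have bb: "\<bar>?H1 x * ?H2 x\<bar> \<le> 1" for x
      using mult_mono[OF b(1)[of "\<epsilon> * orbit_sum ?w ?\<psi> k x"] b(2)[of "Y (random_orbit ?w (k + g) x)"]] by (simp add: abs_mult)
    have "(LINT x|unit_lebesgue. F1 (?B x) * F2 (?Y x)) = (LINT x|unit_lebesgue. ?h x * (?H1 x * ?H2 x))"
      unfolding Beq Yeq by (rule push[OF borel_measurable_times[OF H1 H2] bb])
    moreover have "(LINT x|unit_lebesgue. F1 (?B x)) = (LINT x|unit_lebesgue. ?h x * ?H1 x)"
      unfolding Beq by (rule push[OF H1 b(1)])
    moreover have "(LINT x|unit_lebesgue. F2 (?Y x)) = (LINT x|unit_lebesgue. ?h x * ?H2 x)"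
      unfolding Yeq by (rule push[OF H2 b(2)])
    ultimately show ?thesis
      using decoupling[where L = "2 * M" and \<epsilon> = \<epsilon> and n = k and g = g, OF w' h mh \<psi> F1 Gm] b(2) by (simp add: mult_ac)
  qed
  have Sm: "(\<lambda>x. ?B x + ?Y x) \<in> borel_measurable unit_lebesgue" using Bm Y'm by measurable
  have int: "integrable unit_lebesgue (\<lambda>x. F1 (?B x) * F2 (?Y x))"
    if F1: "F1 = cos \<or> F1 = sin" and F2: "F2 = cos \<or> F2 = sin" for F1 F2 :: "real \<Rightarrow> real"
  proof -
    have m [measurable]: "F1 \<in> borel_measurable borel" "F2 \<in> borel_measurable borel"
      using F1 F2 by (auto intro: borel_measurable_cos borel_measurable_sin borel_measurable_continuous_onI continuous_intros)
    have b: "\<bar>F1 x\<bar> \<le> 1" "\<bar>F2 x\<bar> \<le> 1" for x using F1 F2 by auto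
    have "\<bar>F1 s * F2 t\<bar> \<le> 1" for s t using mult_mono[OF b(1)[of s] b(2)[of t]] by (simp add: abs_mult)
    then show ?thesis
      by (intro integrable_unit_bounded[of _ 1] borel_measurable_times measurable_compose[OF Bm m(1)] measurable_compose[OF Y'm m(2)])
  qed
  let ?D = "unit_cf (\<lambda>x. ?B x + ?Y x) - unit_cf ?B * unit_cf ?Y"
  have "Re ?D = ((LINT x|unit_lebesgue. cos (?B x) * cos (?Y x)) - (LINT x|unit_lebesgue. cos (?B x)) * (LINT x|unit_lebesgue. cos (?Y x)))
    - ((LINT x|unit_lebesgue. sin (?B x) * sin (?Y x)) - (LINT x|unit_lebesgue. sin (?B x)) * (LINT x|unit_lebesgue. sin (?Y x)))"
    using int[of cos cos] int[of sin sin]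
    by (simp add: Re_unit_cf[OF Sm] Re_unit_cf[OF Bm] Re_unit_cf[OF Y'm] Im_unit_cf[OF Bm] Im_unit_cf[OF Y'm] cos_add)
  then have "\<bar>Re ?D\<bar> \<le> ?d + ?d" using part[OF disjI1[OF refl] disjI1[OF refl]] part[OF disjI2[OF refl] disjI2[OF refl]] by linarith
  moreover have "Im ?D = ((LINT x|unit_lebesgue. sin (?B x) * cos (?Y x)) - (LINT x|unit_lebesgue. sin (?B x)) * (LINT x|unit_lebesgue. cos (?Y x)))
    + ((LINT x|unit_lebesgue. cos (?B x) * sin (?Y x)) - (LINT x|unit_lebesgue. cos (?B x)) * (LINT x|unit_lebesgue. sin (?Y x)))"
    using int[of cos sin] int[of sin cos]
    by (simp add: Im_unit_cf[OF Sm] Re_unit_cf[OF Bm] Re_unit_cf[OF Y'm] Im_unit_cf[OF Bm] Im_unit_cf[OF Y'm] sin_add)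
  then have "\<bar>Im ?D\<bar> \<le> ?d + ?d" using part[OF disjI1[OF refl] disjI2[OF refl]] part[OF disjI2[OF refl] disjI1[OF refl]] by linarith
  ultimately show ?thesis using cmod_le[of ?D] by linarith
qed

text \<open>The blocks after the first are a function of the position after its gap, so
  \<open>unit_cf_split\<close> peels off one block at a time. All factors have norm at most 1, hence
  the errors add up; the start index \<open>l\<close> is generalized for the induction.\<close>

lemma unit_cf_blocks:
  assumes w: "admissible \<omega>"
  shows "norm (unit_cf (\<lambda>x. \<epsilon> * (\<Sum>i<N. block_sum \<omega> ((l + i) * (k + g)) k x))
      - (\<Prod>i<N. unit_cf (\<lambda>x. \<epsilon> * block_sum \<omega> ((l + i) * (k + g)) k x)))
    \<le> real N * (8 * exp (120 * M * \<bar>\<epsilon>\<bar> * real k) * decay g)"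
proof (induction N arbitrary: l)
  case 0
  then show ?case using unit_lebesgue.prob_space by (simp add: unit_cf_def)
next
  case (Suc N)
  let ?q = "k + g" and ?d = "8 * exp (120 * M * \<bar>\<epsilon>\<bar> * real k) * decay g"
  let ?B = "\<lambda>i x. \<epsilon> * block_sum \<omega> ((l + i) * ?q) k x"
  let ?w = "\<lambda>i. \<omega> (i + Suc l * ?q)"
  have w': "admissible ?w" by (rule admissible_shift[OF w])
  \<comment> \<open>The later blocks as a function of the position z at time (l+1)(k+g); the
    centring constants still refer to the original sequence and start.\<close>
  define Y where "Y z = \<epsilon> * (\<Sum>i<N. \<Sum>j=1..k. \<phi> (random_orbit ?w (i * ?q + j) z) - fibre_mean \<omega> ((Suc l + i) * ?q + j))" for z
  have Ym: "Y \<in> borel_measurable unit_lebesgue"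
    unfolding Y_def[abs_def]
    by (intro borel_measurable_times borel_measurable_sum borel_measurable_diff borel_measurable_const
        measurable_compose_random_orbit[OF w' measurable_phi])
  have Yeq: "\<epsilon> * (\<Sum>i<N. block_sum \<omega> ((Suc l + i) * ?q) k x) = Y (random_orbit \<omega> (l * ?q + k + g) x)" for x
  proof -
    have "centred \<omega> ((Suc l + i) * ?q + j) x = \<phi> (random_orbit ?w (i * ?q + j) (random_orbit \<omega> (l * ?q + k + g) x)) - fibre_mean \<omega> ((Suc l + i) * ?q + j)" for i j
    proof -
      have "random_orbit \<omega> ((Suc l + i) * ?q + j) x = random_orbit \<omega> (Suc l * ?q + (i * ?q + j)) x"
        by (simp only: add_mult_distrib add.assoc)
      also have "\<dots> = random_orbit ?w (i * ?q + j) (random_orbit \<omega> (Suc l * ?q) x)"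
        by (rule random_orbit_add)
      finally have "random_orbit \<omega> ((Suc l + i) * ?q + j) x = random_orbit ?w (i * ?q + j) (random_orbit \<omega> (Suc l * ?q) x)" .
      moreover have "l * ?q + k + g = Suc l * ?q" by simp
      ultimately show ?thesis by (simp only: centred_def obs_def)
    qed
    then show ?thesis unfolding Y_def block_sum_def by (simp only:)
  qed
  have split: "norm (unit_cf (\<lambda>x. ?B 0 x + \<epsilon> * (\<Sum>i<N. block_sum \<omega> ((Suc l + i) * ?q) k x))
      - unit_cf (?B 0) * unit_cf (\<lambda>x. \<epsilon> * (\<Sum>i<N. block_sum \<omega> ((Suc l + i) * ?q) k x))) \<le> ?d"
    unfolding Yeq using unit_cf_split[OF w Ym, of \<epsilon> "l * ?q" k g] by simp
  have sum: "(\<lambda>x. \<epsilon> * (\<Sum>i<Suc N. block_sum \<omega> ((l + i) * ?q) k x)) = (\<lambda>x. ?B 0 x + \<epsilon> * (\<Sum>i<N. block_sum \<omega> ((Suc l + i) * ?q) k x))"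
    by (simp add: sum.lessThan_Suc_shift distrib_left del: sum.lessThan_Suc)
  have prod: "(\<Prod>i<Suc N. unit_cf (?B i)) = unit_cf (?B 0) * (\<Prod>i<N. unit_cf (\<lambda>x. \<epsilon> * block_sum \<omega> ((Suc l + i) * ?q) k x))"
    by (simp add: prod.lessThan_Suc_shift del: prod.lessThan_Suc)
  have "norm (unit_cf (?B 0) * (unit_cf (\<lambda>x. \<epsilon> * (\<Sum>i<N. block_sum \<omega> ((Suc l + i) * ?q) k x))
      - (\<Prod>i<N. unit_cf (\<lambda>x. \<epsilon> * block_sum \<omega> ((Suc l + i) * ?q) k x)))) \<le> 1 * (real N * ?d)"
    unfolding norm_mult using measurable_block_sum[OF w]
    by (intro mult_mono Suc.IH norm_unit_cf_le) auto
  then show ?case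
    unfolding sum prod using split
      norm_triangle_ineq[of "unit_cf (\<lambda>x. ?B 0 x + \<epsilon> * (\<Sum>i<N. block_sum \<omega> ((Suc l + i) * ?q) k x)) - unit_cf (?B 0) * unit_cf (\<lambda>x. \<epsilon> * (\<Sum>i<N. block_sum \<omega> ((Suc l + i) * ?q) k x))"
        "unit_cf (?B 0) * (unit_cf (\<lambda>x. \<epsilon> * (\<Sum>i<N. block_sum \<omega> ((Suc l + i) * ?q) k x))
      - (\<Prod>i<N. unit_cf (\<lambda>x. \<epsilon> * block_sum \<omega> ((Suc l + i) * ?q) k x)))"]
    by (simp add: algebra_simps)
qed

end

section \<open>The central limit theorem along a fixed parameter sequence\<close>

lemma char_normal:
  assumes "0 < \<sigma>"
  shows "char (density lborel (normal_density 0 \<sigma>)) t = complex_of_real (exp (- (\<sigma> * t)\<^sup>2 / 2))"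
proof -
  interpret N: prob_space std_normal_distribution by (rule prob_space_normal_density) simp
  have "distributed std_normal_distribution lborel (\<lambda>x. x) std_normal_density"
    by (simp add: distributed_def distr_id2 normal_density_nonneg)
  from N.normal_density_affine[OF this, of \<sigma> 0] assms
  have d: "distributed std_normal_distribution lborel (\<lambda>x. \<sigma> * x) (normal_density 0 \<sigma>)" by simp
  have "char (density lborel (normal_density 0 \<sigma>)) t = char (distr std_normal_distribution lborel (\<lambda>x. \<sigma> * x)) t"
    using d by (simp add: distributed_def)
  also have "\<dots> = char std_normal_distribution (\<sigma> * t)"
    unfolding char_def by (subst integral_distr) (auto simp: mult_ac)
  finally show ?thesis by (simp add: char_std_normal_distribution)
qed

lemma exp_minus_taylor_bound:
  fixes u :: real
  assumes "0 \<le> u"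
  shows "\<bar>1 - u - exp (- u)\<bar> \<le> u\<^sup>2 / 2"
proof -
  have "1 - 0 + 0\<^sup>2 / 2 - exp (- 0) \<le> 1 - u + u\<^sup>2 / 2 - exp (- u)"
  proof (rule DERIV_nonneg_imp_nondecreasing[OF assms])
    fix x :: real
    have "((\<lambda>u. 1 - u + u\<^sup>2 / 2 - exp (- u)) has_real_derivative - 1 + x + exp (- x)) (at x)"
      by (auto intro!: derivative_eq_intros)
    then show "\<exists>y. ((\<lambda>u. 1 - u + u\<^sup>2 / 2 - exp (- u)) has_real_derivative y) (at x) \<and> 0 \<le> y"
      using exp_ge_add_one_self[of "- x"] by (intro exI conjI) auto
  qed
  then show ?thesis using exp_ge_add_one_self[of "- u"] by simp
qed

lemma exp_minus_lipschitz:
  fixes a b :: real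
  assumes "0 \<le> a" "0 \<le> b"
  shows "\<bar>exp (- a) - exp (- b)\<bar> \<le> \<bar>a - b\<bar>"
proof -
  have *: "exp (- x) - exp (- y) \<le> y - x" if "0 \<le> x" "x \<le> y" for x y :: real
  proof -
    have "1 - exp (- (y - x)) \<le> y - x" using exp_ge_add_one_self[of "- (y - x)"] by linarith
    then have "exp (- x) * (1 - exp (- (y - x))) \<le> 1 * (y - x)"
      using that by (intro mult_mono) auto
    moreover have "exp (- x) * exp (- (y - x)) = exp (- y)" by (simp flip: exp_add)
    ultimately show ?thesis by (simp add: right_diff_distrib)
  qed
  show ?thesis
    using *[of a b] *[of b a] assms by (cases "a \<le> b") (auto simp: abs_if)
qed

text \<open>Second order expansion: the remainder |X|^3/6 is at most B X^2/6, the linear term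
  integrates to zero, and 1 - v/2 is then replaced by exp(-v/2).\<close>

lemma norm_unit_cf_taylor:
  assumes Xm [measurable]: "X \<in> borel_measurable unit_lebesgue"
    and b: "\<And>x. x \<in> {0..1} \<Longrightarrow> \<bar>X x\<bar> \<le> B" and m: "(LINT x|unit_lebesgue. X x) = 0"
    and v: "(LINT x|unit_lebesgue. (X x)\<^sup>2) \<le> V"
  shows "norm (unit_cf X - complex_of_real (exp (- (LINT x|unit_lebesgue. (X x)\<^sup>2) / 2))) \<le> B * V / 6 + (V / 2)\<^sup>2 / 2"
proof -
  let ?v = "LINT x|unit_lebesgue. (X x)\<^sup>2"
  have B: "0 \<le> B" using b[of 0] by simp
  have v0: "0 \<le> ?v" by simp
  have iX: "integrable unit_lebesgue X" by (rule integrable_unit_bounded[OF Xm b])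
  have iX2: "integrable unit_lebesgue (\<lambda>x. (X x)\<^sup>2)"
    using integrable_unit_bounded_mult[OF iX Xm b] by (simp add: power2_eq_square)
  have ic: "integrable unit_lebesgue (\<lambda>x. complex_of_real (X x))" "integrable unit_lebesgue (\<lambda>x. complex_of_real ((X x)\<^sup>2))"
    using integrable_of_real[OF iX] integrable_of_real[OF iX2] by auto
  let ?T = "\<lambda>x. 1 + \<i> * complex_of_real (X x) - complex_of_real ((X x)\<^sup>2) / 2"
  have iT: "integrable unit_lebesgue ?T" using ic by auto
  have ET: "(CLINT x|unit_lebesgue. ?T x) = complex_of_real (1 - ?v / 2)"
    using ic m unit_lebesgue.prob_space by (simp add: integral_of_real del: of_real_power)
  have "unit_cf X - complex_of_real (1 - ?v / 2) = (CLINT x|unit_lebesgue. cis (X x) - ?T x)"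
    unfolding unit_cf_def ET[symmetric] using iT integrable_cis[OF Xm] by simp
  also have "norm \<dots> \<le> (LINT x|unit_lebesgue. norm (cis (X x) - ?T x))"
    by (rule integral_norm_bound)
  also have "\<dots> \<le> (LINT x|unit_lebesgue. B / 6 * (X x)\<^sup>2)"
  proof (intro integral_unit_mono integrable_norm)
    show "integrable unit_lebesgue (\<lambda>x. cis (X x) - ?T x)"
      by (rule Bochner_Integration.integrable_diff[OF integrable_cis[OF Xm] iT])
    show "integrable unit_lebesgue (\<lambda>x. B / 6 * (X x)\<^sup>2)" using iX2 by simp
    fix x :: real assume x: "0 < x" "x \<le> 1"
    have "norm (cis (X x) - ?T x) \<le> \<bar>X x\<bar> ^ 3 / 6"
      using iexp_approx1[of "X x" 2]
      by (simp add: cis_conv_exp eval_nat_numeral algebra_simps power2_eq_square)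
    also have "\<dots> = \<bar>X x\<bar> * (X x)\<^sup>2 / 6" by (simp add: power3_eq_cube power2_eq_square)
    also have "\<dots> \<le> B * (X x)\<^sup>2 / 6" using b[of x] x by (intro divide_right_mono mult_right_mono) auto
    finally show "norm (cis (X x) - ?T x) \<le> B / 6 * (X x)\<^sup>2" by simp
  qed
  also have "\<dots> = B * ?v / 6" by simp
  also have "\<dots> \<le> B * V / 6" using v B by (intro divide_right_mono mult_left_mono) auto
  finally have 1: "norm (unit_cf X - complex_of_real (1 - ?v / 2)) \<le> B * V / 6" .
  have "norm (complex_of_real (1 - ?v / 2) - complex_of_real (exp (- ?v / 2))) = \<bar>1 - ?v / 2 - exp (- (?v / 2))\<bar>"
    by (simp flip: of_real_diff)
  also have "\<dots> \<le> (?v / 2)\<^sup>2 / 2" by (rule exp_minus_taylor_bound) simp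
  also have "\<dots> \<le> (V / 2)\<^sup>2 / 2" using v v0 by (intro divide_right_mono power_mono) auto
  finally show ?thesis
    using 1 norm_triangle_ineq[of "unit_cf X - complex_of_real (1 - ?v / 2)" "complex_of_real (1 - ?v / 2) - complex_of_real (exp (- ?v / 2))"]
    by simp
qed

text \<open>\<open>max i j - min i j\<close> is |i - j| within the naturals. On each side of i every
  distance occurs at most once, hence the factor 2.\<close>

lemma sum_dist_le:
  fixes f :: "nat \<Rightarrow> real"
  assumes f: "summable f" "\<And>k. 0 \<le> f k"
    and J: "finite J" and gap: "\<And>j. j \<in> J \<Longrightarrow> g \<le> max i j - min i j"
  shows "(\<Sum>j\<in>J. f (max i j - min i j)) \<le> 2 * (\<Sum>k. f (k + g))"
proof -
  have part: "(\<Sum>j\<in>A. f (h j)) \<le> (\<Sum>k. f (k + g))"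
    if A: "finite A" "inj_on h A" "\<And>j. j \<in> A \<Longrightarrow> g \<le> h j" for A and h :: "nat \<Rightarrow> nat"
  proof -
    have inj: "inj_on (\<lambda>j. h j - g) A"
      by (rule inj_onI) (metis A(2,3) inj_onD le_add_diff_inverse2)
    have "(\<Sum>j\<in>A. f (h j)) = (\<Sum>j\<in>A. f ((h j - g) + g))"
      using A(3) by (intro sum.cong) auto
    also have "\<dots> = (\<Sum>k\<in>(\<lambda>j. h j - g) ` A. f (k + g))"
      using inj by (simp add: sum.reindex)
    also have "\<dots> \<le> (\<Sum>k. f (k + g))"
      using A(1) f by (intro sum_le_suminf) (auto simp: summable_iff_shift)
    finally show ?thesis .
  qed
  have "(\<Sum>j\<in>J. f (max i j - min i j)) = (\<Sum>j\<in>{j\<in>J. j \<le> i}. f (max i j - min i j)) + (\<Sum>j\<in>{j\<in>J. i < j}. f (max i j - min i j))"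
    using J by (subst sum.union_disjoint[symmetric]) (auto intro!: sum.cong)
  also have "\<dots> \<le> (\<Sum>k. f (k + g)) + (\<Sum>k. f (k + g))"
  proof (intro add_mono part)
    show "g \<le> max i j - min i j" if "j \<in> {j\<in>J. j \<le> i}" for j using gap that by blast
    show "g \<le> max i j - min i j" if "j \<in> {j\<in>J. i < j}" for j using gap that by blast
  qed (use J in \<open>auto simp: inj_on_def\<close>)
  finally show ?thesis by simp
qed

section \<open>Tails of the rate and the choice of block lengths\<close>

context intermittent
begin

definition decay_tail :: "nat \<Rightarrow> real" where
  "decay_tail g = (\<Sum>k. decay (k + g))"

lemma sum_decay_le:
  assumes "finite J" and "\<And>j. j \<in> J \<Longrightarrow> g \<le> max i j - min i j"
  shows "(\<Sum>j\<in>J. decay (max i j - min i j)) \<le> 2 * decay_tail g"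
  unfolding decay_tail_def using assms
  by (intro sum_dist_le summable_decay less_imp_le[OF decay_pos])

lemma decay_tail_nonneg: "0 \<le> decay_tail g"
  unfolding decay_tail_def using summable_decay decay_pos
  by (intro suminf_nonneg) (auto simp: summable_iff_shift less_imp_le)

lemma decay_tail_tendsto_0: "decay_tail \<longlonglongrightarrow> 0"
  unfolding decay_tail_def using suminf_exist_split2[OF summable_decay] by simp

text \<open>Take k near n^a and g near n^b with b < a < 1/2, both close to 1/2. The last condition
  needs 1 - a - b \<theta> < 0 for \<theta> = \<open>decay_exponent\<close>; at a = b = 1/2 the left
  side is -(\<theta>-1)/2, so \<theta> > 1 leaves room, and \<open>e\<close> is chosen to use up
  half of it.\<close>

lemma bernstein_block_lengths:
  obtains k g :: "nat \<Rightarrow> nat" where "\<And>n. 1 \<le> k n"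
    and "(\<lambda>n. real (k n) / sqrt (real n)) \<longlonglongrightarrow> 0" and "(\<lambda>n. real (g n) / real (k n)) \<longlonglongrightarrow> 0"
    and "filterlim g at_top sequentially" and "(\<lambda>n. real n / real (k n) * decay (g n)) \<longlonglongrightarrow> 0"
proof -
  define e where "e = (decay_exponent - 1) / (4 * (1 + 2 * decay_exponent))"
  define a where "a = 1/2 - e"
  define b where "b = 1/2 - 2 * e"
  note th = decay_exponent_gt_1
  have e: "0 < e" "e < 1/8"
    using th by (auto simp: e_def field_simps)
  have ab: "0 < b" "b < a" "a < 1/2" "0 < a" using e by (auto simp: a_def b_def)
  have exps: "1 - a - b * decay_exponent < 0"
  proof -
    have "e * (1 + 2 * decay_exponent) = (decay_exponent - 1) / 4"
    proof -
      have *: "x / (4 * y) * y = x / 4" if "y \<noteq> 0" for x y :: real using that by simp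
      show ?thesis unfolding e_def by (rule *) (use th in simp)
    qed
    moreover have "1 - a - b * decay_exponent = e * (1 + 2 * decay_exponent) - (decay_exponent - 1) / 2"
      by (simp add: a_def b_def field_simps)
    ultimately show ?thesis using th by simp
  qed
  define k where "k n = Suc (nat \<lfloor>real n powr a\<rfloor>)" for n
  define g where "g n = nat \<lfloor>real n powr b\<rfloor>" for n
  have k: "real n powr a \<le> real (k n)" "real (k n) \<le> real n powr a + 1" for n
  proof -
    have "real (k n) = real_of_int \<lfloor>real n powr a\<rfloor> + 1" by (simp add: k_def)
    then show "real n powr a \<le> real (k n)" "real (k n) \<le> real n powr a + 1" by linarith+
  qed
  have g: "real n powr b \<le> real (Suc (g n))" "real (g n) \<le> real n powr b" for n
  proof -
    have "real (g n) = real_of_int \<lfloor>real n powr b\<rfloor>" by (simp add: g_def)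
    then show "real n powr b \<le> real (Suc (g n))" "real (g n) \<le> real n powr b" by linarith+
  qed
  show thesis
  proof (rule that)
    show "1 \<le> k n" for n by (simp add: k_def)
    show "(\<lambda>n. real (k n) / sqrt (real n)) \<longlonglongrightarrow> 0"
    proof (rule tendsto_sandwich[of "\<lambda>_. 0"])
      show "(\<lambda>n. (real n powr a + 1) / sqrt (real n)) \<longlonglongrightarrow> 0" using ab(3,4) by real_asymp
    qed (auto intro!: always_eventually divide_right_mono k)
    show "(\<lambda>n. real (g n) / real (k n)) \<longlonglongrightarrow> 0"
    proof (rule tendsto_sandwich[of "\<lambda>_. 0"])
      show "(\<lambda>n. real n powr b / real n powr a) \<longlonglongrightarrow> 0" using ab(2) by real_asymp
      show "\<forall>\<^sub>F n in sequentially. real (g n) / real (k n) \<le> real n powr b / real n powr a"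
        using eventually_gt_at_top[of 0] by eventually_elim (auto intro!: frac_le k g)
    qed (auto intro!: always_eventually)
    have "filterlim (\<lambda>n. real n powr b - 1) at_top sequentially" using ab(1) by real_asymp
    then have "filterlim (\<lambda>n. real (g n)) at_top sequentially"
      by (rule filterlim_at_top_mono) (use g(1) in \<open>auto intro!: always_eventually simp: algebra_simps\<close>)
    then show "filterlim g at_top sequentially"
      by (simp add: filterlim_sequentially_iff_filterlim_real)
    show "(\<lambda>n. real n / real (k n) * decay (g n)) \<longlonglongrightarrow> 0"
    proof (rule tendsto_sandwich[of "\<lambda>_. 0"])
      have "(\<lambda>n. real n powr (1 - a - b * decay_exponent)) \<longlonglongrightarrow> 0"
        using exps by real_asymp
      then show "(\<lambda>n. decay_const * real n powr (1 - a - b * decay_exponent)) \<longlonglongrightarrow> 0"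
        by (rule tendsto_mult_right_zero)
      show "\<forall>\<^sub>F n in sequentially. real n / real (k n) * decay (g n) \<le> decay_const * real n powr (1 - a - b * decay_exponent)"
        using eventually_gt_at_top[of 0]
      proof eventually_elim
        fix n :: nat assume n: "0 < n"
        have k0: "0 < real (k n)" unfolding k_def by (simp only: of_nat_0_less_iff zero_less_Suc)
        have "decay (g n) \<le> decay_const * (real n powr b) powr (- decay_exponent)"
          unfolding decay_def using decay_const th n g(1)[of n] by (intro mult_left_mono powr_mono2') auto
        moreover have "real n / real (k n) \<le> real n / real n powr a"
          using n k(1)[of n] k0 by (intro divide_left_mono mult_pos_pos) auto
        ultimately have "real n / real (k n) * decay (g n) \<le> real n / real n powr a * (decay_const * (real n powr b) powr (- decay_exponent))"
          using decay_pos[of "g n"] by (intro mult_mono) auto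
        also have "real n / real n powr a = real n powr (1 - a)" using n by (simp add: powr_diff)
        also have "real n powr (1 - a) * (decay_const * (real n powr b) powr (- decay_exponent)) = decay_const * real n powr (1 - a - b * decay_exponent)"
          using n by (simp add: powr_powr flip: powr_add)
        finally show "real n / real (k n) * decay (g n) \<le> decay_const * real n powr (1 - a - b * decay_exponent)" .
      qed
    qed (use decay_pos in \<open>auto intro!: always_eventually mult_nonneg_nonneg simp: less_imp_le\<close>)
  qed
qed

end

section \<open>Variances over index sets and the Bernstein comparison\<close>

context intermittent_observable
begin

definition centred_sum :: "(nat \<Rightarrow> real) \<Rightarrow> nat set \<Rightarrow> real \<Rightarrow> real" where
  "centred_sum \<omega> J x = (\<Sum>j\<in>J. centred \<omega> j x)"

text \<open>Bounds the sum of absolute covariances over all partners at distance at least g from a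
  fixed index, with 120 for each side; at g = 0 it bounds the variance per summand.\<close>

definition cov_const :: "nat \<Rightarrow> real" where
  "cov_const g = 240 * M\<^sup>2 * decay_tail g"

lemma cov_const_nonneg: "0 \<le> cov_const g"
  unfolding cov_const_def using decay_tail_nonneg by simp

lemma cov_const_tendsto_0: "cov_const \<longlonglongrightarrow> 0"
  unfolding cov_const_def[abs_def] using tendsto_mult_left[OF decay_tail_tendsto_0] by simp

lemma sum_fibre_cov_le:
  assumes w: "admissible \<omega>" and J: "finite J" and gap: "\<And>j. j \<in> J \<Longrightarrow> g \<le> max i j - min i j"
  shows "(\<Sum>j\<in>J. \<bar>fibre_cov \<omega> i j\<bar>) \<le> cov_const g"
proof -
  have "(\<Sum>j\<in>J. \<bar>fibre_cov \<omega> i j\<bar>) \<le> (\<Sum>j\<in>J. 120 * M\<^sup>2 * decay (max i j - min i j))"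
    by (intro sum_mono fibre_cov_bound'[OF w])
  also have "\<dots> = 120 * M\<^sup>2 * (\<Sum>j\<in>J. decay (max i j - min i j))" by (simp add: sum_distrib_left)
  also have "\<dots> \<le> 120 * M\<^sup>2 * (2 * decay_tail g)"
    by (intro mult_left_mono sum_decay_le[OF J gap]) auto
  finally show ?thesis by (simp add: cov_const_def)
qed

lemma sum_fibre_cov_le0:
  assumes w: "admissible \<omega>" and J: "finite J"
  shows "(\<Sum>j\<in>J. \<bar>fibre_cov \<omega> i j\<bar>) \<le> cov_const 0"
  by (rule sum_fibre_cov_le[OF w J]) simp

lemma measurable_centred_sum: "admissible \<omega> \<Longrightarrow> centred_sum \<omega> J \<in> borel_measurable unit_lebesgue"
  unfolding centred_sum_def[abs_def] by (intro borel_measurable_sum measurable_centred)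

lemma centred_sum_bound:
  assumes "admissible \<omega>" "x \<in> {0..1}"
  shows "\<bar>centred_sum \<omega> J x\<bar> \<le> 2 * M * real (card J)"
proof -
  have "\<bar>centred_sum \<omega> J x\<bar> \<le> (\<Sum>j\<in>J. \<bar>centred \<omega> j x\<bar>)" unfolding centred_sum_def by (rule sum_abs)
  also have "\<dots> \<le> real (card J) * (2 * M)" using centred_bound[OF assms] by (intro sum_bounded_above)
  finally show ?thesis by (simp add: mult_ac)
qed

lemma integrable_centred_sum: "admissible \<omega> \<Longrightarrow> integrable unit_lebesgue (centred_sum \<omega> J)"
  using integrable_unit_bounded[OF measurable_centred_sum centred_sum_bound] by blast

lemma integral_centred_sum: "admissible \<omega> \<Longrightarrow> (LINT x|unit_lebesgue. centred_sum \<omega> J x) = 0"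
  unfolding centred_sum_def by (simp add: integrable_centred integral_centred)

lemma integrable_centred_sum_times:
  "admissible \<omega> \<Longrightarrow> integrable unit_lebesgue (\<lambda>x. centred_sum \<omega> J x * centred_sum \<omega> K x)"
  using integrable_unit_bounded_mult[OF integrable_centred_sum measurable_centred_sum centred_sum_bound] by blast

lemma integral_centred_sum_times:
  assumes w: "admissible \<omega>"
  shows "(LINT x|unit_lebesgue. centred_sum \<omega> J x * centred_sum \<omega> K x) = (\<Sum>i\<in>J. \<Sum>j\<in>K. fibre_cov \<omega> i j)"
proof -
  have "(LINT x|unit_lebesgue. centred_sum \<omega> J x * centred_sum \<omega> K x) =
      (LINT x|unit_lebesgue. (\<Sum>i\<in>J. \<Sum>j\<in>K. centred \<omega> i x * centred \<omega> j x))"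
    by (simp add: centred_sum_def sum_product)
  also have "\<dots> = (\<Sum>i\<in>J. LINT x|unit_lebesgue. (\<Sum>j\<in>K. centred \<omega> i x * centred \<omega> j x))"
    using integrable_centred_times[OF w] by (intro Bochner_Integration.integral_sum) auto
  also have "\<dots> = (\<Sum>i\<in>J. \<Sum>j\<in>K. fibre_cov \<omega> i j)"
    unfolding fibre_cov_def using integrable_centred_times[OF w]
    by (intro sum.cong Bochner_Integration.integral_sum) auto
  finally show ?thesis .
qed

definition sum_var :: "(nat \<Rightarrow> real) \<Rightarrow> nat set \<Rightarrow> real" where
  "sum_var \<omega> J = (LINT x|unit_lebesgue. (centred_sum \<omega> J x)\<^sup>2)"

lemma sum_var_eq: "admissible \<omega> \<Longrightarrow> sum_var \<omega> J = (\<Sum>i\<in>J. \<Sum>j\<in>J. fibre_cov \<omega> i j)"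
  unfolding sum_var_def power2_eq_square by (rule integral_centred_sum_times)

lemma sum_var_nonneg: "0 \<le> sum_var \<omega> J"
  by (simp add: sum_var_def)

lemma double_sum_fibre_cov_le:
  assumes w: "admissible \<omega>" and J: "finite J" "finite K"
  shows "\<bar>\<Sum>i\<in>J. \<Sum>j\<in>K. fibre_cov \<omega> i j\<bar> \<le> real (card J) * cov_const 0"
proof -
  have "\<bar>\<Sum>i\<in>J. \<Sum>j\<in>K. fibre_cov \<omega> i j\<bar> \<le> (\<Sum>i\<in>J. \<bar>\<Sum>j\<in>K. fibre_cov \<omega> i j\<bar>)" by (rule sum_abs)
  also have "\<dots> \<le> (\<Sum>i\<in>J. cov_const 0)"
    by (intro sum_mono order_trans[OF sum_abs sum_fibre_cov_le0[OF w J(2)]])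
  finally show ?thesis by simp
qed

lemma sum_var_le:
  assumes "admissible \<omega>" "finite J"
  shows "sum_var \<omega> J \<le> cov_const 0 * real (card J)"
  using double_sum_fibre_cov_le[OF assms assms(2)] by (simp add: sum_var_eq[OF assms(1)] mult.commute)

text \<open>Only pairs with an index in A - J contribute, and by symmetry that index can be taken as
  the outer one, where every row sum is at most \<open>cov_const 0\<close>.\<close>

lemma sum_var_remainder:
  assumes w: "admissible \<omega>" and A: "finite A" "J \<subseteq> A"
  shows "\<bar>sum_var \<omega> A - sum_var \<omega> J\<bar> \<le> 3 * cov_const 0 * real (card (A - J))"
proof -
  let ?R = "A - J"
  have fin: "finite J" "finite ?R" using A finite_subset by auto
  have split: "(\<Sum>i\<in>A. f i) = (\<Sum>i\<in>J. f i) + (\<Sum>i\<in>?R. f i)" for f :: "nat \<Rightarrow> real"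
    using sum.subset_diff[OF A(2,1), of f] by simp
  have "(\<Sum>i\<in>J. \<Sum>j\<in>A. fibre_cov \<omega> i j) = (\<Sum>i\<in>J. \<Sum>j\<in>J. fibre_cov \<omega> i j) + (\<Sum>i\<in>J. \<Sum>j\<in>?R. fibre_cov \<omega> i j)"
    by (simp only: split sum.distrib)
  then have "(\<Sum>i\<in>A. \<Sum>j\<in>A. fibre_cov \<omega> i j) = (\<Sum>i\<in>J. \<Sum>j\<in>J. fibre_cov \<omega> i j) + (\<Sum>i\<in>J. \<Sum>j\<in>?R. fibre_cov \<omega> i j)
      + (\<Sum>i\<in>?R. \<Sum>j\<in>A. fibre_cov \<omega> i j)"
    using split[of "\<lambda>i. \<Sum>j\<in>A. fibre_cov \<omega> i j"] by simp
  moreover have "(\<Sum>i\<in>J. \<Sum>j\<in>?R. fibre_cov \<omega> i j) = (\<Sum>i\<in>?R. \<Sum>j\<in>J. fibre_cov \<omega> i j)"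
    by (subst sum.swap) (simp add: fibre_cov_commute)
  ultimately have "sum_var \<omega> A - sum_var \<omega> J = (\<Sum>i\<in>?R. \<Sum>j\<in>J. fibre_cov \<omega> i j) + (\<Sum>i\<in>?R. \<Sum>j\<in>A. fibre_cov \<omega> i j)"
    by (simp add: sum_var_eq[OF w])
  then have "\<bar>sum_var \<omega> A - sum_var \<omega> J\<bar> \<le> 2 * (real (card ?R) * cov_const 0)"
    using double_sum_fibre_cov_le[OF w fin(2,1)] double_sum_fibre_cov_le[OF w fin(2) A(1)] by linarith
  also have "\<dots> \<le> 3 * cov_const 0 * real (card ?R)"
    using cov_const_nonneg[of 0] by (simp add: mult_right_mono)
  finally show ?thesis .
qed

lemma unit_cf_remainder:
  assumes w: "admissible \<omega>" and A: "finite A" "J \<subseteq> A"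
  shows "norm (unit_cf (\<lambda>x. \<epsilon> * centred_sum \<omega> A x) - unit_cf (\<lambda>x. \<epsilon> * centred_sum \<omega> J x))
    \<le> \<bar>\<epsilon>\<bar> * sqrt (cov_const 0 * real (card (A - J)))"
proof -
  let ?R = "A - J"
  have fin: "finite ?R" using A by auto
  have diff: "\<epsilon> * centred_sum \<omega> A x - \<epsilon> * centred_sum \<omega> J x = \<epsilon> * centred_sum \<omega> ?R x" for x
    unfolding centred_sum_def using sum.subset_diff[OF A(2,1), of "\<lambda>j. centred \<omega> j x"] by (simp add: distrib_left)
  have "norm (unit_cf (\<lambda>x. \<epsilon> * centred_sum \<omega> A x) - unit_cf (\<lambda>x. \<epsilon> * centred_sum \<omega> J x))
      \<le> (LINT x|unit_lebesgue. \<bar>\<epsilon> * centred_sum \<omega> A x - \<epsilon> * centred_sum \<omega> J x\<bar>)"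
    using measurable_centred_sum[OF w] integrable_centred_sum[OF w]
    by (intro norm_unit_cf_diff_le) (auto simp: diff)
  also have "\<dots> = \<bar>\<epsilon>\<bar> * (LINT x|unit_lebesgue. \<bar>centred_sum \<omega> ?R x\<bar>)"
    by (simp add: diff abs_mult)
  \<comment> \<open>The L1 norm is bounded by the L2 norm, in the form that the variance of |X| is
    nonnegative.\<close>
  also have "(LINT x|unit_lebesgue. \<bar>centred_sum \<omega> ?R x\<bar>) \<le> sqrt (sum_var \<omega> ?R)"
  proof (rule real_le_rsqrt)
    let ?X = "\<lambda>x. \<bar>centred_sum \<omega> ?R x\<bar>"
    have i: "integrable unit_lebesgue ?X" using integrable_centred_sum[OF w] by auto
    have i2: "integrable unit_lebesgue (\<lambda>x. (?X x)\<^sup>2)"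
      using integrable_centred_sum_times[OF w, of ?R ?R] by (simp add: power2_eq_square)
    show "(LINT x|unit_lebesgue. ?X x)\<^sup>2 \<le> sum_var \<omega> ?R"
      using unit_lebesgue.variance_positive[of ?X] unit_lebesgue.variance_eq[OF i i2] by (simp add: sum_var_def)
  qed
  also have "\<dots> \<le> sqrt (cov_const 0 * real (card ?R))"
    using sum_var_le[OF w fin] by simp
  finally show ?thesis by (simp add: mult_left_mono)
qed

lemma block_sum_eq: "block_sum \<omega> a k x = centred_sum \<omega> {a + 1..a + k} x"
  unfolding block_sum_def centred_sum_def
  by (rule sum.reindex_bij_witness[of _ "\<lambda>j. j - a" "\<lambda>j. a + j"]) auto

text \<open>The summands on the right are, in order, the cost of discarding the gaps and the
  incomplete end, of factorizing over blocks, of expanding each factor to second order, of replacing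
  the block variances by the variance of the whole sum, and of replacing the latter by its limit.
  \<open>R\<close> counts the discarded indices.\<close>

lemma unit_cf_bernstein:
  fixes t s2 :: real and n k g :: nat
  assumes w: "admissible \<omega>" and n: "1 \<le> n" and s2: "0 \<le> s2"
  defines "N \<equiv> n div (k + g)" and "\<epsilon> \<equiv> t / sqrt (real n)"
  defines "R \<equiv> real n - real N * real k"
  shows "norm (unit_cf (\<lambda>x. \<epsilon> * centred_sum \<omega> {1..n} x) - complex_of_real (exp (- (t\<^sup>2 * s2) / 2)))
    \<le> \<bar>\<epsilon>\<bar> * sqrt (cov_const 0 * R) + real N * (8 * exp (120 * M * \<bar>\<epsilon>\<bar> * real k) * decay g)
      + real N * (\<bar>\<epsilon>\<bar> * (2 * M * real k) * (\<epsilon>\<^sup>2 * (cov_const 0 * real k)) / 6 + (\<epsilon>\<^sup>2 * (cov_const 0 * real k) / 2)\<^sup>2 / 2)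
      + \<epsilon>\<^sup>2 / 2 * (cov_const g * (real N * real k) + 3 * cov_const 0 * R)
      + t\<^sup>2 / 2 * \<bar>sum_var \<omega> {1..n} / real n - s2\<bar>"
proof -
  let ?q = "k + g"
  define I where "I l = {l * ?q + 1..l * ?q + k}" for l
  define J where "J = (\<Union>l<N. I l)"
  let ?A = "{1..n}"
  have Nq: "N * ?q \<le> n" unfolding N_def by (metis div_times_less_eq_dividend)
  have disj: "I l \<inter> I l' = {}" if "l < l'" for l l'
  proof -
    have "l * ?q + ?q \<le> l' * ?q" using that by (metis Suc_leI mult_Suc add.commute mult_le_mono1)
    then show ?thesis unfolding I_def by auto
  qed
  have disj': "I l \<inter> I l' = {}" if "l \<noteq> l'" for l l'
    using disj[of l l'] disj[of l' l] that by (cases "l < l'") auto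
  have finI: "finite (I l)" and cardI: "card (I l) = k" for l by (auto simp: I_def)
  have finJ: "finite J" unfolding J_def using finI by auto
  have JA: "J \<subseteq> ?A"
  proof
    fix j assume "j \<in> J"
    then obtain l where l: "l < N" "j \<in> I l" unfolding J_def by auto
    have "l * ?q + ?q \<le> N * ?q" using l(1) by (metis Suc_leI mult_Suc add.commute mult_le_mono1)
    then show "j \<in> ?A" using l(2) Nq unfolding I_def by auto
  qed
  have cardJ: "card J = N * k"
    unfolding J_def using finI disj' by (subst card_UN_disjoint) (auto simp: cardI)
  have cardR: "real (card (?A - J)) = R"
    using card_Diff_subset[OF finJ JA] card_mono[OF _ JA] cardJ unfolding R_def by (simp add: of_nat_diff)
  have sumJ: "(\<Sum>j\<in>J. f j) = (\<Sum>l<N. \<Sum>j\<in>I l. f j)" for f :: "nat \<Rightarrow> real"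
    unfolding J_def using finI disj' by (intro sum.UNION_disjoint) auto
  have e2: "\<epsilon>\<^sup>2 = t\<^sup>2 / real n" using n by (simp add: \<epsilon>_def power_divide)
  let ?B = "\<lambda>l. block_sum \<omega> (l * ?q) k"
  have Beq: "?B l = centred_sum \<omega> (I l)" for l by (simp add: fun_eq_iff block_sum_eq I_def)
  have UJ: "(\<Sum>l<N. ?B l x) = centred_sum \<omega> J x" for x
    unfolding Beq centred_sum_def sumJ ..
  let ?v = "\<lambda>l. sum_var \<omega> (I l)"
  have s1: "norm (unit_cf (\<lambda>x. \<epsilon> * centred_sum \<omega> ?A x) - unit_cf (\<lambda>x. \<epsilon> * centred_sum \<omega> J x))
      \<le> \<bar>\<epsilon>\<bar> * sqrt (cov_const 0 * R)"
    using unit_cf_remainder[OF w finite_atLeastAtMost JA, of \<epsilon>] unfolding cardR .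
  have s2': "norm (unit_cf (\<lambda>x. \<epsilon> * centred_sum \<omega> J x) - (\<Prod>l<N. unit_cf (\<lambda>x. \<epsilon> * ?B l x)))
      \<le> real N * (8 * exp (120 * M * \<bar>\<epsilon>\<bar> * real k) * decay g)"
    using unit_cf_blocks[OF w, of \<epsilon> 0 k g N] by (simp add: UJ)
  have s3: "norm ((\<Prod>l<N. unit_cf (\<lambda>x. \<epsilon> * ?B l x)) - (\<Prod>l<N. complex_of_real (exp (- (\<epsilon>\<^sup>2 * ?v l) / 2))))
      \<le> real N * (\<bar>\<epsilon>\<bar> * (2 * M * real k) * (\<epsilon>\<^sup>2 * (cov_const 0 * real k)) / 6 + (\<epsilon>\<^sup>2 * (cov_const 0 * real k) / 2)\<^sup>2 / 2)"
    (is "_ \<le> real N * ?D")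
  proof -
    have each: "norm (unit_cf (\<lambda>x. \<epsilon> * ?B l x) - complex_of_real (exp (- (\<epsilon>\<^sup>2 * ?v l) / 2))) \<le> ?D" for l
    proof -
      let ?X = "\<lambda>x. \<epsilon> * centred_sum \<omega> (I l) x"
      have Xm: "?X \<in> borel_measurable unit_lebesgue" using measurable_centred_sum[OF w] by measurable
      have Xb: "\<bar>?X x\<bar> \<le> \<bar>\<epsilon>\<bar> * (2 * M * real k)" if "x \<in> {0..1}" for x
        using centred_sum_bound[OF w that, of "I l"] by (simp add: abs_mult cardI mult_left_mono)
      have X0: "(LINT x|unit_lebesgue. ?X x) = 0" using integral_centred_sum[OF w] by simp
      have X2: "(LINT x|unit_lebesgue. (?X x)\<^sup>2) = \<epsilon>\<^sup>2 * ?v l" by (simp add: power_mult_distrib sum_var_def)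
      have Xv: "(LINT x|unit_lebesgue. (?X x)\<^sup>2) \<le> \<epsilon>\<^sup>2 * (cov_const 0 * real k)"
        unfolding X2 using sum_var_le[OF w finI, of l] by (intro mult_left_mono) (auto simp: cardI)
      show ?thesis using norm_unit_cf_taylor[OF Xm Xb X0 Xv] unfolding X2 Beq .
    qed
    have "norm ((\<Prod>l<N. unit_cf (\<lambda>x. \<epsilon> * ?B l x)) - (\<Prod>l<N. complex_of_real (exp (- (\<epsilon>\<^sup>2 * ?v l) / 2))))
        \<le> (\<Sum>l<N. norm (unit_cf (\<lambda>x. \<epsilon> * ?B l x) - complex_of_real (exp (- (\<epsilon>\<^sup>2 * ?v l) / 2))))"
    proof (rule norm_prod_diff)
      show "norm (unit_cf (\<lambda>x. \<epsilon> * ?B l x)) \<le> 1" for l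
        by (intro norm_unit_cf_le borel_measurable_times borel_measurable_const measurable_block_sum[OF w])
      show "norm (complex_of_real (exp (- (\<epsilon>\<^sup>2 * ?v l) / 2))) \<le> 1" for l
        using sum_var_nonneg by simp
    qed
    also have "\<dots> \<le> (\<Sum>l<N. ?D)" by (intro sum_mono each)
    finally show ?thesis by simp
  qed
  have prod: "(\<Prod>l<N. complex_of_real (exp (- (\<epsilon>\<^sup>2 * ?v l) / 2))) = complex_of_real (exp (- (\<epsilon>\<^sup>2 / 2 * (\<Sum>l<N. ?v l))))"
    by (simp add: exp_sum[symmetric] sum_distrib_left sum_negf[symmetric] flip: of_real_prod)
  have vJ: "\<bar>(\<Sum>l<N. ?v l) - sum_var \<omega> J\<bar> \<le> cov_const g * (real N * real k)"
  proof -
    have "sum_var \<omega> J = (\<Sum>l<N. \<Sum>i\<in>I l. \<Sum>j\<in>J. fibre_cov \<omega> i j)"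
      by (simp add: sum_var_eq[OF w] sumJ)
    also have "\<dots> = (\<Sum>l<N. \<Sum>i\<in>I l. (\<Sum>j\<in>I l. fibre_cov \<omega> i j) + (\<Sum>j\<in>J - I l. fibre_cov \<omega> i j))"
    proof (intro sum.cong refl)
      fix l i assume "l \<in> {..<N}"
      then have "I l \<subseteq> J" unfolding J_def by auto
      from sum.subset_diff[OF this finJ, of "fibre_cov \<omega> i"]
      show "(\<Sum>j\<in>J. fibre_cov \<omega> i j) = (\<Sum>j\<in>I l. fibre_cov \<omega> i j) + (\<Sum>j\<in>J - I l. fibre_cov \<omega> i j)" by simp
    qed
    also have "\<dots> = (\<Sum>l<N. ?v l) + (\<Sum>l<N. \<Sum>i\<in>I l. \<Sum>j\<in>J - I l. fibre_cov \<omega> i j)"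
      by (simp add: sum.distrib sum_var_eq[OF w])
    finally have "\<bar>(\<Sum>l<N. ?v l) - sum_var \<omega> J\<bar> = \<bar>\<Sum>l<N. \<Sum>i\<in>I l. \<Sum>j\<in>J - I l. fibre_cov \<omega> i j\<bar>" by simp
    also have "\<dots> \<le> (\<Sum>l<N. \<Sum>i\<in>I l. \<Sum>j\<in>J - I l. \<bar>fibre_cov \<omega> i j\<bar>)"
      by (intro order_trans[OF sum_abs] sum_mono order_refl)
    also have "\<dots> \<le> (\<Sum>l<N. \<Sum>i\<in>I l. cov_const g)"
    proof (intro sum_mono)
      fix l i assume l: "l \<in> {..<N}" and i: "i \<in> I l"
      show "(\<Sum>j\<in>J - I l. \<bar>fibre_cov \<omega> i j\<bar>) \<le> cov_const g"
      proof (rule sum_fibre_cov_le[OF w])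
        show "finite (J - I l)" using finJ by auto
        fix j assume j: "j \<in> J - I l"
        obtain l' where l': "j \<in> I l'" "l' \<noteq> l" using j unfolding J_def by auto
        \<comment> \<open>Different block numbers leave a full gap of length g between the two
          indices, so only the tail of the covariances enters.\<close>
        have "l * ?q + ?q \<le> l' * ?q \<or> l' * ?q + ?q \<le> l * ?q"
        proof (cases "l < l'")
          case True
          then show ?thesis by (metis Suc_leI mult_Suc add.commute mult_le_mono1)
        next
          case False
          then have "l' < l" using l'(2) by simp
          then show ?thesis by (metis Suc_leI mult_Suc add.commute mult_le_mono1)
        qed
        then show "g \<le> max i j - min i j"
          using i l'(1) unfolding I_def by (auto simp: max_def min_def)
      qed
    qed
    also have "\<dots> = cov_const g * (real N * real k)" by (simp add: cardI)
    finally show ?thesis .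
  qed
  have "norm (complex_of_real (exp (- (\<epsilon>\<^sup>2 / 2 * (\<Sum>l<N. ?v l)))) - complex_of_real (exp (- (t\<^sup>2 * s2) / 2)))
      = \<bar>exp (- (\<epsilon>\<^sup>2 / 2 * (\<Sum>l<N. ?v l))) - exp (- (t\<^sup>2 * s2 / 2))\<bar>"
    by (simp flip: of_real_diff)
  also have "\<dots> \<le> \<bar>\<epsilon>\<^sup>2 / 2 * (\<Sum>l<N. ?v l) - t\<^sup>2 * s2 / 2\<bar>"
    using s2 sum_var_nonneg by (intro exp_minus_lipschitz mult_nonneg_nonneg sum_nonneg) auto
  also have "\<epsilon>\<^sup>2 / 2 * (\<Sum>l<N. ?v l) - t\<^sup>2 * s2 / 2 = \<epsilon>\<^sup>2 / 2 * ((\<Sum>l<N. ?v l) - sum_var \<omega> J) + \<epsilon>\<^sup>2 / 2 * (sum_var \<omega> J - sum_var \<omega> ?A)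
      + t\<^sup>2 / 2 * (sum_var \<omega> ?A / real n - s2)"
    by (simp add: e2 algebra_simps diff_divide_distrib)
  also have "\<bar>\<dots>\<bar> \<le> \<epsilon>\<^sup>2 / 2 * \<bar>(\<Sum>l<N. ?v l) - sum_var \<omega> J\<bar> + \<epsilon>\<^sup>2 / 2 * \<bar>sum_var \<omega> J - sum_var \<omega> ?A\<bar> + t\<^sup>2 / 2 * \<bar>sum_var \<omega> ?A / real n - s2\<bar>"
    by (intro order_trans[OF abs_triangle_ineq] add_mono) (auto simp: abs_mult)
  also have "\<dots> \<le> \<epsilon>\<^sup>2 / 2 * (cov_const g * (real N * real k)) + \<epsilon>\<^sup>2 / 2 * (3 * cov_const 0 * R) + t\<^sup>2 / 2 * \<bar>sum_var \<omega> ?A / real n - s2\<bar>"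
    using vJ sum_var_remainder[OF w finite_atLeastAtMost JA, unfolded cardR]
    by (intro add_mono mult_left_mono) (auto simp: abs_minus_commute)
  finally have s4: "norm ((\<Prod>l<N. complex_of_real (exp (- (\<epsilon>\<^sup>2 * ?v l) / 2))) - complex_of_real (exp (- (t\<^sup>2 * s2) / 2)))
      \<le> \<epsilon>\<^sup>2 / 2 * (cov_const g * (real N * real k) + 3 * cov_const 0 * R) + t\<^sup>2 / 2 * \<bar>sum_var \<omega> ?A / real n - s2\<bar>"
    unfolding prod by (simp add: distrib_left)
  have tri: "norm (a - e) \<le> norm (a - b) + norm (b - c) + norm (c - d) + norm (d - e)" for a b c d e :: complex
    using norm_triangle_ineq[of "a - b" "b - c"] norm_triangle_ineq[of "a - c" "c - d"] norm_triangle_ineq[of "a - d" "d - e"]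
    by simp
  show ?thesis
    by (rule order_trans[OF tri[of _ _ "unit_cf (\<lambda>x. \<epsilon> * centred_sum \<omega> J x)" "\<Prod>l<N. unit_cf (\<lambda>x. \<epsilon> * ?B l x)"
          "\<Prod>l<N. complex_of_real (exp (- (\<epsilon>\<^sup>2 * ?v l) / 2))"]])
      (use s1 s2' s3 s4 in linarith)
qed

lemma clt_characteristic:
  assumes w: "admissible \<omega>" and lim: "(\<lambda>n. sum_var \<omega> {1..n} / real n) \<longlonglongrightarrow> s2" and s2: "0 \<le> s2"
  shows "(\<lambda>n. unit_cf (\<lambda>x. t / sqrt (real n) * centred_sum \<omega> {1..n} x)) \<longlonglongrightarrow> complex_of_real (exp (- (t\<^sup>2 * s2) / 2))"
proof -
  obtain k g :: "nat \<Rightarrow> nat" where k1: "\<And>n. 1 \<le> k n"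
    and kap: "(\<lambda>n. real (k n) / sqrt (real n)) \<longlonglongrightarrow> 0" and gk: "(\<lambda>n. real (g n) / real (k n)) \<longlonglongrightarrow> 0"
    and gtop: "filterlim g at_top sequentially" and dec: "(\<lambda>n. real n / real (k n) * decay (g n)) \<longlonglongrightarrow> 0"
    using bernstein_block_lengths by blast
  let ?c = "cov_const 0"
  define \<kappa> where "\<kappa> n = real (k n) / sqrt (real n)" for n
  define \<gamma> where "\<gamma> n = real (g n) / real (k n)" for n
  \<comment> \<open>Bounds the proportion of discarded indices: the gaps contain at most n \<gamma>
    of them, and the incomplete end at most k + g = k(1 + \<gamma>), where k/n \<le>
    \<kappa>.\<close>
  define \<rho> where "\<rho> n = \<gamma> n + \<kappa> n * (1 + \<gamma> n)" for n
  define \<delta> where "\<delta> n = real n / real (k n) * decay (g n)" for n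
  define v where "v n = \<bar>sum_var \<omega> {1..n} / real n - s2\<bar>" for n
  have \<kappa>: "\<kappa> \<longlonglongrightarrow> 0" and \<gamma>: "\<gamma> \<longlonglongrightarrow> 0" and \<delta>: "\<delta> \<longlonglongrightarrow> 0"
    using kap gk dec by (auto simp: \<kappa>_def[abs_def] \<gamma>_def[abs_def] \<delta>_def[abs_def])
  have \<rho>: "\<rho> \<longlonglongrightarrow> 0"
    unfolding \<rho>_def[abs_def] using \<kappa> \<gamma> by (auto intro!: tendsto_eq_intros)
  have v: "v \<longlonglongrightarrow> 0"
    using lim unfolding v_def[abs_def] by (simp add: LIM_zero tendsto_rabs_zero)
  have cg: "(\<lambda>n. cov_const (g n)) \<longlonglongrightarrow> 0"
    using filterlim_compose[OF cov_const_tendsto_0 gtop] .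
  \<comment> \<open>The bound of \<open>unit_cf_bernstein\<close> for \<epsilon> = t / sqrt n in
    terms of null sequences; its exponential stays bounded because \<kappa> = k / sqrt n
    does.\<close>
  define U where "U n = \<bar>t\<bar> * sqrt (?c * \<rho> n) + 8 * exp (120 * M * \<bar>t\<bar> * \<kappa> n) * \<delta> n
    + (\<bar>t\<bar> ^ 3 * M * ?c / 3 + (t\<^sup>2 * ?c)\<^sup>2 / 8) * \<kappa> n + t\<^sup>2 / 2 * (cov_const (g n) + 3 * ?c * \<rho> n) + t\<^sup>2 / 2 * v n" for n
  have U: "U \<longlonglongrightarrow> 0"
    unfolding U_def[abs_def] using \<kappa> \<delta> \<rho> v cg by (auto intro!: tendsto_eq_intros)
  have "\<forall>\<^sub>F n in sequentially. norm (unit_cf (\<lambda>x. t / sqrt (real n) * centred_sum \<omega> {1..n} x) - complex_of_real (exp (- (t\<^sup>2 * s2) / 2))) \<le> U n"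
    using eventually_ge_at_top[of 1]
  proof eventually_elim
    fix n :: nat assume n: "1 \<le> n"
    let ?N = "n div (k n + g n)" and ?e = "t / sqrt (real n)"
    let ?R = "real n - real ?N * real (k n)"
    let ?sn = "sqrt (real n)"
    have sn: "1 \<le> ?sn" "?sn * ?sn = real n" using n by auto
    have k0: "0 < real (k n)" using k1[of n] by simp
    have nonneg: "0 \<le> \<kappa> n" "0 \<le> \<gamma> n" by (auto simp: \<kappa>_def \<gamma>_def)
    have Nq: "?N * (k n + g n) \<le> n" by (metis div_times_less_eq_dividend)
    have "real ?N * real (k n) + real ?N * real (g n) \<le> real n"
      using Nq by (metis of_nat_add of_nat_le_iff of_nat_mult distrib_left)
    then have Nk: "real ?N * real (k n) \<le> real n" by (smt (verit) mult_nonneg_nonneg of_nat_0_le_iff)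
    have Nn: "real ?N \<le> real n / real (k n)" using Nk k0 by (simp add: field_simps)
    have kn: "real (k n) / real n \<le> \<kappa> n"
    proof -
      have "?sn \<le> real n" using mult_right_mono[of 1 ?sn ?sn] sn by simp
      then show ?thesis unfolding \<kappa>_def using sn(1) by (intro divide_left_mono mult_pos_pos) auto
    qed
    have R: "0 \<le> ?R" "?R \<le> real n * \<rho> n"
    proof -
      show "0 \<le> ?R" using Nk by simp
      have "n = ?N * (k n + g n) + n mod (k n + g n)" by (rule div_mult_mod_eq[symmetric])
      also have "\<dots> \<le> ?N * (k n + g n) + (k n + g n)"
        using k1[of n] by (intro add_left_mono less_imp_le mod_less_divisor) auto
      finally have "real n \<le> real (?N * (k n + g n) + (k n + g n))" by (simp only: of_nat_le_iff)
      then have "?R \<le> real ?N * real (g n) + (real (k n) + real (g n))" by (simp add: algebra_simps)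
      also have "real ?N * real (g n) \<le> real n / real (k n) * real (g n)" using Nn by (intro mult_right_mono) auto
      also have "\<dots> = real n * \<gamma> n" by (simp add: \<gamma>_def)
      also have "real (k n) + real (g n) = real n * (real (k n) / real n * (1 + \<gamma> n))"
        using n k0 by (simp add: \<gamma>_def field_simps)
      also have "\<dots> \<le> real n * (\<kappa> n * (1 + \<gamma> n))"
        using kn nonneg by (intro mult_left_mono mult_right_mono) auto
      finally show "?R \<le> real n * \<rho> n" by (simp add: \<rho>_def algebra_simps)
    qed
    have e: "\<bar>?e\<bar> = \<bar>t\<bar> / ?sn" "?e\<^sup>2 = t\<^sup>2 / real n" using n by (auto simp: power_divide)
    have t1: "\<bar>?e\<bar> * sqrt (?c * ?R) \<le> \<bar>t\<bar> * sqrt (?c * \<rho> n)"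
    proof -
      have "sqrt (?c * ?R) \<le> sqrt (real n * (?c * \<rho> n))"
        using mult_left_mono[OF R(2) cov_const_nonneg[of 0]] by (simp add: mult_ac)
      also have "\<dots> = ?sn * sqrt (?c * \<rho> n)" by (rule real_sqrt_mult)
      finally show ?thesis using sn unfolding e by (simp add: field_simps mult_left_mono)
    qed
    have t2: "real ?N * (8 * exp (120 * M * \<bar>?e\<bar> * real (k n)) * decay (g n)) \<le> 8 * exp (120 * M * \<bar>t\<bar> * \<kappa> n) * \<delta> n"
    proof -
      have "real ?N * (8 * exp (120 * M * \<bar>?e\<bar> * real (k n)) * decay (g n)) = 8 * exp (120 * M * \<bar>t\<bar> * \<kappa> n) * (real ?N * decay (g n))"
        by (simp add: e \<kappa>_def)
      also have "\<dots> \<le> 8 * exp (120 * M * \<bar>t\<bar> * \<kappa> n) * \<delta> n"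
        unfolding \<delta>_def using Nn decay_pos[of "g n"] by (intro mult_left_mono mult_right_mono) auto
      finally show ?thesis .
    qed
    have t3: "real ?N * (\<bar>?e\<bar> * (2 * M * real (k n)) * (?e\<^sup>2 * (?c * real (k n))) / 6 + (?e\<^sup>2 * (?c * real (k n)) / 2)\<^sup>2 / 2)
      \<le> (\<bar>t\<bar> ^ 3 * M * ?c / 3 + (t\<^sup>2 * ?c)\<^sup>2 / 8) * \<kappa> n"
    proof -
      have r: "real ?N * real (k n) / real n \<le> 1" using Nk n by simp
      have "real ?N * (\<bar>?e\<bar> * (2 * M * real (k n)) * (?e\<^sup>2 * (?c * real (k n))) / 6)
          = \<bar>t\<bar> ^ 3 * M * ?c / 3 * \<kappa> n * (real ?N * real (k n) / real n)"
        unfolding e \<kappa>_def by (simp add: power3_eq_cube power2_eq_square field_simps abs_mult_self_eq)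
      also have "\<dots> \<le> \<bar>t\<bar> ^ 3 * M * ?c / 3 * \<kappa> n * 1"
        using r nonneg M_pos cov_const_nonneg[of 0] by (intro mult_left_mono) auto
      finally have 1: "real ?N * (\<bar>?e\<bar> * (2 * M * real (k n)) * (?e\<^sup>2 * (?c * real (k n))) / 6) \<le> \<bar>t\<bar> ^ 3 * M * ?c / 3 * \<kappa> n" by simp
      have "real ?N * ((?e\<^sup>2 * (?c * real (k n)) / 2)\<^sup>2 / 2) = (t\<^sup>2 * ?c)\<^sup>2 / 8 * ((real (k n) / real n) * (real ?N * real (k n) / real n))"
        unfolding e by (simp add: power2_eq_square field_simps)
      also have "\<dots> \<le> (t\<^sup>2 * ?c)\<^sup>2 / 8 * (\<kappa> n * 1)"
        using kn r nonneg by (intro mult_left_mono mult_mono) auto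
      finally have 2: "real ?N * ((?e\<^sup>2 * (?c * real (k n)) / 2)\<^sup>2 / 2) \<le> (t\<^sup>2 * ?c)\<^sup>2 / 8 * \<kappa> n" by simp
      show ?thesis using add_mono[OF 1 2] by (simp only: distrib_left distrib_right)
    qed
    have t4: "?e\<^sup>2 / 2 * (cov_const (g n) * (real ?N * real (k n)) + 3 * ?c * ?R) \<le> t\<^sup>2 / 2 * (cov_const (g n) + 3 * ?c * \<rho> n)"
    proof -
      have "cov_const (g n) * (real ?N * real (k n)) + 3 * ?c * ?R \<le> cov_const (g n) * real n + 3 * ?c * (real n * \<rho> n)"
        using Nk R(2) cov_const_nonneg by (intro add_mono mult_left_mono) auto
      then have "?e\<^sup>2 / 2 * (cov_const (g n) * (real ?N * real (k n)) + 3 * ?c * ?R) \<le> ?e\<^sup>2 / 2 * (cov_const (g n) * real n + 3 * ?c * (real n * \<rho> n))"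
        by (intro mult_left_mono) auto
      also have "\<dots> = t\<^sup>2 / 2 * (cov_const (g n) + 3 * ?c * \<rho> n)"
        using n unfolding e by (simp add: field_simps)
      finally show ?thesis .
    qed
    show "norm (unit_cf (\<lambda>x. ?e * centred_sum \<omega> {1..n} x) - complex_of_real (exp (- (t\<^sup>2 * s2) / 2))) \<le> U n"
      using unit_cf_bernstein[OF w n s2, where t = t and k = "k n" and g = "g n"] t1 t2 t3 t4
      unfolding U_def v_def by linarith
  qed
  then have "(\<lambda>n. unit_cf (\<lambda>x. t / sqrt (real n) * centred_sum \<omega> {1..n} x) - complex_of_real (exp (- (t\<^sup>2 * s2) / 2))) \<longlonglongrightarrow> 0"
    using U by (rule Lim_null_comparison)
  then show ?thesis by (simp add: LIM_zero_iff)
qed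

theorem clt_fixed_sequence:
  assumes w: "admissible \<omega>" and lim: "(\<lambda>n. sum_var \<omega> {1..n} / real n) \<longlonglongrightarrow> s2" and s2: "0 < s2"
  shows "weak_conv_m
     (\<lambda>n. distr unit_lebesgue borel
        (\<lambda>x. 1 / sqrt (real n) *
           (\<Sum>j=1..n. \<phi> (random_orbit \<omega> j x)
              - (LINT y|unit_lebesgue. \<phi> (random_orbit \<omega> j y)))))
     (density lborel (normal_density 0 (sqrt s2)))"
proof (rule levy_continuity)
  let ?X = "\<lambda>n x. 1 / sqrt (real n) * (\<Sum>j=1..n. \<phi> (random_orbit \<omega> j x)
              - (LINT y|unit_lebesgue. \<phi> (random_orbit \<omega> j y)))"
  have X: "?X n = (\<lambda>x. 1 / sqrt (real n) * centred_sum \<omega> {1..n} x)" for n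
    by (simp add: centred_sum_def centred_def obs_def fibre_mean_def)
  have Xm: "?X n \<in> borel_measurable unit_lebesgue" for n
    unfolding X by (intro borel_measurable_times borel_measurable_const measurable_centred_sum[OF w])
  show "real_distribution (distr unit_lebesgue borel (?X n))" for n
    using Xm by (rule unit_lebesgue.real_distribution_distr)
  have "prob_space (density lborel (normal_density 0 (sqrt s2)))"
    using s2 by (intro prob_space_normal_density) simp
  then show "real_distribution (density lborel (normal_density 0 (sqrt s2)))"
    by (simp add: real_distribution_def real_distribution_axioms_def)
  fix t
  have "char (distr unit_lebesgue borel (?X n)) t = unit_cf (\<lambda>x. t / sqrt (real n) * centred_sum \<omega> {1..n} x)" for n
  proof -
    have "char (distr unit_lebesgue borel (?X n)) t = (CLINT x|unit_lebesgue. cis (t * ?X n x))"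
      unfolding char_def using Xm[of n] by (subst integral_distr) (auto simp: cis_conv_exp)
    moreover have "t * ?X n x = t / sqrt (real n) * centred_sum \<omega> {1..n} x" for x
      by (simp add: centred_sum_def centred_def obs_def fibre_mean_def)
    ultimately show ?thesis unfolding unit_cf_def by (simp only:)
  qed
  moreover have "char (density lborel (normal_density 0 (sqrt s2))) t = complex_of_real (exp (- (t\<^sup>2 * s2) / 2))"
    using s2 by (subst char_normal) (auto simp: power_mult_distrib mult.commute)
  ultimately show "(\<lambda>n. char (distr unit_lebesgue borel (?X n)) t) \<longlonglongrightarrow> char (density lborel (normal_density 0 (sqrt s2))) t"
    using clt_characteristic[OF w lim] s2 by simp
qed

end

section \<open>Averages of weakly dependent quantities\<close>

lemma cesaro_null:
  fixes a :: "nat \<Rightarrow> real"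
  assumes a: "a \<longlonglongrightarrow> 0"
  shows "(\<lambda>n. (\<Sum>i=1..n. a i) / real n) \<longlonglongrightarrow> 0"
proof (rule LIMSEQ_I)
  fix r :: real assume r: "0 < r"
  obtain N where N: "\<And>n. n \<ge> N \<Longrightarrow> \<bar>a n\<bar> < r / 2"
    using LIMSEQ_D[OF a, of "r / 2"] r by auto
  define K where "K = (\<Sum>i<N. \<bar>a i\<bar>)"
  have "(\<lambda>n. K / real n) \<longlonglongrightarrow> 0" by (intro lim_const_over_n)
  then obtain N' where N': "\<And>n. n \<ge> N' \<Longrightarrow> \<bar>K / real n\<bar> < r / 2"
    using LIMSEQ_D[of "\<lambda>n. K / real n" 0 "r / 2"] r by auto
  show "\<exists>no. \<forall>n\<ge>no. norm ((\<Sum>i=1..n. a i) / real n - 0) < r"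
  proof (intro exI[of _ "max N' 1"] allI impI)
    fix n assume n: "max N' 1 \<le> n"
    have "\<bar>\<Sum>i=1..n. a i\<bar> \<le> (\<Sum>i=1..n. \<bar>a i\<bar>)" by (rule sum_abs)
    also have "\<dots> \<le> (\<Sum>i=1..n. (if i < N then \<bar>a i\<bar> else 0) + r / 2)"
      using N r by (intro sum_mono) (auto simp: not_less intro: less_imp_le)
    also have "\<dots> = (\<Sum>i\<in>{1..n}. if i < N then \<bar>a i\<bar> else 0) + real n * (r / 2)"
      by (simp add: sum.distrib)
    also have "(\<Sum>i\<in>{1..n}. if i < N then \<bar>a i\<bar> else 0) = (\<Sum>i\<in>{i\<in>{1..n}. i < N}. \<bar>a i\<bar>)"
      by (rule sum.inter_filter[symmetric]) simp
    also have "\<dots> \<le> K" unfolding K_def by (intro sum_mono2) auto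
    finally have "\<bar>\<Sum>i=1..n. a i\<bar> / real n \<le> K / real n + r / 2"
      using n by (simp add: field_simps)
    then show "norm ((\<Sum>i=1..n. a i) / real n - 0) < r"
      using abs_ge_self[of "K / real n"] N'[of n] n by (simp only: diff_zero real_norm_def abs_divide abs_of_nat) linarith
  qed
qed

lemma cesaro_limit:
  fixes a :: "nat \<Rightarrow> real"
  assumes a: "a \<longlonglongrightarrow> L"
  shows "(\<lambda>n. (\<Sum>i=1..n. a i) / real n) \<longlonglongrightarrow> L"
proof -
  have "(\<lambda>n. (\<Sum>i=1..n. a i - L) / real n + L) \<longlonglongrightarrow> 0 + L"
    by (intro tendsto_intros cesaro_null) (use a in \<open>simp add: LIM_zero\<close>)
  moreover have "\<forall>\<^sub>F n in sequentially. (\<Sum>i=1..n. a i - L) / real n + L = (\<Sum>i=1..n. a i) / real n"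
    using eventually_gt_at_top[of 0] by eventually_elim (simp add: sum_subtractf field_simps)
  ultimately show ?thesis by (simp add: tendsto_cong)
qed

text \<open>Summation along the diagonals j - i = k. Passing from n to n + 1 appends one term of the
  new column to every diagonal, counted twice off the main one.\<close>

lemma symmetric_double_sum:
  fixes c :: "nat \<Rightarrow> nat \<Rightarrow> real"
  assumes sym: "\<And>i j. c i j = c j i"
  shows "(\<Sum>i=1..n. \<Sum>j=1..n. c i j) = (\<Sum>k<n. (2 - (if k = 0 then 1 else 0)) * (\<Sum>i=1..n - k. c i (i + k)))"
proof (induction n)
  case (Suc n)
  let ?f = "\<lambda>k::nat. (2 - (if k = 0 then 1 else 0) :: real)"
  have "(\<Sum>i=1..Suc n. \<Sum>j=1..Suc n. c i j) = (\<Sum>i=1..n. \<Sum>j=1..n. c i j) + 2 * (\<Sum>i=1..n. c i (Suc n)) + c (Suc n) (Suc n)"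
    using sym by (simp add: sum.distrib)
  also have "(\<Sum>i=1..n. \<Sum>j=1..n. c i j) = (\<Sum>k<Suc n. ?f k * (\<Sum>i=1..n - k. c i (i + k)))"
    by (simp only: Suc.IH sum.lessThan_Suc) simp
  also have "2 * (\<Sum>i=1..n. c i (Suc n)) + c (Suc n) (Suc n) = (\<Sum>k<Suc n. ?f k * c (Suc n - k) (Suc n))"
  proof -
    have "(\<Sum>i=1..n. c i (Suc n)) = (\<Sum>k<n. c (n - k) (Suc n))"
      by (rule sum.reindex_bij_witness[of _ "\<lambda>k. n - k" "\<lambda>i. n - i"]) auto
    then show ?thesis
      by (subst sum.lessThan_Suc_shift) (simp add: sum_distrib_left)
  qed
  then have "(\<Sum>k<Suc n. ?f k * (\<Sum>i=1..n - k. c i (i + k))) + 2 * (\<Sum>i=1..n. c i (Suc n)) + c (Suc n) (Suc n)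
      = (\<Sum>k<Suc n. ?f k * ((\<Sum>i=1..n - k. c i (i + k)) + c (Suc n - k) (Suc n)))"
    by (simp add: distrib_left sum.distrib)
  also have "\<dots> = (\<Sum>k<Suc n. ?f k * (\<Sum>i=1..Suc n - k. c i (i + k)))"
    by (intro sum.cong refl) (auto simp: Suc_diff_le)
  finally show ?case .
qed simp

text \<open>Tannery's theorem, dominated convergence for series, exchanges the limit in n with the
  sum over the lag k, with majorant 2 \<rho>. It serves the fibre covariances along one sequence,
  their means, and the covariances of the fibre means alike.\<close>

lemma double_cesaro:
  fixes c :: "nat \<Rightarrow> nat \<Rightarrow> real"
  assumes sym: "\<And>i j. c i j = c j i" and bnd: "\<And>i k. \<bar>c i (i + k)\<bar> \<le> \<rho> k" and sum: "summable \<rho>"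
    and lim: "\<And>k. (\<lambda>n. (\<Sum>i=1..n. c i (i + k)) / real n) \<longlonglongrightarrow> A k"
  shows "summable (\<lambda>k. (2 - (if k = 0 then 1 else 0)) * A k)"
    and "(\<lambda>n. (\<Sum>i=1..n. \<Sum>j=1..n. c i j) / real n) \<longlonglongrightarrow> (\<Sum>k. (2 - (if k = 0 then 1 else 0)) * A k)"
proof -
  let ?f = "\<lambda>k::nat. (2 - (if k = 0 then 1 else 0) :: real)"
  define b where "b k n = (if k < n then ?f k * ((\<Sum>i=1..n - k. c i (i + k)) / real n) else 0)" for k n
  have \<rho>0: "0 \<le> \<rho> k" for k using bnd[of 0 k] by linarith
  have limb: "b k \<longlonglongrightarrow> ?f k * A k" for k
  proof -
    \<comment> \<open>Passing from n - k to n summands adds at most k terms of size at most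
      \<rho>(k), which is negligible after division by n.\<close>
    have 1: "(\<lambda>n. (\<Sum>i=1..n. c i (i + k)) / real n - (\<Sum>i=1..n - k. c i (i + k)) / real n) \<longlonglongrightarrow> 0"
    proof (rule Lim_null_comparison)
      show "(\<lambda>n. real k * \<rho> k / real n) \<longlonglongrightarrow> 0" by (intro lim_const_over_n)
      show "\<forall>\<^sub>F n in sequentially. norm ((\<Sum>i=1..n. c i (i + k)) / real n - (\<Sum>i=1..n - k. c i (i + k)) / real n) \<le> real k * \<rho> k / real n"
      proof (rule always_eventually, rule allI)
        fix n
        have "(\<Sum>i=1..n. c i (i + k)) = (\<Sum>i=1..n - k. c i (i + k)) + (\<Sum>i=n - k + 1..n. c i (i + k))"
          using sum.ub_add_nat[of 1 "n - k" "\<lambda>i. c i (i + k)" "n - (n - k)"] by simp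
        then have "\<bar>(\<Sum>i=1..n. c i (i + k)) - (\<Sum>i=1..n - k. c i (i + k))\<bar> \<le> (\<Sum>i=n - k + 1..n. \<bar>c i (i + k)\<bar>)"
          using sum_abs[of "\<lambda>i. c i (i + k)" "{n - k + 1..n}"] by simp
        also have "\<dots> \<le> real (card {n - k + 1..n}) * \<rho> k" using bnd by (intro sum_bounded_above)
        also have "\<dots> \<le> real k * \<rho> k" using \<rho>0 by (intro mult_right_mono) auto
        finally have "\<bar>(\<Sum>i=1..n. c i (i + k)) - (\<Sum>i=1..n - k. c i (i + k))\<bar> / real n \<le> real k * \<rho> k / real n"
          by (rule divide_right_mono) simp
        then show "norm ((\<Sum>i=1..n. c i (i + k)) / real n - (\<Sum>i=1..n - k. c i (i + k)) / real n) \<le> real k * \<rho> k / real n"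
          by (simp flip: diff_divide_distrib)
      qed
    qed
    have "(\<lambda>n. (\<Sum>i=1..n - k. c i (i + k)) / real n) \<longlonglongrightarrow> A k - 0"
      using tendsto_diff[OF lim[of k] 1] by simp
    then have "(\<lambda>n. ?f k * ((\<Sum>i=1..n - k. c i (i + k)) / real n)) \<longlonglongrightarrow> ?f k * A k"
      by (intro tendsto_mult_left) simp
    moreover have "\<forall>\<^sub>F n in sequentially. ?f k * ((\<Sum>i=1..n - k. c i (i + k)) / real n) = b k n"
      using eventually_gt_at_top[of k] by eventually_elim (simp add: b_def)
    ultimately show ?thesis by (simp add: tendsto_cong)
  qed
  have bb: "norm (b k n) \<le> 2 * \<rho> k" for k n
  proof (cases "k < n")
    case True
    have "\<bar>\<Sum>i=1..n - k. c i (i + k)\<bar> \<le> (\<Sum>i=1..n - k. \<bar>c i (i + k)\<bar>)" by (rule sum_abs)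
    also have "\<dots> \<le> real (card {1..n - k}) * \<rho> k" using bnd by (intro sum_bounded_above)
    also have "\<dots> \<le> real n * \<rho> k" using \<rho>0 by (intro mult_right_mono) auto
    finally have "\<bar>\<Sum>i=1..n - k. c i (i + k)\<bar> / real n \<le> \<rho> k" using True by (simp add: field_simps)
    then have "\<bar>?f k\<bar> * (\<bar>\<Sum>i=1..n - k. c i (i + k)\<bar> / real n) \<le> 2 * \<rho> k"
      using \<rho>0 by (intro mult_mono) auto
    then show ?thesis using True by (simp add: b_def abs_mult)
  qed (use \<rho>0 in \<open>simp add: b_def\<close>)
  have T: "summable (\<lambda>k. norm (?f k * A k)) \<and> ((\<lambda>n. \<Sum>k. b k n) \<longlonglongrightarrow> (\<Sum>k. ?f k * A k))"
    using tannerys_theorem[of b "\<lambda>k. ?f k * A k" sequentially "\<lambda>k. 2 * \<rho> k"] limb bb sum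
    by (auto simp: summable_mult always_eventually)
  then show "summable (\<lambda>k. ?f k * A k)" by (intro summable_norm_cancel[of "\<lambda>k. ?f k * A k"]) (rule conjunct1)
  have "(\<Sum>k. b k n) = (\<Sum>i=1..n. \<Sum>j=1..n. c i j) / real n" for n
  proof -
    have "(\<Sum>k. b k n) = (\<Sum>k<n. b k n)" by (rule suminf_finite) (auto simp: b_def)
    also have "\<dots> = (\<Sum>k<n. ?f k * (\<Sum>i=1..n - k. c i (i + k)) / real n)"
      by (intro sum.cong) (auto simp: b_def)
    also have "\<dots> = (\<Sum>k<n. ?f k * (\<Sum>i=1..n - k. c i (i + k))) / real n"
      by (rule sum_divide_distrib[symmetric])
    also have "\<dots> = (\<Sum>i=1..n. \<Sum>j=1..n. c i j) / real n"
      by (simp only: symmetric_double_sum[OF sym])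
    finally show ?thesis .
  qed
  then show "(\<lambda>n. (\<Sum>i=1..n. \<Sum>j=1..n. c i j) / real n) \<longlonglongrightarrow> (\<Sum>k. ?f k * A k)"
    using T by simp
qed

text \<open>Between q^2 and the next square lie few indices: n - q^2 \<le> 2q+1 \<le> 3q, so bounded
  terms change the average by O(1/q) only. Almost sure convergence is thereby reduced to the
  squares, along which the second moments will be summable.\<close>

lemma average_from_squares:
  fixes y :: "nat \<Rightarrow> real"
  assumes bnd: "\<And>i. \<bar>y i\<bar> \<le> B" and lim: "(\<lambda>q. (\<Sum>i=1..q\<^sup>2. y i) / real (q\<^sup>2)) \<longlonglongrightarrow> 0"
  shows "(\<lambda>n. (\<Sum>i=1..n. y i) / real n) \<longlonglongrightarrow> 0"
proof -
  define q where "q n = nat \<lfloor>sqrt (real n)\<rfloor>" for n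
  have B: "0 \<le> B" using bnd[of 0] by linarith
  have qtop: "filterlim q at_top sequentially"
    unfolding q_def by real_asymp
  have "(\<lambda>n. \<bar>(\<Sum>i=1..(q n)\<^sup>2. y i) / real ((q n)\<^sup>2)\<bar> + 3 * B * (1 / real (q n))) \<longlonglongrightarrow> \<bar>0\<bar> + 3 * B * 0"
    by (intro tendsto_intros filterlim_compose[OF lim qtop] filterlim_compose[OF lim_1_over_n qtop])
  then have U: "(\<lambda>n. \<bar>(\<Sum>i=1..(q n)\<^sup>2. y i) / real ((q n)\<^sup>2)\<bar> + 3 * B * (1 / real (q n))) \<longlonglongrightarrow> 0" by simp
  have "\<forall>\<^sub>F n in sequentially. norm ((\<Sum>i=1..n. y i) / real n) \<le> \<bar>(\<Sum>i=1..(q n)\<^sup>2. y i) / real ((q n)\<^sup>2)\<bar> + 3 * B * (1 / real (q n))"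
    using eventually_ge_at_top[of 1]
  proof eventually_elim
    fix n :: nat assume n: "1 \<le> n"
    have "1 \<le> sqrt (real n)" using n by simp
    then have "1 \<le> \<lfloor>sqrt (real n)\<rfloor>" by (simp add: le_floor_iff)
    then have rq: "real (q n) = real_of_int \<lfloor>sqrt (real n)\<rfloor>" "1 \<le> real (q n)" unfolding q_def by auto
    have "real (q n) \<le> sqrt (real n)" using rq(1) by simp
    then have "(real (q n))\<^sup>2 \<le> (sqrt (real n))\<^sup>2" by (intro power_mono) auto
    then have q1: "(q n)\<^sup>2 \<le> n" by (simp flip: of_nat_power)
    have "sqrt (real n) \<le> real (q n) + 1" using rq(1) by linarith
    then have "(sqrt (real n))\<^sup>2 \<le> (real (q n) + 1)\<^sup>2" by (intro power_mono) auto
    then have q2: "real n - real ((q n)\<^sup>2) \<le> 3 * real (q n)" using rq(2) by (simp add: power2_eq_square algebra_simps)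
    have pos: "0 < real ((q n)\<^sup>2)" using rq(2) by simp
    have split: "(\<Sum>i=1..n. y i) = (\<Sum>i=1..(q n)\<^sup>2. y i) + (\<Sum>i=(q n)\<^sup>2 + 1..n. y i)"
      using sum.ub_add_nat[of 1 "(q n)\<^sup>2" y "n - (q n)\<^sup>2"] q1 by simp
    have "\<bar>\<Sum>i=(q n)\<^sup>2 + 1..n. y i\<bar> \<le> (\<Sum>i=(q n)\<^sup>2 + 1..n. \<bar>y i\<bar>)" by (rule sum_abs)
    also have "\<dots> \<le> real (card {(q n)\<^sup>2 + 1..n}) * B" using bnd by (intro sum_bounded_above)
    also have "\<dots> \<le> 3 * real (q n) * B" using q1 q2 B by (intro mult_right_mono) (auto simp: of_nat_diff)
    finally have "\<bar>\<Sum>i=1..n. y i\<bar> \<le> \<bar>\<Sum>i=1..(q n)\<^sup>2. y i\<bar> + 3 * real (q n) * B" unfolding split by linarith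
    then have "\<bar>\<Sum>i=1..n. y i\<bar> / real n \<le> (\<bar>\<Sum>i=1..(q n)\<^sup>2. y i\<bar> + 3 * real (q n) * B) / real n"
      by (rule divide_right_mono) simp
    also have "\<dots> \<le> (\<bar>\<Sum>i=1..(q n)\<^sup>2. y i\<bar> + 3 * real (q n) * B) / real ((q n)\<^sup>2)"
      using q1 pos B n by (intro divide_left_mono mult_pos_pos) (auto simp del: of_nat_power)
    also have "\<dots> = \<bar>(\<Sum>i=1..(q n)\<^sup>2. y i) / real ((q n)\<^sup>2)\<bar> + 3 * B * (1 / real (q n))"
      using rq(2) by (simp add: add_divide_distrib power2_eq_square)
    finally show "norm ((\<Sum>i=1..n. y i) / real n) \<le> \<bar>(\<Sum>i=1..(q n)\<^sup>2. y i) / real ((q n)\<^sup>2)\<bar> + 3 * B * (1 / real (q n))"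
      by simp
  qed
  then show ?thesis using U by (rule Lim_null_comparison)
qed

section \<open>A strong law for functions of an independent sequence that forget the past\<close>

context sequence_space
begin

text \<open>The last two clauses complement each other: finite dependence separates X i from the
  coordinates to come, and forgetting at rate r nearly separates later variables from the
  coordinates before. Under a product measure this gives decay of correlations without stationarity
  of X.\<close>

definition shift_mixing :: "(nat \<Rightarrow> (nat \<Rightarrow> 'a) \<Rightarrow> real) \<Rightarrow> nat \<Rightarrow> real \<Rightarrow> (nat \<Rightarrow> real) \<Rightarrow> bool" where
  "shift_mixing X d B r \<longleftrightarrow> (\<forall>i. X i \<in> borel_measurable S) \<and> (\<forall>i. \<forall>\<omega>\<in>space S. \<bar>X i \<omega>\<bar> \<le> B) \<and>
     (\<forall>i \<omega> \<omega>'. (\<forall>j<i + d. \<omega> j = \<omega>' j) \<longrightarrow> X i \<omega> = X i \<omega>') \<and>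
     (\<forall>l L. \<forall>\<omega>\<in>space S. \<bar>X (l + L) \<omega> - X L (\<lambda>i. \<omega> (i + l))\<bar> \<le> r L)"

lemma shift_mixingD:
  assumes "shift_mixing X d B r"
  shows "X i \<in> borel_measurable S" "\<omega> \<in> space S \<Longrightarrow> \<bar>X i \<omega>\<bar> \<le> B"
    "(\<And>j. j < i + d \<Longrightarrow> \<omega> j = \<omega>' j) \<Longrightarrow> X i \<omega> = X i \<omega>'"
    "\<omega> \<in> space S \<Longrightarrow> \<bar>X (l + L) \<omega> - X L (\<lambda>i. \<omega> (i + l))\<bar> \<le> r L"
  using assms unfolding shift_mixing_def by blast+

lemma measurable_shift: "(\<lambda>\<omega> i. \<omega> (i + n)) \<in> S \<rightarrow>\<^sub>M S"
  by (rule measurable_PiM_single') (auto simp: space_PiM PiE_iff)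

lemma shift_space: "\<omega> \<in> space S \<Longrightarrow> (\<lambda>i. \<omega> (i + n)) \<in> space S"
  using measurable_space[OF measurable_shift] .

lemma integrable_bounded_S:
  fixes f :: "(nat \<Rightarrow> 'a) \<Rightarrow> real"
  assumes "f \<in> borel_measurable S" "\<And>\<omega>. \<omega> \<in> space S \<Longrightarrow> \<bar>f \<omega>\<bar> \<le> B"
  shows "integrable S f"
  using assms by (intro P.integrable_const_bound[of _ B]) auto

text \<open>Gluing the first n coordinates of one sample to an independent second sample does not
  change the law; after gluing, f sees only the first sample and the shifted g only the
  second.\<close>

lemma independent_shift:
  fixes f g :: "(nat \<Rightarrow> 'a) \<Rightarrow> real"
  assumes f: "f \<in> borel_measurable S" "\<And>\<omega>. \<omega> \<in> space S \<Longrightarrow> \<bar>f \<omega>\<bar> \<le> B"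
    and dep: "\<And>\<omega> \<omega>'. (\<And>j. j < n \<Longrightarrow> \<omega> j = \<omega>' j) \<Longrightarrow> f \<omega> = f \<omega>'"
    and g: "g \<in> borel_measurable S" "\<And>\<omega>. \<omega> \<in> space S \<Longrightarrow> \<bar>g \<omega>\<bar> \<le> C"
  shows "(LINT \<omega>|S. f \<omega> * g (\<lambda>i. \<omega> (i + n))) = (LINT \<omega>|S. f \<omega>) * (LINT \<omega>|S. g \<omega>)"
proof -
  interpret PP: pair_prob_space S S by unfold_locales
  note [measurable] = f(1) g(1) measurable_shift[of n]
  obtain \<omega>0 where "\<omega>0 \<in> space S" using P.not_empty by blast
  then have B: "0 \<le> B" and C: "0 \<le> C" using f(2)[of \<omega>0] g(2)[of \<omega>0] by linarith+
  have "(LINT \<omega>|S. f \<omega> * g (\<lambda>i. \<omega> (i + n))) =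
      (LINT \<omega>|(distr (S \<Otimes>\<^sub>M S) S (\<lambda>(\<omega>, \<omega>'). comb_seq n \<omega> \<omega>')). f \<omega> * g (\<lambda>i. \<omega> (i + n)))"
    by (simp add: PiM_comb_seq)
  also have "\<dots> = (LINT z|(S \<Otimes>\<^sub>M S). f (case z of (\<omega>, \<omega>') \<Rightarrow> comb_seq n \<omega> \<omega>') * g (\<lambda>i. (case z of (\<omega>, \<omega>') \<Rightarrow> comb_seq n \<omega> \<omega>') (i + n)))"
    by (rule integral_distr[OF measurable_comb_seq]) measurable
  also have "\<dots> = (LINT z|(S \<Otimes>\<^sub>M S). f (fst z) * g (snd z))"
  proof (rule Bochner_Integration.integral_cong[OF refl])
    fix z :: "(nat \<Rightarrow> 'a) \<times> (nat \<Rightarrow> 'a)"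
    obtain \<omega> \<omega>' where z: "z = (\<omega>, \<omega>')" by (cases z)
    have "f (comb_seq n \<omega> \<omega>') = f \<omega>" by (rule dep) (simp add: comb_seq_def)
    moreover have "(\<lambda>i. comb_seq n \<omega> \<omega>' (i + n)) = \<omega>'" by (simp add: comb_seq_def fun_eq_iff)
    ultimately show "f (case z of (\<omega>, \<omega>') \<Rightarrow> comb_seq n \<omega> \<omega>') * g (\<lambda>i. (case z of (\<omega>, \<omega>') \<Rightarrow> comb_seq n \<omega> \<omega>') (i + n)) = f (fst z) * g (snd z)"
      by (simp add: z)
  qed
  also have "\<dots> = (LINT \<omega>|S. LINT \<omega>'|S. f \<omega> * g \<omega>')"
  proof -
    have "integrable (S \<Otimes>\<^sub>M S) (\<lambda>z. f (fst z) * g (snd z))"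
    proof (rule PP.integrable_const_bound[of _ "B * C"])
      show "AE z in S \<Otimes>\<^sub>M S. norm (f (fst z) * g (snd z)) \<le> B * C"
        using f(2) g(2) B C by (intro AE_I2) (auto simp: space_pair_measure abs_mult intro!: mult_mono)
    qed measurable
    from PP.integral_fst'[OF this] show ?thesis by simp
  qed
  also have "\<dots> = (LINT \<omega>|S. f \<omega>) * (LINT \<omega>|S. g \<omega>)" by simp
  finally show ?thesis .
qed

lemma integral_shift:
  fixes g :: "(nat \<Rightarrow> 'a) \<Rightarrow> real"
  assumes "g \<in> borel_measurable S" "\<And>\<omega>. \<omega> \<in> space S \<Longrightarrow> \<bar>g \<omega>\<bar> \<le> C"
  shows "(LINT \<omega>|S. g (\<lambda>i. \<omega> (i + n))) = (LINT \<omega>|S. g \<omega>)"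
  using independent_shift[of "\<lambda>_. 1" 1 n g C] assms P.prob_space by simp

context
  fixes X d B r
  assumes X: "shift_mixing X d B r"
begin

lemma mixing_bound_nonneg: "0 \<le> B"
proof -
  obtain \<omega>0 where "\<omega>0 \<in> space S" using P.not_empty by blast
  then show ?thesis using shift_mixingD(2)[OF X, of \<omega>0 0] by linarith
qed

lemma integrable_mixing: "integrable S (X i)"
  using shift_mixingD(1,2)[OF X] by (rule integrable_bounded_S)

lemma mean_mixing_bound: "\<bar>LINT \<omega>|S. X i \<omega>\<bar> \<le> B"
proof -
  have "\<bar>LINT \<omega>|S. X i \<omega>\<bar> \<le> (LINT \<omega>|S. \<bar>X i \<omega>\<bar>)" by (rule integral_abs_bound)
  also have "\<dots> \<le> (LINT \<omega>|S. B)"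
    using integrable_mixing shift_mixingD(2)[OF X] by (intro integral_mono) auto
  finally show ?thesis using P.prob_space by simp
qed

lemma mean_mixing_diff: "\<bar>(LINT \<omega>|S. X (l + L) \<omega>) - (LINT \<omega>|S. X L \<omega>)\<bar> \<le> r L"
proof -
  have i: "integrable S (\<lambda>\<omega>. X L (\<lambda>i. \<omega> (i + l)))"
    using shift_mixingD(2)[OF X] shift_space
    by (intro integrable_bounded_S[of _ B] measurable_compose[OF measurable_shift shift_mixingD(1)[OF X]]) blast
  have "(LINT \<omega>|S. X (l + L) \<omega>) - (LINT \<omega>|S. X L \<omega>) = (LINT \<omega>|S. X (l + L) \<omega> - X L (\<lambda>i. \<omega> (i + l)))"
    using i integrable_mixing integral_shift[OF shift_mixingD(1,2)[OF X]] by simp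
  also have "\<bar>\<dots>\<bar> \<le> (LINT \<omega>|S. \<bar>X (l + L) \<omega> - X L (\<lambda>i. \<omega> (i + l))\<bar>)" by (rule integral_abs_bound)
  also have "\<dots> \<le> (LINT \<omega>|S. r L)"
    using i integrable_mixing shift_mixingD(4)[OF X] by (intro integral_mono) auto
  finally show ?thesis using P.prob_space by simp
qed

lemma convergent_mean_mixing:
  assumes r: "r \<longlonglongrightarrow> 0"
  shows "convergent (\<lambda>i. LINT \<omega>|S. X i \<omega>)"
proof -
  have "Cauchy (\<lambda>i. LINT \<omega>|S. X i \<omega>)"
  proof (rule metric_CauchyI)
    fix e :: real assume e: "0 < e"
    then obtain N where N: "\<bar>r N\<bar> < e / 2" using LIMSEQ_D[OF r, of "e / 2"] by auto
    have "\<bar>(LINT \<omega>|S. X n \<omega>) - (LINT \<omega>|S. X N \<omega>)\<bar> < e / 2" if "N \<le> n" for n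
      using mean_mixing_diff[of "n - N" N] N that by simp
    then have "\<bar>(LINT \<omega>|S. X m \<omega>) - (LINT \<omega>|S. X n \<omega>)\<bar> < e" if "N \<le> m" "N \<le> n" for m n
      using that by (smt (verit) field_sum_of_halves)
    then show "\<exists>N. \<forall>m\<ge>N. \<forall>n\<ge>N. dist (LINT \<omega>|S. X m \<omega>) (LINT \<omega>|S. X n \<omega>) < e"
      by (auto simp: dist_real_def)
  qed
  then show ?thesis by (rule Cauchy_convergent)
qed

text \<open>The later variable is replaced by \<open>X k\<close> of the sequence shifted by i + d,
  which is independent of \<open>X i\<close>. The replacement is made in the joint expectation and
  in the product of means, at the price B r(k) each.\<close>

lemma covariance_mixing:
  "\<bar>(LINT \<omega>|S. X i \<omega> * X (i + d + k) \<omega>) - (LINT \<omega>|S. X i \<omega>) * (LINT \<omega>|S. X (i + d + k) \<omega>)\<bar> \<le> 2 * B * r k"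
proof -
  let ?l = "i + d" and ?Z = "\<lambda>\<omega>. X k (\<lambda>j. \<omega> (j + (i + d)))"
  note m = shift_mixingD[OF X]
  have B: "0 \<le> B" by (rule mixing_bound_nonneg)
  have Zm: "?Z \<in> borel_measurable S" using measurable_compose[OF measurable_shift m(1)] .
  have Zb: "\<bar>?Z \<omega>\<bar> \<le> B" if "\<omega> \<in> space S" for \<omega> using m(2) shift_space[OF that] by blast
  have prod: "integrable S (\<lambda>\<omega>. X i \<omega> * Y \<omega>)"
    if "Y \<in> borel_measurable S" "\<And>\<omega>. \<omega> \<in> space S \<Longrightarrow> \<bar>Y \<omega>\<bar> \<le> B" for Y
    using m(1,2) that B by (intro integrable_bounded_S[of _ "B * B"]) (auto simp: abs_mult intro!: mult_mono)
  have "(LINT \<omega>|S. X i \<omega> * X (?l + k) \<omega>) - (LINT \<omega>|S. X i \<omega>) * (LINT \<omega>|S. X k \<omega>)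
      = (LINT \<omega>|S. X i \<omega> * X (?l + k) \<omega>) - (LINT \<omega>|S. X i \<omega> * ?Z \<omega>)"
  proof -
    have "X i \<omega> = X i \<omega>'" if "\<And>j. j < i + d \<Longrightarrow> \<omega> j = \<omega>' j" for \<omega> \<omega>'
      using that by (rule m(3))
    from independent_shift[of "X i" B "i + d" "X k" B, OF m(1,2) this m(1,2)] show ?thesis by simp
  qed
  also have "\<dots> = (LINT \<omega>|S. X i \<omega> * X (?l + k) \<omega> - X i \<omega> * ?Z \<omega>)"
    using prod[OF m(1,2)] prod[OF Zm Zb] by simp
  also have "\<bar>\<dots>\<bar> \<le> (LINT \<omega>|S. \<bar>X i \<omega> * X (?l + k) \<omega> - X i \<omega> * ?Z \<omega>\<bar>)" by (rule integral_abs_bound)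
  also have "\<dots> \<le> (LINT \<omega>|S. B * r k)"
  proof (intro integral_mono integrable_abs Bochner_Integration.integrable_diff prod[OF m(1,2)] prod[OF Zm Zb])
    fix \<omega> assume w: "\<omega> \<in> space S"
    have "\<bar>X i \<omega>\<bar> * \<bar>X (?l + k) \<omega> - ?Z \<omega>\<bar> \<le> B * r k"
      using m(2,4) w B by (intro mult_mono) auto
    then show "\<bar>X i \<omega> * X (?l + k) \<omega> - X i \<omega> * ?Z \<omega>\<bar> \<le> B * r k"
      by (simp flip: abs_mult right_diff_distrib)
  qed (use P.prob_space in auto)
  finally have 1: "\<bar>(LINT \<omega>|S. X i \<omega> * X (?l + k) \<omega>) - (LINT \<omega>|S. X i \<omega>) * (LINT \<omega>|S. X k \<omega>)\<bar> \<le> B * r k"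
    using P.prob_space by simp
  have "\<bar>LINT \<omega>|S. X i \<omega>\<bar> * \<bar>(LINT \<omega>|S. X k \<omega>) - (LINT \<omega>|S. X (?l + k) \<omega>)\<bar> \<le> B * r k"
    using mean_mixing_bound[of i] mean_mixing_diff[of ?l k] B by (intro mult_mono) (auto simp: abs_minus_commute)
  then have "\<bar>(LINT \<omega>|S. X i \<omega>) * (LINT \<omega>|S. X k \<omega>) - (LINT \<omega>|S. X i \<omega>) * (LINT \<omega>|S. X (?l + k) \<omega>)\<bar> \<le> B * r k"
    by (simp flip: abs_mult right_diff_distrib)
  then show ?thesis using 1 by linarith
qed

lemma integrable_mixing_times: "integrable S (\<lambda>\<omega>. X i \<omega> * X j \<omega>)"
  using shift_mixingD(1,2)[OF X] mixing_bound_nonneg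
  by (intro integrable_bounded_S[of _ "B * B"]) (auto simp: abs_mult intro!: mult_mono)

lemma covariance_mixing_bound:
  "\<bar>(LINT \<omega>|S. X i \<omega> * X (i + k) \<omega>) - (LINT \<omega>|S. X i \<omega>) * (LINT \<omega>|S. X (i + k) \<omega>)\<bar>
    \<le> (if k < d then 2 * B * B else 2 * B * r (k - d))"
proof (cases "k < d")
  case True
  have "\<bar>LINT \<omega>|S. X i \<omega> * X (i + k) \<omega>\<bar> \<le> (LINT \<omega>|S. \<bar>X i \<omega> * X (i + k) \<omega>\<bar>)" by (rule integral_abs_bound)
  also have "\<dots> \<le> (LINT \<omega>|S. B * B)"
    using integrable_mixing_times shift_mixingD(2)[OF X] mixing_bound_nonneg
    by (intro integral_mono integrable_abs) (auto simp: abs_mult intro!: mult_mono)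
  finally have "\<bar>LINT \<omega>|S. X i \<omega> * X (i + k) \<omega>\<bar> \<le> B * B" using P.prob_space by simp
  moreover have "\<bar>(LINT \<omega>|S. X i \<omega>) * (LINT \<omega>|S. X (i + k) \<omega>)\<bar> \<le> B * B"
    using mean_mixing_bound mixing_bound_nonneg unfolding abs_mult by (intro mult_mono) auto
  ultimately show ?thesis using True by simp
next
  case False
  then show ?thesis using covariance_mixing[of i "k - d"] by simp
qed

definition mixing_cov :: "nat \<Rightarrow> nat \<Rightarrow> real" where
  "mixing_cov i j = (LINT \<omega>|S. X i \<omega> * X j \<omega>) - (LINT \<omega>|S. X i \<omega>) * (LINT \<omega>|S. X j \<omega>)"

lemma variance_mixing_sum:
  "(LINT \<omega>|S. (\<Sum>i\<in>J. X i \<omega> - (LINT \<omega>|S. X i \<omega>))\<^sup>2) = (\<Sum>i\<in>J. \<Sum>j\<in>J. mixing_cov i j)"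
proof -
  let ?e = "\<lambda>i. LINT \<omega>|S. X i \<omega>"
  have eq: "(X i \<omega> - ?e i) * (X j \<omega> - ?e j) = X i \<omega> * X j \<omega> - ?e j * X i \<omega> - ?e i * X j \<omega> + ?e i * ?e j" for i j \<omega>
    by (simp add: algebra_simps)
  have int: "integrable S (\<lambda>\<omega>. (X i \<omega> - ?e i) * (X j \<omega> - ?e j))" for i j
    unfolding eq using integrable_mixing_times integrable_mixing by auto
  have val: "(LINT \<omega>|S. (X i \<omega> - ?e i) * (X j \<omega> - ?e j)) = mixing_cov i j" for i j
    unfolding eq mixing_cov_def using integrable_mixing_times integrable_mixing P.prob_space by simp
  have "(LINT \<omega>|S. (\<Sum>i\<in>J. X i \<omega> - ?e i)\<^sup>2) = (LINT \<omega>|S. (\<Sum>i\<in>J. \<Sum>j\<in>J. (X i \<omega> - ?e i) * (X j \<omega> - ?e j)))"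
    by (simp add: power2_eq_square sum_product)
  also have "\<dots> = (\<Sum>i\<in>J. LINT \<omega>|S. (\<Sum>j\<in>J. (X i \<omega> - ?e i) * (X j \<omega> - ?e j)))"
    using int by (intro Bochner_Integration.integral_sum Bochner_Integration.integrable_sum)
  also have "\<dots> = (\<Sum>i\<in>J. \<Sum>j\<in>J. mixing_cov i j)"
    using int by (simp add: Bochner_Integration.integral_sum val)
  finally show ?thesis .
qed

lemma mixing_cov_commute: "mixing_cov i j = mixing_cov j i"
  by (simp add: mixing_cov_def mult.commute)

lemma mixing_rate_nonneg: "0 \<le> r k"
proof -
  obtain \<omega>0 where "\<omega>0 \<in> space S" using P.not_empty by blast
  then show ?thesis using shift_mixingD(4)[OF X, of \<omega>0 0 k] by linarith
qed

lemma summable_mixing_rate: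
  assumes "summable r"
  shows "summable (\<lambda>k. if k < d then 2 * B * B else 2 * B * r (k - d))"
proof -
  have "summable (\<lambda>k. 2 * B * r k)" using assms by (rule summable_mult)
  then have "summable (\<lambda>k. (\<lambda>k. if k < d then 2 * B * B else 2 * B * r (k - d)) (k + d))" by simp
  then show ?thesis by (subst (asm) summable_iff_shift)
qed

text \<open>Summable covariances make the second moment of the average over q^2 terms O(1/q^2). This
  is summable, so almost surely the squared averages are summable in q and the averages tend to zero
  along squares; boundedness fills in the other indices.\<close>

lemma strong_law_mixing:
  assumes r: "summable r"
  shows "AE \<omega> in S. (\<lambda>n. (\<Sum>i=1..n. X i \<omega> - (LINT \<omega>|S. X i \<omega>)) / real n) \<longlonglongrightarrow> 0"
proof -
  let ?e = "\<lambda>i. LINT \<omega>|S. X i \<omega>"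
  define \<kappa> where "\<kappa> k = (if k < d then 2 * B * B else 2 * B * r (k - d))" for k
  define K where "K = 2 * (\<Sum>k. \<kappa> (k + 0))"
  note B = mixing_bound_nonneg
  have \<kappa>: "summable \<kappa>" "\<And>k. 0 \<le> \<kappa> k"
    using summable_mixing_rate[OF r] B mixing_rate_nonneg by (auto simp: \<kappa>_def[abs_def])
  have K: "0 \<le> K" unfolding K_def using suminf_nonneg[OF \<kappa>] by simp
  have cov1: "\<bar>mixing_cov i (i + k)\<bar> \<le> \<kappa> k" for i k
    unfolding mixing_cov_def \<kappa>_def by (rule covariance_mixing_bound)
  have cov: "\<bar>mixing_cov i j\<bar> \<le> \<kappa> (max i j - min i j)" for i j
    using cov1[of i "j - i"] cov1[of j "i - j"] mixing_cov_commute[of i j] by (cases "i \<le> j") auto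
  define Z where "Z q \<omega> = (\<Sum>i=1..q\<^sup>2. X i \<omega> - ?e i) / real (q\<^sup>2)" for q \<omega>
  have Zm [measurable]: "Z q \<in> borel_measurable S" for q
    unfolding Z_def[abs_def] using shift_mixingD(1)[OF X] by measurable
  have var: "(LINT \<omega>|S. (Z q \<omega>)\<^sup>2) \<le> K * (1 / real q ^ 2)" if q: "1 \<le> q" for q
  proof -
    let ?J = "{1..q\<^sup>2}"
    have "(LINT \<omega>|S. (\<Sum>i\<in>?J. X i \<omega> - ?e i)\<^sup>2) = (\<Sum>i\<in>?J. \<Sum>j\<in>?J. mixing_cov i j)"
      by (rule variance_mixing_sum)
    also have "\<dots> \<le> (\<Sum>i\<in>?J. K)"
    proof (rule sum_mono)
      fix i
      have "(\<Sum>j\<in>?J. mixing_cov i j) \<le> (\<Sum>j\<in>?J. \<kappa> (max i j - min i j))"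
        using cov by (intro sum_mono) (meson abs_le_D1)
      also have "\<dots> \<le> K" unfolding K_def by (rule sum_dist_le[OF \<kappa>]) auto
      finally show "(\<Sum>j\<in>?J. mixing_cov i j) \<le> K" .
    qed
    finally have "(LINT \<omega>|S. (\<Sum>i\<in>?J. X i \<omega> - ?e i)\<^sup>2) \<le> K * real (q\<^sup>2)" by (simp add: mult.commute)
    then have "(LINT \<omega>|S. (\<Sum>i\<in>?J. X i \<omega> - ?e i)\<^sup>2) / (real (q\<^sup>2))\<^sup>2 \<le> K * real (q\<^sup>2) / (real (q\<^sup>2))\<^sup>2"
      by (rule divide_right_mono) simp
    then show ?thesis using q by (simp add: Z_def power_divide power2_eq_square field_simps)
  qed
  have Zb: "\<bar>Z q \<omega>\<bar> \<le> 2 * B" if w: "\<omega> \<in> space S" for q \<omega>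
  proof -
    have "\<bar>\<Sum>i=1..q\<^sup>2. X i \<omega> - ?e i\<bar> \<le> (\<Sum>i=1..q\<^sup>2. \<bar>X i \<omega> - ?e i\<bar>)" by (rule sum_abs)
    also have "\<dots> \<le> real (card {1..q\<^sup>2}) * (2 * B)"
    proof (rule sum_bounded_above)
      fix i show "\<bar>X i \<omega> - ?e i\<bar> \<le> 2 * B"
        using shift_mixingD(2)[OF X w, of i] mean_mixing_bound[of i] by linarith
    qed
    finally have "\<bar>\<Sum>i=1..q\<^sup>2. X i \<omega> - ?e i\<bar> \<le> real (q\<^sup>2) * (2 * B)" by simp
    then show ?thesis
      using B by (cases "q = 0") (auto simp: Z_def abs_divide divide_le_eq mult.commute)
  qed
  have Zi: "integrable S (\<lambda>\<omega>. (Z q \<omega>)\<^sup>2)" for q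
  proof (rule integrable_bounded_S[of _ "(2 * B)\<^sup>2"])
    show "\<bar>(Z q \<omega>)\<^sup>2\<bar> \<le> (2 * B)\<^sup>2" if "\<omega> \<in> space S" for \<omega>
      using power_mono[OF Zb[OF that, of q] abs_ge_zero, of 2] by simp
  qed measurable
  have "(\<integral>\<^sup>+\<omega>. (\<Sum>q. ennreal ((Z (Suc q) \<omega>)\<^sup>2)) \<partial>S) = (\<Sum>q. \<integral>\<^sup>+\<omega>. ennreal ((Z (Suc q) \<omega>)\<^sup>2) \<partial>S)"
    by (rule nn_integral_suminf) measurable
  also have "\<dots> = (\<Sum>q. ennreal (LINT \<omega>|S. (Z (Suc q) \<omega>)\<^sup>2))"
    using Zi by (simp add: nn_integral_eq_integral)
  also have "\<dots> \<le> (\<Sum>q. ennreal (K * (1 / real (Suc q) ^ 2)))"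
    by (intro suminf_le ennreal_leI var) auto
  also have "\<dots> < \<top>"
  proof -
    have "summable (\<lambda>q. 1 / real (Suc q) ^ 2)"
      using inverse_power_summable[of 2, where 'a = real] by (subst summable_Suc_iff) (simp add: divide_inverse power_inverse)
    then have "summable (\<lambda>q. K * (1 / real (Suc q) ^ 2))" by (rule summable_mult)
    then show ?thesis using K by (subst suminf_ennreal2) auto
  qed
  finally have "(\<integral>\<^sup>+\<omega>. (\<Sum>q. ennreal ((Z (Suc q) \<omega>)\<^sup>2)) \<partial>S) \<noteq> \<infinity>" by simp
  then have "AE \<omega> in S. (\<Sum>q. ennreal ((Z (Suc q) \<omega>)\<^sup>2)) \<noteq> \<infinity>"
    by (intro nn_integral_PInf_AE) measurable
  then show ?thesis
  proof (rule AE_mp, intro AE_I2 impI)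
    fix \<omega> assume w: "\<omega> \<in> space S" and fin: "(\<Sum>q. ennreal ((Z (Suc q) \<omega>)\<^sup>2)) \<noteq> \<infinity>"
    have "summable (\<lambda>q. (Z (Suc q) \<omega>)\<^sup>2)" using fin by (intro summable_suminf_not_top) auto
    then have "(\<lambda>q. (Z (Suc q) \<omega>)\<^sup>2) \<longlonglongrightarrow> 0" by (rule summable_LIMSEQ_zero)
    then have "(\<lambda>q. sqrt ((Z (Suc q) \<omega>)\<^sup>2)) \<longlonglongrightarrow> sqrt 0" by (intro tendsto_intros)
    then have "(\<lambda>q. Z (Suc q) \<omega>) \<longlonglongrightarrow> 0" by (simp add: tendsto_rabs_zero_iff)
    then have "(\<lambda>q. Z q \<omega>) \<longlonglongrightarrow> 0" by (rule LIMSEQ_imp_Suc)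
    then show "(\<lambda>n. (\<Sum>i=1..n. X i \<omega> - ?e i) / real n) \<longlonglongrightarrow> 0"
    proof (intro average_from_squares[of "\<lambda>i. X i \<omega> - ?e i" "2 * B"])
      fix i show "\<bar>X i \<omega> - ?e i\<bar> \<le> 2 * B"
        using shift_mixingD(2)[OF X w, of i] mean_mixing_bound[of i] by linarith
    qed (simp add: Z_def[abs_def])
  qed
qed

lemma strong_law_mixing_limit:
  assumes r: "summable r"
  shows "AE \<omega> in S. (\<lambda>n. (\<Sum>i=1..n. X i \<omega>) / real n) \<longlonglongrightarrow> Topological_Spaces.lim (\<lambda>i. LINT \<omega>|S. X i \<omega>)"
  using strong_law_mixing[OF r]
proof (rule AE_mp, intro AE_I2 impI)
  fix \<omega> assume *: "(\<lambda>n. (\<Sum>i=1..n. X i \<omega> - (LINT \<omega>|S. X i \<omega>)) / real n) \<longlonglongrightarrow> 0"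
  have "(\<lambda>n. (\<Sum>i=1..n. LINT \<omega>|S. X i \<omega>) / real n) \<longlonglongrightarrow> Topological_Spaces.lim (\<lambda>i. LINT \<omega>|S. X i \<omega>)"
    using convergent_mean_mixing[OF summable_LIMSEQ_zero[OF r]] by (intro cesaro_limit) (simp add: convergent_LIMSEQ_iff)
  from tendsto_add[OF * this] show "(\<lambda>n. (\<Sum>i=1..n. X i \<omega>) / real n) \<longlonglongrightarrow> Topological_Spaces.lim (\<lambda>i. LINT \<omega>|S. X i \<omega>)"
    by (simp add: sum_subtractf add_divide_distrib[symmetric])
qed

end

end

section \<open>Random parameter sequences\<close>

locale random_intermittent = intermittent_observable +
  fixes \<Omega> :: "real set" and p :: "real \<Rightarrow> real"
  assumes finite_Omega: "finite \<Omega>" and Omega_subset: "\<Omega> \<subseteq> {0<..<\<alpha>}"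
    and p_nonneg: "\<And>\<beta>. \<beta> \<in> \<Omega> \<Longrightarrow> 0 \<le> p \<beta>" and p_sum: "(\<Sum>\<beta>\<in>\<Omega>. p \<beta>) = 1"
begin

abbreviation parameter_law :: "real measure" where
  "parameter_law \<equiv> point_measure \<Omega> (\<lambda>\<beta>. ennreal (p \<beta>))"

lemma prob_space_parameter_law: "prob_space parameter_law"
  using finite_Omega p_nonneg p_sum by (intro prob_space_point_measure) auto

sublocale noise: sequence_space parameter_law
  by (intro sequence_space.intro product_prob_space.intro product_sigma_finite.intro
      product_prob_space_axioms.intro prob_space_imp_sigma_finite prob_space_parameter_law)

lemma noise_eq: "noise \<Omega> p = noise.S"
  by (simp add: noise_def)

lemma space_noise: "\<omega> \<in> space noise.S \<longleftrightarrow> (\<forall>i. \<omega> i \<in> \<Omega>)"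
  by (simp add: space_PiM PiE_iff space_point_measure)

lemma admissible_noise: "\<omega> \<in> space noise.S \<Longrightarrow> admissible \<omega>"
  using Omega_subset unfolding space_noise admissible_def by (fastforce intro: less_imp_le)

lemma measurable_random_orbit_joint:
  "(\<lambda>z. random_orbit (fst z) n (snd z)) \<in> noise.S \<Otimes>\<^sub>M unit_lebesgue \<rightarrow>\<^sub>M unit_lebesgue"
proof (induction n)
  case (Suc n)
  have "(\<lambda>z. fst z n) \<in> noise.S \<Otimes>\<^sub>M unit_lebesgue \<rightarrow>\<^sub>M parameter_law"
    by (rule measurable_compose[OF measurable_fst measurable_component_singleton]) simp
  moreover have "(\<lambda>x. x) \<in> parameter_law \<rightarrow>\<^sub>M borel" by simp
  ultimately have 1: "(\<lambda>z. fst z n) \<in> noise.S \<Otimes>\<^sub>M unit_lebesgue \<rightarrow>\<^sub>M borel"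
    by (rule measurable_compose)
  have 2: "(\<lambda>z. random_orbit (fst z) n (snd z)) \<in> noise.S \<Otimes>\<^sub>M unit_lebesgue \<rightarrow>\<^sub>M borel"
    using measurable_compose[OF Suc measurable_id_unit] .
  have "(\<lambda>z. intermittent_map (fst z n) (random_orbit (fst z) n (snd z))) \<in> noise.S \<Otimes>\<^sub>M unit_lebesgue \<rightarrow>\<^sub>M borel"
    using measurable_compose[OF measurable_Pair[OF 1 2] measurable_intermittent_map] by simp
  then have "(\<lambda>z. random_orbit (fst z) (Suc n) (snd z)) \<in> noise.S \<Otimes>\<^sub>M unit_lebesgue \<rightarrow>\<^sub>M restrict_space borel {0..1}"
    using random_orbit_unit[OF admissible_noise, of _ _ "Suc n"]
    by (intro measurable_restrict_space2) (auto simp: space_pair_measure simp del: atLeastAtMost_iff)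
  then show ?case
    by (simp only: measurable_cong_sets[OF refl sets_unit_lebesgue])
qed simp

lemma measurable_obs_joint: "(\<lambda>z. obs \<phi> j (fst z) (snd z)) \<in> borel_measurable (noise.S \<Otimes>\<^sub>M unit_lebesgue)"
  unfolding obs_def by (rule measurable_compose[OF measurable_random_orbit_joint measurable_phi])

lemma measurable_fibre_integral:
  fixes f :: "(nat \<Rightarrow> real) \<Rightarrow> real \<Rightarrow> real"
  assumes "(\<lambda>z. f (fst z) (snd z)) \<in> borel_measurable (noise.S \<Otimes>\<^sub>M unit_lebesgue)"
  shows "(\<lambda>\<omega>. LINT x|unit_lebesgue. f \<omega> x) \<in> borel_measurable noise.S"
  using assms by (intro unit_lebesgue.borel_measurable_lebesgue_integral) (simp add: case_prod_beta')

lemma measurable_fibre_mean: "(\<lambda>\<omega>. fibre_mean \<omega> j) \<in> borel_measurable noise.S"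
  unfolding fibre_mean_def by (rule measurable_fibre_integral[OF measurable_obs_joint])

lemma measurable_centred_joint: "(\<lambda>z. centred (fst z) j (snd z)) \<in> borel_measurable (noise.S \<Otimes>\<^sub>M unit_lebesgue)"
  unfolding centred_def
  by (intro borel_measurable_diff measurable_obs_joint measurable_compose[OF measurable_fst measurable_fibre_mean])

lemma measurable_fibre_cov: "(\<lambda>\<omega>. fibre_cov \<omega> i j) \<in> borel_measurable noise.S"
  unfolding fibre_cov_def
  by (intro measurable_fibre_integral borel_measurable_times measurable_centred_joint)

section \<open>Finite dependence on the parameters and loss of the past\<close>

lemma random_orbit_cong: "(\<And>j. j < n \<Longrightarrow> \<omega> j = \<omega>' j) \<Longrightarrow> random_orbit \<omega> n x = random_orbit \<omega>' n x"
  by (induction n) auto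

lemma obs_cong: "(\<And>j. j < n \<Longrightarrow> \<omega> j = \<omega>' j) \<Longrightarrow> obs \<phi> n \<omega> = obs \<phi> n \<omega>'"
  unfolding obs_def using random_orbit_cong by metis

lemma fibre_mean_cong: "(\<And>j. j < n \<Longrightarrow> \<omega> j = \<omega>' j) \<Longrightarrow> fibre_mean \<omega> n = fibre_mean \<omega>' n"
  unfolding fibre_mean_def using obs_cong by metis

lemma fibre_cov_cong:
  assumes "\<And>j. j < i + k \<Longrightarrow> \<omega> j = \<omega>' j"
  shows "fibre_cov \<omega> i (i + k) = fibre_cov \<omega>' i (i + k)"
  using obs_cong[of i \<omega> \<omega>'] obs_cong[of "i + k" \<omega> \<omega>'] fibre_mean_cong[of i \<omega> \<omega>'] fibre_mean_cong[of "i + k" \<omega> \<omega>'] assms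
  unfolding fibre_cov_def centred_def by simp

text \<open>After l steps Lebesgue measure has a density in the cone with the same mass as the
  constant 1, and from then on both densities are moved by the same L maps.\<close>

lemma forget_past:
  assumes w: "admissible \<omega>" and G: "G \<in> borel_measurable unit_lebesgue" "\<And>x. x \<in> {0..1} \<Longrightarrow> \<bar>G x\<bar> \<le> B"
  shows "\<bar>(LINT x|unit_lebesgue. G (random_orbit \<omega> (l + L) x)) - (LINT x|unit_lebesgue. G (random_orbit (\<lambda>i. \<omega> (i + l)) L x))\<bar> \<le> B * decay L"
proof -
  let ?w = "\<lambda>i. \<omega> (i + l)" and ?h = "transfers l \<omega> (\<lambda>_. 1)"
  have w': "admissible ?w" by (rule admissible_shift[OF w])
  have c1: "cone (\<lambda>_. 1)" by (rule cone_const) simp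
  have h: "cone ?h" by (rule cone_transfers[OF w c1])
  have mh: "(LINT x|unit_lebesgue. ?h x) = (LINT x|unit_lebesgue. (\<lambda>_. 1) x)"
    by (rule transfers_integral(2)[OF w coneD(2)[OF c1]])
  let ?D = "transfers L ?w (\<lambda>x. ?h x - 1)"
  have iD: "integrable unit_lebesgue ?D"
    using coneD(2)[OF h] by (intro transfers_integral(1)[OF w']) auto
  have i1: "integrable unit_lebesgue (\<lambda>x. transfers L ?w f x * G x)" if "integrable unit_lebesgue f" for f
    by (rule integrable_unit_bounded_mult[OF transfers_integral(1)[OF w' that] G])
  have B: "0 \<le> B" using G(2)[of 0] by simp
  have "(LINT x|unit_lebesgue. G (random_orbit \<omega> (l + L) x)) - (LINT x|unit_lebesgue. G (random_orbit ?w L x))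
      = (LINT x|unit_lebesgue. transfers L ?w ?h x * G x) - (LINT x|unit_lebesgue. transfers L ?w (\<lambda>_. 1) x * G x)"
    using integral_transfers_one[OF w G, of "l + L"] integral_transfers_one[OF w' G, of L] by (simp add: transfers_add)
  also have "\<dots> = (LINT x|unit_lebesgue. transfers L ?w ?h x * G x - transfers L ?w (\<lambda>_. 1) x * G x)"
    using i1 coneD(2)[OF h] by simp
  also have "\<dots> = (LINT x|unit_lebesgue. ?D x * G x)"
    by (simp add: transfers_diff left_diff_distrib)
  also have "\<bar>\<dots>\<bar> \<le> (LINT x|unit_lebesgue. \<bar>?D x * G x\<bar>)" by (rule integral_abs_bound)
  also have "\<dots> \<le> (LINT x|unit_lebesgue. \<bar>?D x\<bar> * B)"
    using iD G(2) integrable_unit_bounded_mult[OF iD G]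
    by (intro integral_unit_mono integrable_abs) (auto simp: abs_mult intro!: mult_left_mono)
  also have "\<dots> = (LINT x|unit_lebesgue. \<bar>?D x\<bar>) * B" by simp
  also have "\<dots> \<le> (decay L * (LINT x|unit_lebesgue. ?h x)) * B"
    by (intro mult_right_mono B memory_loss_decay[OF w' h c1 mh])
  finally show ?thesis using mh unit_lebesgue.prob_space by (simp add: mult.commute)
qed

lemma fibre_mean_forget:
  assumes w: "admissible \<omega>"
  shows "\<bar>fibre_mean \<omega> (l + L) - fibre_mean (\<lambda>i. \<omega> (i + l)) L\<bar> \<le> M * decay L"
  unfolding fibre_mean_def obs_def by (rule forget_past[OF w measurable_phi phi_bound])

lemma abs_prod_diff_le:
  fixes a b c d :: real
  assumes "\<bar>a - c\<bar> \<le> e" "\<bar>b - d\<bar> \<le> e'" "\<bar>a\<bar> \<le> K" "\<bar>d\<bar> \<le> K"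
  shows "\<bar>a * b - c * d\<bar> \<le> K * e' + K * e"
proof -
  have "a * b - c * d = a * (b - d) + d * (a - c)" by (simp add: algebra_simps)
  also have "\<bar>\<dots>\<bar> \<le> \<bar>a\<bar> * \<bar>b - d\<bar> + \<bar>d\<bar> * \<bar>a - c\<bar>"
    using abs_triangle_ineq[of "a * (b - d)" "d * (a - c)"] by (simp add: abs_mult)
  also have "\<dots> \<le> K * e' + K * e" using assms by (intro add_mono mult_mono) auto
  finally show ?thesis .
qed

lemma fibre_mean_prod_forget:
  assumes w: "admissible \<omega>"
  shows "\<bar>fibre_mean \<omega> (l + L) * fibre_mean \<omega> (l + L + k)
    - fibre_mean (\<lambda>i. \<omega> (i + l)) L * fibre_mean (\<lambda>i. \<omega> (i + l)) (L + k)\<bar> \<le> 2 * M\<^sup>2 * decay L"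
proof -
  have w': "admissible (\<lambda>i. \<omega> (i + l))" by (rule admissible_shift[OF w])
  have "\<bar>fibre_mean \<omega> (l + (L + k)) - fibre_mean (\<lambda>i. \<omega> (i + l)) (L + k)\<bar> \<le> M * decay L"
    using fibre_mean_forget[OF w, of l "L + k"] decay_antimono[of L "L + k"] M_pos
      mult_left_mono[of "decay (L + k)" "decay L" M] by linarith
  then have "\<bar>fibre_mean \<omega> (l + L) * fibre_mean \<omega> (l + L + k)
    - fibre_mean (\<lambda>i. \<omega> (i + l)) L * fibre_mean (\<lambda>i. \<omega> (i + l)) (L + k)\<bar> \<le> M * (M * decay L) + M * (M * decay L)"
    using fibre_mean_forget[OF w, of l L] fibre_mean_bound[OF w] fibre_mean_bound[OF w']
    by (intro abs_prod_diff_le) (auto simp: add.assoc)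
  then show ?thesis by (simp add: power2_eq_square)
qed

text \<open>The last k maps agree for both sequences, so the mixed moments are integrals of one
  function, bounded by M^2, of the position at time l + L respectively L; the products of means
  contribute the remaining 2 M^2.\<close>

lemma fibre_cov_forget:
  assumes w: "admissible \<omega>"
  shows "\<bar>fibre_cov \<omega> (l + L) (l + L + k) - fibre_cov (\<lambda>i. \<omega> (i + l)) L (L + k)\<bar> \<le> 3 * M\<^sup>2 * decay L"
proof -
  let ?w = "\<lambda>i. \<omega> (i + l)" and ?v = "\<lambda>i. \<omega> (i + (l + L))"
  have w': "admissible ?w" and v: "admissible ?v" by (rule admissible_shift[OF w])+
  let ?G = "\<lambda>y. \<phi> y * \<phi> (random_orbit ?v k y)"
  have Gm: "?G \<in> borel_measurable unit_lebesgue"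
    by (intro borel_measurable_times measurable_phi measurable_compose_random_orbit[OF v])
  have Gb: "\<bar>?G x\<bar> \<le> M * M" if "x \<in> {0..1}" for x
    unfolding abs_mult using phi_bound[OF that] phi_bound[OF random_orbit_unit[OF v that]] M_pos
    by (intro mult_mono) auto
  have "obs \<phi> (l + L) \<omega> x * obs \<phi> (l + L + k) \<omega> x = ?G (random_orbit \<omega> (l + L) x)" for x
    unfolding obs_def by (simp only: random_orbit_add[of \<omega> "l + L" k x])
  moreover have "obs \<phi> L ?w x * obs \<phi> (L + k) ?w x = ?G (random_orbit ?w L x)" for x
    unfolding obs_def random_orbit_add[of ?w L k x] by (simp add: add.assoc add.commute add.left_commute)
  ultimately have "\<bar>(LINT x|unit_lebesgue. obs \<phi> (l + L) \<omega> x * obs \<phi> (l + L + k) \<omega> x)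
      - (LINT x|unit_lebesgue. obs \<phi> L ?w x * obs \<phi> (L + k) ?w x)\<bar> \<le> M * M * decay L"
    using forget_past[OF w Gm Gb, of l L] by simp
  then show ?thesis
    using fibre_mean_prod_forget[OF w, of l L k]
    unfolding fibre_cov_eq[OF w] fibre_cov_eq[OF w'] power2_eq_square by (simp add: abs_if split: if_splits)
qed

lemma fibre_cov_abs_le: "admissible \<omega> \<Longrightarrow> \<bar>fibre_cov \<omega> i j\<bar> \<le> 120 * M\<^sup>2 * decay 0"
  using fibre_cov_bound'[of \<omega> i j] decay_antimono[of 0 "max i j - min i j"]
    mult_left_mono[of "decay (max i j - min i j)" "decay 0" "120 * M\<^sup>2"] by simp

lemma mixing_fibre_cov:
  "noise.shift_mixing (\<lambda>i \<omega>. fibre_cov \<omega> i (i + k)) k (120 * M\<^sup>2 * decay 0) (\<lambda>L. 3 * M\<^sup>2 * decay L)"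
  unfolding noise.shift_mixing_def
  using measurable_fibre_cov fibre_cov_abs_le[OF admissible_noise] fibre_cov_forget[OF admissible_noise] fibre_cov_cong
  by blast

lemma mixing_fibre_mean:
  "noise.shift_mixing (\<lambda>i \<omega>. fibre_mean \<omega> i) 0 M (\<lambda>L. M * decay L)"
  unfolding noise.shift_mixing_def add_0_right
  using measurable_fibre_mean fibre_mean_bound[OF admissible_noise] fibre_mean_forget[OF admissible_noise] fibre_mean_cong
  by blast

lemma mixing_fibre_mean_prod:
  "noise.shift_mixing (\<lambda>i \<omega>. fibre_mean \<omega> i * fibre_mean \<omega> (i + k)) k (M * M) (\<lambda>L. 2 * M\<^sup>2 * decay L)"
  unfolding noise.shift_mixing_def
proof (intro conjI allI ballI impI)
  show "(\<lambda>\<omega>. fibre_mean \<omega> i * fibre_mean \<omega> (i + k)) \<in> borel_measurable noise.S" for i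
    by (intro borel_measurable_times measurable_fibre_mean)
  show "\<bar>fibre_mean \<omega> i * fibre_mean \<omega> (i + k)\<bar> \<le> M * M" if "\<omega> \<in> space noise.S" for i \<omega>
    unfolding abs_mult using fibre_mean_bound[OF admissible_noise[OF that]] M_pos by (intro mult_mono) auto
  show "fibre_mean \<omega> i * fibre_mean \<omega> (i + k) = fibre_mean \<omega>' i * fibre_mean \<omega>' (i + k)"
    if "\<forall>j<i + k. \<omega> j = \<omega>' j" for i \<omega> \<omega>'
    using fibre_mean_cong[of i \<omega> \<omega>'] fibre_mean_cong[of "i + k" \<omega> \<omega>'] that by simp
qed (rule fibre_mean_prod_forget[OF admissible_noise])

lemma summable_decay_cmult: "summable (\<lambda>L. c * decay L)"
  by (rule summable_mult[OF summable_decay])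

lemma mean_fibre_cov_eq: "mean_fibre_cov \<Omega> p \<phi> k i = (LINT \<omega>|noise.S. fibre_cov \<omega> i (i + k))"
  unfolding mean_fibre_cov_def noise_eq
  by (intro Bochner_Integration.integral_cong refl) (simp add: fibre_cov_eq[OF admissible_noise] fibre_mean_def)

lemma convergent_mean_fibre_cov: "convergent (mean_fibre_cov \<Omega> p \<phi> k)"
  using noise.convergent_mean_mixing[OF mixing_fibre_cov summable_LIMSEQ_zero[OF summable_decay_cmult], of k]
  by (simp add: mean_fibre_cov_eq[abs_def])

section \<open>Averaged covariances and the almost sure variance\<close>

definition mean_cov :: "nat \<Rightarrow> nat \<Rightarrow> real" where
  "mean_cov i j = (LINT \<omega>|noise.S. fibre_cov \<omega> i j)"

lemma integrable_fibre_cov: "integrable noise.S (\<lambda>\<omega>. fibre_cov \<omega> i j)"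
  using measurable_fibre_cov fibre_cov_abs_le[OF admissible_noise] by (rule noise.integrable_bounded_S)

lemma mean_cov_bound: "\<bar>mean_cov i (i + k)\<bar> \<le> 120 * M\<^sup>2 * decay k"
proof -
  have "\<bar>mean_cov i (i + k)\<bar> \<le> (LINT \<omega>|noise.S. \<bar>fibre_cov \<omega> i (i + k)\<bar>)"
    unfolding mean_cov_def by (rule integral_abs_bound)
  also have "\<dots> \<le> (LINT \<omega>|noise.S. 120 * M\<^sup>2 * decay k)"
    using integrable_fibre_cov fibre_cov_bound[OF admissible_noise] by (intro integral_mono) auto
  finally show ?thesis using noise.P.prob_space by simp
qed

lemma mean_cov_cesaro:
  "(\<lambda>n. (\<Sum>i=1..n. mean_cov i (i + k)) / real n) \<longlonglongrightarrow> Topological_Spaces.lim (mean_fibre_cov \<Omega> p \<phi> k)"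
  using cesaro_limit[of "mean_fibre_cov \<Omega> p \<phi> k"] convergent_mean_fibre_cov[of k]
  unfolding convergent_LIMSEQ_iff by (simp add: mean_fibre_cov_eq[abs_def] mean_cov_def)

lemma summable_variance_term: "summable (variance_term \<Omega> p \<phi>)"
  and mean_cov_limit: "(\<lambda>n. (\<Sum>i=1..n. \<Sum>j=1..n. mean_cov i j) / real n) \<longlonglongrightarrow> variance_series \<Omega> p \<phi>"
proof -
  have sym: "mean_cov i j = mean_cov j i" for i j
    unfolding mean_cov_def by (simp add: fibre_cov_commute)
  note * = double_cesaro[of mean_cov "\<lambda>k. 120 * M\<^sup>2 * decay k", OF sym mean_cov_bound summable_decay_cmult mean_cov_cesaro]
  show "summable (variance_term \<Omega> p \<phi>)"
    using *(1) by (simp add: variance_term_def[abs_def])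
  show "(\<lambda>n. (\<Sum>i=1..n. \<Sum>j=1..n. mean_cov i j) / real n) \<longlonglongrightarrow> variance_series \<Omega> p \<phi>"
    using *(2) by (simp only: variance_series_def variance_term_def)
qed

text \<open>The strong law is applied to each lag k separately. Only countably many null sets are
  discarded, and along the remaining sequences \<open>double_cesaro\<close> applies
  deterministically with the majorant from \<open>fibre_cov_bound\<close>.\<close>

lemma quenched_variance:
  "AE \<omega> in noise.S. (\<lambda>n. sum_var \<omega> {1..n} / real n) \<longlonglongrightarrow> variance_series \<Omega> p \<phi>"
proof -
  have "AE \<omega> in noise.S. \<forall>k. (\<lambda>n. (\<Sum>i=1..n. fibre_cov \<omega> i (i + k)) / real n) \<longlonglongrightarrow> Topological_Spaces.lim (mean_fibre_cov \<Omega> p \<phi> k)"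
    unfolding AE_all_countable
    using noise.strong_law_mixing_limit[OF mixing_fibre_cov summable_decay_cmult]
    by (simp add: mean_fibre_cov_eq[abs_def])
  then show ?thesis
  proof (rule AE_mp, intro AE_I2 impI)
    fix \<omega> assume w: "\<omega> \<in> space noise.S"
      and lim: "\<forall>k. (\<lambda>n. (\<Sum>i=1..n. fibre_cov \<omega> i (i + k)) / real n) \<longlonglongrightarrow> Topological_Spaces.lim (mean_fibre_cov \<Omega> p \<phi> k)"
    have "(\<lambda>n. (\<Sum>i=1..n. \<Sum>j=1..n. fibre_cov \<omega> i j) / real n) \<longlonglongrightarrow> variance_series \<Omega> p \<phi>"
      using double_cesaro(2)[of "fibre_cov \<omega>" "\<lambda>k. 120 * M\<^sup>2 * decay k", OF fibre_cov_commute
          fibre_cov_bound[OF admissible_noise[OF w]] summable_decay_cmult spec[OF lim]]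
      by (simp only: variance_series_def variance_term_def)
    then show "(\<lambda>n. sum_var \<omega> {1..n} / real n) \<longlonglongrightarrow> variance_series \<Omega> p \<phi>"
      by (simp only: sum_var_eq[OF admissible_noise[OF w]])
  qed
qed

definition fibre_mean_cov :: "nat \<Rightarrow> nat \<Rightarrow> real" where
  "fibre_mean_cov = noise.mixing_cov (\<lambda>i \<omega>. fibre_mean \<omega> i)"

text \<open>For each lag the covariance converges because the expected fibre means and their
  expected products converge. The i-th fibre mean depends on exactly the first i parameters, so d =
  0 and the mixing bound is 2 M^2 \<open>decay\<close> at every lag.\<close>

lemma fibre_mean_cov_limit: "convergent (\<lambda>n. (\<Sum>i=1..n. \<Sum>j=1..n. fibre_mean_cov i j) / real n)"
proof -
  note null = summable_LIMSEQ_zero[OF summable_decay_cmult]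
  note def = fibre_mean_cov_def noise.mixing_cov_def[OF mixing_fibre_mean]
  have "convergent (\<lambda>i. fibre_mean_cov i (i + k))" for k
  proof -
    have "convergent (\<lambda>i. LINT \<omega>|noise.S. fibre_mean \<omega> i)"
      by (rule noise.convergent_mean_mixing[OF mixing_fibre_mean null])
    moreover from this have "convergent (\<lambda>i. LINT \<omega>|noise.S. fibre_mean \<omega> (i + k))"
      by (subst convergent_ignore_initial_segment)
    moreover have "convergent (\<lambda>i. LINT \<omega>|noise.S. fibre_mean \<omega> i * fibre_mean \<omega> (i + k))"
      by (rule noise.convergent_mean_mixing[OF mixing_fibre_mean_prod null])
    ultimately show ?thesis unfolding def by (intro convergent_diff convergent_mult)
  qed
  then have lim: "(\<lambda>n. (\<Sum>i=1..n. fibre_mean_cov i (i + k)) / real n) \<longlonglongrightarrow> Topological_Spaces.lim (\<lambda>i. fibre_mean_cov i (i + k))" for k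
    by (intro cesaro_limit) (simp add: convergent_LIMSEQ_iff)
  have bnd: "\<bar>fibre_mean_cov i (i + k)\<bar> \<le> 2 * M * M * decay k" for i k
    using noise.covariance_mixing_bound[OF mixing_fibre_mean, of i k] unfolding def by (simp add: mult.assoc)
  have sym: "fibre_mean_cov i j = fibre_mean_cov j i" for i j
    unfolding fibre_mean_cov_def by (rule noise.mixing_cov_commute[OF mixing_fibre_mean])
  show ?thesis
    using double_cesaro(2)[of fibre_mean_cov "\<lambda>k. 2 * M * M * decay k", OF sym bnd summable_decay_cmult lim]
    by (rule convergentI)
qed

section \<open>The annealed variance and the law of total variance\<close>

sublocale joint: pair_prob_space noise.S unit_lebesgue ..

lemma measurable_birkhoff_joint:
  "(\<lambda>z. birkhoff_sum \<phi> n (fst z) (snd z)) \<in> borel_measurable (noise.S \<Otimes>\<^sub>M unit_lebesgue)"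
  unfolding birkhoff_sum_def by (intro borel_measurable_sum measurable_obs_joint)

lemma birkhoff_bound:
  assumes "admissible \<omega>" "x \<in> {0..1}"
  shows "\<bar>birkhoff_sum \<phi> n \<omega> x\<bar> \<le> real n * M"
proof -
  have "\<bar>birkhoff_sum \<phi> n \<omega> x\<bar> \<le> (\<Sum>j=1..n. \<bar>obs \<phi> j \<omega> x\<bar>)" unfolding birkhoff_sum_def by (rule sum_abs)
  also have "\<dots> \<le> real (card {1..n}) * M" using obs_bound[OF assms] by (intro sum_bounded_above)
  finally show ?thesis by simp
qed

lemma fibre_integral_birkhoff:
  "admissible \<omega> \<Longrightarrow> (LINT x|unit_lebesgue. birkhoff_sum \<phi> n \<omega> x) = (\<Sum>j=1..n. fibre_mean \<omega> j)"
  unfolding birkhoff_sum_def fibre_mean_def using integrable_obs by (intro Bochner_Integration.integral_sum)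

lemma integrable_fibre_mean: "integrable noise.S (\<lambda>\<omega>. fibre_mean \<omega> j)"
  by (rule noise.integrable_mixing[OF mixing_fibre_mean])

lemma joint_integral:
  fixes f :: "(nat \<Rightarrow> real) \<Rightarrow> real \<Rightarrow> real"
  assumes m: "(\<lambda>z. f (fst z) (snd z)) \<in> borel_measurable (noise.S \<Otimes>\<^sub>M unit_lebesgue)"
    and b: "\<And>\<omega> x. admissible \<omega> \<Longrightarrow> x \<in> {0..1} \<Longrightarrow> \<bar>f \<omega> x\<bar> \<le> B"
  shows "(LINT z|(noise.S \<Otimes>\<^sub>M unit_lebesgue). f (fst z) (snd z)) = (LINT \<omega>|noise.S. LINT x|unit_lebesgue. f \<omega> x)"
proof -
  have "integrable (noise.S \<Otimes>\<^sub>M unit_lebesgue) (\<lambda>z. f (fst z) (snd z))"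
    using m b[OF admissible_noise]
    by (intro joint.integrable_const_bound[of _ B]) (auto intro!: AE_I2 simp: space_pair_measure simp del: atLeastAtMost_iff)
  from joint.integral_fst'[OF this] show ?thesis by simp
qed

lemma annealed_mean_eq: "annealed_mean \<Omega> p \<phi> n = (\<Sum>j=1..n. LINT \<omega>|noise.S. fibre_mean \<omega> j)"
proof -
  have "annealed_mean \<Omega> p \<phi> n = (LINT \<omega>|noise.S. LINT x|unit_lebesgue. birkhoff_sum \<phi> n \<omega> x)"
    unfolding annealed_mean_def noise_eq by (rule joint_integral[OF measurable_birkhoff_joint birkhoff_bound])
  also have "\<dots> = (LINT \<omega>|noise.S. (\<Sum>j=1..n. fibre_mean \<omega> j))"
    by (intro Bochner_Integration.integral_cong refl fibre_integral_birkhoff admissible_noise)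
  also have "\<dots> = (\<Sum>j=1..n. LINT \<omega>|noise.S. fibre_mean \<omega> j)"
    using integrable_fibre_mean by (intro Bochner_Integration.integral_sum)
  finally show ?thesis .
qed

lemma fibre_mean_deviation:
  "admissible \<omega> \<Longrightarrow> (LINT x|unit_lebesgue. birkhoff_sum \<phi> n \<omega> x) - annealed_mean \<Omega> p \<phi> n
    = (\<Sum>j=1..n. fibre_mean \<omega> j - (LINT \<omega>|noise.S. fibre_mean \<omega> j))"
  by (simp add: fibre_integral_birkhoff annealed_mean_eq sum_subtractf)

lemma fibre_mean_L2_sq_eq: "fibre_mean_L2_sq \<Omega> p \<phi> n = (\<Sum>i=1..n. \<Sum>j=1..n. fibre_mean_cov i j)"
proof -
  have "fibre_mean_L2_sq \<Omega> p \<phi> n = (LINT \<omega>|noise.S. (\<Sum>j=1..n. fibre_mean \<omega> j - (LINT \<omega>|noise.S. fibre_mean \<omega> j))\<^sup>2)"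
    unfolding fibre_mean_L2_sq_def noise_eq
    by (intro Bochner_Integration.integral_cong refl) (simp only: fibre_mean_deviation admissible_noise)
  also have "\<dots> = (\<Sum>i=1..n. \<Sum>j=1..n. fibre_mean_cov i j)"
    unfolding fibre_mean_cov_def by (rule noise.variance_mixing_sum[OF mixing_fibre_mean])
  finally show ?thesis .
qed

text \<open>In each fibre the deviation from the global mean is the centred sum plus a constant. The
  mixed term integrates to zero over the fibre, and the squared constants integrate to
  \<open>fibre_mean_L2_sq\<close>.\<close>

lemma total_variance:
  "annealed_L2_sq \<Omega> p \<phi> n = (\<Sum>i=1..n. \<Sum>j=1..n. mean_cov i j) + fibre_mean_L2_sq \<Omega> p \<phi> n"
proof -
  let ?\<mu> = "annealed_mean \<Omega> p \<phi> n"
  let ?m = "\<lambda>\<omega>. (LINT x|unit_lebesgue. birkhoff_sum \<phi> n \<omega> x) - ?\<mu>"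
  have fibre: "(LINT x|unit_lebesgue. (birkhoff_sum \<phi> n \<omega> x - ?\<mu>)\<^sup>2) = (\<Sum>i=1..n. \<Sum>j=1..n. fibre_cov \<omega> i j) + (?m \<omega>)\<^sup>2"
    if w: "admissible \<omega>" for \<omega>
  proof -
    let ?S = "centred_sum \<omega> {1..n}"
    have S: "birkhoff_sum \<phi> n \<omega> x - ?\<mu> = ?S x + ?m \<omega>" for x
      unfolding fibre_integral_birkhoff[OF w] by (simp add: birkhoff_sum_def centred_sum_def centred_def sum_subtractf)
    have i2: "integrable unit_lebesgue (\<lambda>x. (?S x)\<^sup>2)"
      using integrable_centred_sum_times[OF w] by (simp add: power2_eq_square)
    have "(LINT x|unit_lebesgue. (birkhoff_sum \<phi> n \<omega> x - ?\<mu>)\<^sup>2) = (LINT x|unit_lebesgue. (?S x)\<^sup>2 + 2 * ?m \<omega> * ?S x + (?m \<omega>)\<^sup>2)"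
      unfolding S by (simp add: power2_eq_square algebra_simps)
    also have "\<dots> = sum_var \<omega> {1..n} + (?m \<omega>)\<^sup>2"
      using i2 integrable_centred_sum[OF w] integral_centred_sum[OF w] unit_lebesgue.prob_space by (simp add: sum_var_def)
    finally show ?thesis by (simp only: sum_var_eq[OF w])
  qed
  have b: "\<bar>(birkhoff_sum \<phi> n \<omega> x - ?\<mu>)\<^sup>2\<bar> \<le> (real n * M + \<bar>?\<mu>\<bar>)\<^sup>2" if "admissible \<omega>" "x \<in> {0..1}" for \<omega> x
  proof -
    have "\<bar>birkhoff_sum \<phi> n \<omega> x - ?\<mu>\<bar> \<le> real n * M + \<bar>?\<mu>\<bar>" using birkhoff_bound[OF that, of n] by linarith
    from power_mono[OF this abs_ge_zero, of 2] show ?thesis by simp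
  qed
  have "annealed_L2_sq \<Omega> p \<phi> n = (LINT \<omega>|noise.S. LINT x|unit_lebesgue. (birkhoff_sum \<phi> n \<omega> x - ?\<mu>)\<^sup>2)"
    unfolding annealed_L2_sq_def noise_eq
    by (rule joint_integral[OF _ b]) (intro borel_measurable_power borel_measurable_diff measurable_birkhoff_joint borel_measurable_const)
  also have "\<dots> = (LINT \<omega>|noise.S. (\<Sum>i=1..n. \<Sum>j=1..n. fibre_cov \<omega> i j) + (?m \<omega>)\<^sup>2)"
    by (intro Bochner_Integration.integral_cong refl fibre admissible_noise)
  also have "\<dots> = (LINT \<omega>|noise.S. (\<Sum>i=1..n. \<Sum>j=1..n. fibre_cov \<omega> i j)) + (LINT \<omega>|noise.S. (?m \<omega>)\<^sup>2)"
  proof (intro Bochner_Integration.integral_add Bochner_Integration.integrable_sum integrable_fibre_cov)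
    show "integrable noise.S (\<lambda>\<omega>. (?m \<omega>)\<^sup>2)"
    proof (rule noise.integrable_bounded_S)
      show "(\<lambda>\<omega>. (?m \<omega>)\<^sup>2) \<in> borel_measurable noise.S"
        by (intro borel_measurable_power borel_measurable_diff measurable_fibre_integral[OF measurable_birkhoff_joint] borel_measurable_const)
      fix \<omega> assume "\<omega> \<in> space noise.S"
      then have w: "admissible \<omega>" by (rule admissible_noise)
      have "\<bar>\<Sum>j=1..n. fibre_mean \<omega> j\<bar> \<le> (\<Sum>j=1..n. \<bar>fibre_mean \<omega> j\<bar>)" by (rule sum_abs)
      also have "\<dots> \<le> real (card {1..n}) * M" using fibre_mean_bound[OF w] by (intro sum_bounded_above)
      finally have "\<bar>?m \<omega>\<bar> \<le> real n * M + \<bar>?\<mu>\<bar>" unfolding fibre_integral_birkhoff[OF w] by simp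
      from power_mono[OF this abs_ge_zero, of 2] show "\<bar>(?m \<omega>)\<^sup>2\<bar> \<le> (real n * M + \<bar>?\<mu>\<bar>)\<^sup>2" by simp
    qed
  qed
  also have "(LINT \<omega>|noise.S. (\<Sum>i=1..n. \<Sum>j=1..n. fibre_cov \<omega> i j)) = (\<Sum>i=1..n. \<Sum>j=1..n. mean_cov i j)"
    unfolding mean_cov_def using integrable_fibre_cov by (simp add: Bochner_Integration.integral_sum)
  finally show ?thesis unfolding fibre_mean_L2_sq_def noise_eq .
qed

lemma convergent_fibre_mean_L2: "convergent (\<lambda>n. fibre_mean_L2_sq \<Omega> p \<phi> n / real n)"
  using fibre_mean_cov_limit by (simp add: fibre_mean_L2_sq_eq)

lemma annealed_L2_limit:
  "(\<lambda>n. annealed_L2_sq \<Omega> p \<phi> n / real n) \<longlonglongrightarrow>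
    variance_series \<Omega> p \<phi> + Topological_Spaces.lim (\<lambda>n. fibre_mean_L2_sq \<Omega> p \<phi> n / real n)"
  using tendsto_add[OF mean_cov_limit iffD1[OF convergent_LIMSEQ_iff convergent_fibre_mean_L2]]
  by (simp add: total_variance add_divide_distrib)

lemma quenched_clt:
  assumes "0 < variance_series \<Omega> p \<phi>"
  shows "AE \<omega> in noise \<Omega> p.
     weak_conv_m
       (\<lambda>n. distr unit_lebesgue borel
          (\<lambda>x. 1 / sqrt (real n) *
             (\<Sum>j=1..n. \<phi> (random_orbit \<omega> j x)
                - (LINT y|unit_lebesgue. \<phi> (random_orbit \<omega> j y)))))
       (density lborel (normal_density 0 (sqrt (variance_series \<Omega> p \<phi>))))"
  unfolding noise_eq using quenched_variance
  by (rule AE_mp) (intro AE_I2 impI clt_fixed_sequence admissible_noise assms)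

end

text \<open>The mean value estimate with bounds from compactness; the maximum with 1 makes M
  positive also when \<phi> vanishes.\<close>

lemma C1_imp_bounded_lipschitz:
  assumes C1: "\<And>x. x \<in> {0..1} \<Longrightarrow> (\<phi> has_real_derivative \<phi>' x) (at x within {0..1})"
      "continuous_on {0..1} \<phi>'"
  obtains M where "0 < M" "bounded_lipschitz M \<phi>"
proof -
  have "bounded (\<phi>' ` {0..1})" "bounded (\<phi> ` {0..1})"
    using C1 DERIV_continuous_on[of "{0..1}" \<phi> \<phi>'] by (auto intro!: compact_imp_bounded compact_continuous_image)
  then obtain K1 K2 where "\<forall>y\<in>\<phi>' ` {0..1}. norm y \<le> K1" "\<forall>y\<in>\<phi> ` {0..1}. norm y \<le> K2"
    unfolding bounded_iff by blast
  then have K: "\<bar>\<phi>' x\<bar> \<le> K1" "\<bar>\<phi> x\<bar> \<le> K2" if "x \<in> {0..1}" for x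
    using that unfolding real_norm_def by blast+
  define M where "M = max 1 (max K1 K2)"
  have "\<bar>\<phi> x - \<phi> y\<bar> \<le> M * \<bar>x - y\<bar>" if "x \<in> {0..1}" "y \<in> {0..1}" for x y
    using field_differentiable_bound[of "{0..1}" \<phi> \<phi>' M x y] C1(1) K(1) that
    by (auto simp: M_def le_max_iff_disj)
  moreover have "\<bar>\<phi> x\<bar> \<le> M" if "x \<in> {0..1}" for x using K(2)[OF that] by (simp add: M_def)
  ultimately have "bounded_lipschitz M \<phi>" by (simp add: bounded_lipschitz_def)
  then show thesis by (intro that[of M]) (auto simp: M_def)
qed

text \<open>\<open>lim\<close> and infinite sums are total functions, so convergence and summability
  are asserted alongside the values. Positivity is asked of \<open>variance_series\<close> because
  it is the variance of the quenched limit law; the annealed variance exceeds it by the limiting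
  variance of the fibre means.\<close>

theorem proposition5p1:
  fixes \<alpha> :: real and \<Omega> :: "real set" and p \<phi> \<phi>' :: "real \<Rightarrow> real"
  assumes alpha: "0 < \<alpha>" "\<alpha> < 1/2"
    and Omega: "finite \<Omega>" "\<Omega> \<subseteq> {0<..<\<alpha>}"
    and prob: "\<And>\<beta>. \<beta> \<in> \<Omega> \<Longrightarrow> 0 \<le> p \<beta>" "(\<Sum>\<beta>\<in>\<Omega>. p \<beta>) = 1"
    and C1: "\<And>x. x \<in> {0..1} \<Longrightarrow> (\<phi> has_real_derivative \<phi>' x) (at x within {0..1})"
      "continuous_on {0..1} \<phi>'"
  shows "(\<forall>k. convergent (mean_fibre_cov \<Omega> p \<phi> k))
    \<and> summable (variance_term \<Omega> p \<phi>)
    \<and> convergent (\<lambda>n. annealed_L2_sq \<Omega> p \<phi> n / real n)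
    \<and> convergent (\<lambda>n. fibre_mean_L2_sq \<Omega> p \<phi> n / real n)
    \<and> annealed_variance \<Omega> p \<phi>
        = variance_series \<Omega> p \<phi> + lim (\<lambda>n. fibre_mean_L2_sq \<Omega> p \<phi> n / real n)
    \<and> (variance_series \<Omega> p \<phi> > 0 \<longrightarrow>
        (AE \<omega> in noise \<Omega> p.
           weak_conv_m
             (\<lambda>n. distr unit_lebesgue borel
                (\<lambda>x. 1 / sqrt (real n) *
                   (\<Sum>j=1..n. \<phi> (random_orbit \<omega> j x)
                      - (LINT y|unit_lebesgue. \<phi> (random_orbit \<omega> j y)))))
             (density lborel (normal_density 0 (sqrt (variance_series \<Omega> p \<phi>))))))"
proof -
  obtain M where M: "0 < M" "bounded_lipschitz M \<phi>"
    using C1_imp_bounded_lipschitz[OF C1] by blast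
  interpret random_intermittent \<alpha> \<phi> M \<Omega> p
    by unfold_locales (use alpha Omega prob M in auto)
  show ?thesis
    unfolding annealed_variance_def
    using convergent_mean_fibre_cov summable_variance_term convergentI[OF annealed_L2_limit]
      convergent_fibre_mean_L2 limI[OF annealed_L2_limit] quenched_clt
    by blast
qed

end
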